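(* Let $(\mathcal{S},\mathcal{A},P,r)$ be a weakly communicating MDP with finite state space $\mathcal{S}$ ($S=|\mathcal{S}|$), finite action space $\mathcal{A}$ ($A=|\mathcal{A}|$), unknown transition kernel $P$ and known reward $r:\mathcal{S}\times\mathcal{A}\to[0,1]$. Fix $\delta\in(0,1)$ and a positive integer $n$, and run the following algorithm (Algorithm 1). For every $(s,a)$ draw $n$ i.i.d. samples $S^1_{s,a},\dots,S^n_{s,a}\sim P(\cdot\mid s,a)$ and set $\widehat P(s'\mid s,a)=\frac1n\sum_{i=1}^n\mathbb{I}\{S^i_{s,a}=s'\}$. Let $\mathcal{H}=\{\gamma:\ \tfrac{1}{1-\gamma}=2^k \text{ for some integer } k,\ \sqrt n\le \tfrac{1}{1-\gamma}\le n\}$. For each $\gamma\in\mathcal{H}$, let $(\widetilde\pi_\gamma,\widetilde V_\gamma)=\textsc{SolveDMDP}(\widehat P,r,\gamma,\tfrac1n)$ and $$\widehat L(\gamma)=(1-\gamma)\min_s\widetilde V_\gamma(s)-2\frac{1-\gamma}{n}-\alpha(\delta,n)\sqrt{\frac{\|\widetilde V_\gamma\|_{\mathrm{sp}}+\frac3n+1}{n}}.$$ Let $\widehat\gamma\in\arg\max_{\gamma\in\mathcal{H}}\widehat L(\gamma)$ and output $\widehat\pi=\widetilde\pi_{\widehat\gamma}$ and $\widehat\rho=\max\{\widehat L(\widehat\gamma),0\}\mathbf 1$. Then there is an absolute constant $C_3$ such that with probability at least $1-\delta$, elementwise, $$\rho^{\widehat\pi}\ \ge\ \widehat\rho\ \ge\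 \rho^\star-C_3\,\alpha(\delta,n)^2\sqrt{\frac{\|h^\star\|_{\mathrm{sp}}+1}{n}}\,\mathbf 1.$$
   Context: Policies are stationary Markovian $\pi:\mathcal{S}\to\Delta(\mathcal{A})$. For a transition kernel $Q$, discount $\gamma\in(0,1)$ and policy $\pi$, the discounted value is $V^\pi_\gamma(s)=\mathbb{E}^\pi_s[\sum_{t\ge0}\gamma^t r(S_t,A_t)]$; $\widehat V^\pi_\gamma,\widehat V^\star_\gamma$ denote the value of $\pi$ and optimal value in the DMDP $(\widehat P,r,\gamma)$. $\textsc{SolveDMDP}(\widehat P,r,\gamma,\frac1n)$ is any subroutine returning a deterministic policy $\widetilde\pi_\gamma$ and vector $\widetilde V_\gamma$ with $\widehat V^{\widetilde\pi_\gamma}_\gamma\ge\widehat V^\star_\gamma-\frac1n\mathbf 1$ and $\|\widetilde V_\gamma-\widehat V^\star_\gamma\|_\infty\le\frac1n$. The gain is $\rho^\pi(s)=\lim_{T\to\infty}\frac1T\mathbb{E}^\pi_s[\sum_{t=0}^{T-1}r(S_t,A_t)]$ and bias $h^\pi(s)=\mathrm{C}\text{-}\lim_{T\to\infty}\mathbb{E}^\pi_s[\sum_{t=0}^{T-1}(r(S_t,A_t)-\rho^\pi(S_t))]$ (Cesàro limit). $\rho^\star=\sup_\pi\rho^\pi$ (constant in weakly communicating MDPs), $h^\star=h^{\pi^\star}$ for a Blackwell-optimal policy $\pi^\star$ (one that is optimal in the $\gamma$-discounted problem for all $\gamma$ sufficiently close to 1). $\|x\|_{\mathrm{sp}}=\max_s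 x(s)-\min_s x(s)$. $\mathbf 1$ is the all-ones vector. $\alpha(\delta,n)=96\sqrt{\log(24SAn^5/\delta)}\,\log_2(\log_2(n+4))$. A weakly communicating MDP is one whose states split into a set transient under every stationary policy and a set in which every state can reach every other with probability 1 under some policy. *)

theory Defs
  imports "HOL-Probability.Probability"
begin

(* States are {..<S}, actions {..<A} (explicit carriers so that the constant C3
   can be quantified before S and A).  A transition kernel is P s a :: nat pmf. *)

definition valid_kernel :: "nat \<Rightarrow> nat \<Rightarrow> (nat \<Rightarrow> nat \<Rightarrow> nat pmf) \<Rightarrow> bool" where
  "valid_kernel S A P \<longleftrightarrow> (\<forall>s<S. \<forall>a<A. set_pmf (P s a) \<subseteq> {..<S})"

definition valid_policy :: "nat \<Rightarrow> nat \<Rightarrow> (nat \<Rightarrow> nat pmf) \<Rightarrow> bool" where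
  "valid_policy S A \<pi> \<longleftrightarrow> (\<forall>s<S. set_pmf (\<pi> s) \<subseteq> {..<A})"

definition det_pol :: "(nat \<Rightarrow> nat) \<Rightarrow> nat \<Rightarrow> nat pmf" where
  "det_pol d = (\<lambda>s. return_pmf (d s))"

definition pol_step :: "(nat \<Rightarrow> nat \<Rightarrow> nat pmf) \<Rightarrow> (nat \<Rightarrow> nat pmf) \<Rightarrow> nat \<Rightarrow> nat pmf" where
  "pol_step P \<pi> s = bind_pmf (\<pi> s) (P s)"

fun state_dist :: "(nat \<Rightarrow> nat \<Rightarrow> nat pmf) \<Rightarrow> (nat \<Rightarrow> nat pmf) \<Rightarrow> nat \<Rightarrow> nat \<Rightarrow> nat pmf" where
  "state_dist P \<pi> s 0 = return_pmf s"
| "state_dist P \<pi> s (Suc t) = bind_pmf (state_dist P \<pi> s t) (pol_step P \<pi>)"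

definition exp_at :: "(nat \<Rightarrow> nat \<Rightarrow> nat pmf) \<Rightarrow> (nat \<Rightarrow> nat \<Rightarrow> real) \<Rightarrow> (nat \<Rightarrow> nat pmf)
    \<Rightarrow> nat \<Rightarrow> nat \<Rightarrow> real" where
  "exp_at P f \<pi> s t = measure_pmf.expectation (state_dist P \<pi> s t)
       (\<lambda>x. measure_pmf.expectation (\<pi> x) (f x))"

definition disc_value :: "(nat \<Rightarrow> nat \<Rightarrow> nat pmf) \<Rightarrow> (nat \<Rightarrow> nat \<Rightarrow> real) \<Rightarrow> (nat \<Rightarrow> nat pmf)
    \<Rightarrow> real \<Rightarrow> nat \<Rightarrow> real" where
  "disc_value P r \<pi> \<gamma> s = (\<Sum>t. \<gamma> ^ t * exp_at P r \<pi> s t)"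

definition opt_disc_value :: "nat \<Rightarrow> nat \<Rightarrow> (nat \<Rightarrow> nat \<Rightarrow> nat pmf) \<Rightarrow> (nat \<Rightarrow> nat \<Rightarrow> real)
    \<Rightarrow> real \<Rightarrow> nat \<Rightarrow> real" where
  "opt_disc_value S A P r \<gamma> s = (SUP \<pi>\<in>{\<pi>. valid_policy S A \<pi>}. disc_value P r \<pi> \<gamma> s)"

definition gain :: "(nat \<Rightarrow> nat \<Rightarrow> nat pmf) \<Rightarrow> (nat \<Rightarrow> nat \<Rightarrow> real) \<Rightarrow> (nat \<Rightarrow> nat pmf)
    \<Rightarrow> nat \<Rightarrow> real" where
  "gain P r \<pi> s = lim (\<lambda>T. (1 / real T) * (\<Sum>t<T. exp_at P r \<pi> s t))"

definition cesaro_lim :: "(nat \<Rightarrow> real) \<Rightarrow> real" where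
  "cesaro_lim b = lim (\<lambda>N. (1 / real N) * (\<Sum>T=1..N. b T))"

definition bias :: "(nat \<Rightarrow> nat \<Rightarrow> nat pmf) \<Rightarrow> (nat \<Rightarrow> nat \<Rightarrow> real) \<Rightarrow> (nat \<Rightarrow> nat pmf)
    \<Rightarrow> nat \<Rightarrow> real" where
  "bias P r \<pi> s = cesaro_lim (\<lambda>T. \<Sum>t<T.
       exp_at P (\<lambda>x a. r x a - gain P r \<pi> x) \<pi> s t)"

definition opt_gain :: "nat \<Rightarrow> nat \<Rightarrow> (nat \<Rightarrow> nat \<Rightarrow> nat pmf) \<Rightarrow> (nat \<Rightarrow> nat \<Rightarrow> real) \<Rightarrow> nat \<Rightarrow> real" where
  "opt_gain S A P r s = (SUP \<pi>\<in>{\<pi>. valid_policy S A \<pi>}. gain P r \<pi> s)"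

definition blackwell_optimal :: "nat \<Rightarrow> nat \<Rightarrow> (nat \<Rightarrow> nat \<Rightarrow> nat pmf) \<Rightarrow> (nat \<Rightarrow> nat \<Rightarrow> real)
    \<Rightarrow> (nat \<Rightarrow> nat pmf) \<Rightarrow> bool" where
  "blackwell_optimal S A P r \<pi> \<longleftrightarrow> valid_policy S A \<pi> \<and>
     (\<exists>\<gamma>0<1. \<forall>\<gamma>. \<gamma>0 < \<gamma> \<and> \<gamma> < 1 \<longrightarrow>
        (\<forall>\<pi>'. valid_policy S A \<pi>' \<longrightarrow> (\<forall>s<S. disc_value P r \<pi>' \<gamma> s \<le> disc_value P r \<pi> \<gamma> s)))"

(* taboo probabilities: taboo S M s s' t y = probability that the chain with
   transition matrix M started at s is at y at time t and did not visit s'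
   at any time 1..t-1 *)
fun taboo :: "nat \<Rightarrow> (nat \<Rightarrow> nat \<Rightarrow> real) \<Rightarrow> nat \<Rightarrow> nat \<Rightarrow> nat \<Rightarrow> nat \<Rightarrow> real" where
  "taboo S M s s' 0 y = (if y = s then 1 else 0)"
| "taboo S M s s' (Suc t) y =
     (\<Sum>x<S. (if t \<noteq> 0 \<and> x = s' then 0 else taboo S M s s' t x) * M x y)"

definition hit_prob :: "nat \<Rightarrow> (nat \<Rightarrow> nat \<Rightarrow> nat pmf) \<Rightarrow> (nat \<Rightarrow> nat pmf) \<Rightarrow> nat \<Rightarrow> nat \<Rightarrow> real" where
  "hit_prob S P \<pi> s s' = (\<Sum>t. taboo S (\<lambda>x y. pmf (pol_step P \<pi> x) y) s s' (Suc t) s')"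

definition transient :: "nat \<Rightarrow> (nat \<Rightarrow> nat \<Rightarrow> nat pmf) \<Rightarrow> (nat \<Rightarrow> nat pmf) \<Rightarrow> nat \<Rightarrow> bool" where
  "transient S P \<pi> s \<longleftrightarrow> hit_prob S P \<pi> s s < 1"

definition weakly_communicating :: "nat \<Rightarrow> nat \<Rightarrow> (nat \<Rightarrow> nat \<Rightarrow> nat pmf) \<Rightarrow> bool" where
  "weakly_communicating S A P \<longleftrightarrow> (\<exists>C \<subseteq> {..<S}.
     (\<forall>s\<in>{..<S} - C. \<forall>\<pi>. valid_policy S A \<pi> \<longrightarrow> transient S P \<pi> s) \<and>
     (\<forall>s\<in>C. \<forall>s'\<in>C. s \<noteq> s' \<longrightarrow>
        (\<exists>\<pi>. valid_policy S A \<pi> \<and> hit_prob S P \<pi> s s' = 1)))"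

definition sp_norm :: "nat \<Rightarrow> (nat \<Rightarrow> real) \<Rightarrow> real" where
  "sp_norm S x = Max (x ` {..<S}) - Min (x ` {..<S})"

definition alpha :: "nat \<Rightarrow> nat \<Rightarrow> real \<Rightarrow> nat \<Rightarrow> real" where
  "alpha S A \<delta> n = 96 * sqrt (ln (24 * real S * real A * real n ^ 5 / \<delta>))
                    * log 2 (log 2 (real n + 4))"

definition solver_spec :: "nat \<Rightarrow> nat \<Rightarrow> (nat \<Rightarrow> nat \<Rightarrow> real) \<Rightarrow> nat
    \<Rightarrow> ((nat \<Rightarrow> nat \<Rightarrow> nat pmf) \<Rightarrow> real \<Rightarrow> (nat \<Rightarrow> nat) \<times> (nat \<Rightarrow> real)) \<Rightarrow> bool" where
  "solver_spec S A r n solve \<longleftrightarrow> (\<forall>Q \<gamma>. valid_kernel S A Q \<and> 0 \<le> \<gamma> \<and> \<gamma> < 1 \<longrightarrow>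
     (\<forall>s<S. fst (solve Q \<gamma>) s < A) \<and>
     (\<forall>s<S. disc_value Q r (det_pol (fst (solve Q \<gamma>))) \<gamma> s \<ge> opt_disc_value S A Q r \<gamma> s - 1 / real n) \<and>
     (\<forall>s<S. \<bar>snd (solve Q \<gamma>) s - opt_disc_value S A Q r \<gamma> s\<bar> \<le> 1 / real n))"

definition samples :: "nat \<Rightarrow> nat \<Rightarrow> nat \<Rightarrow> (nat \<Rightarrow> nat \<Rightarrow> nat pmf) \<Rightarrow> (nat \<times> nat \<times> nat \<Rightarrow> nat) pmf" where
  "samples S A n P = Pi_pmf ({..<S} \<times> {..<A} \<times> {..<n}) 0 (\<lambda>(s, a, i). P s a)"

definition emp_kernel :: "nat \<Rightarrow> (nat \<times> nat \<times> nat \<Rightarrow> nat) \<Rightarrow> nat \<Rightarrow> nat \<Rightarrow> nat pmf" where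
  "emp_kernel n \<omega> s a = map_pmf (\<lambda>i. \<omega> (s, a, i)) (pmf_of_set {..<n})"

definition gamma_grid :: "nat \<Rightarrow> real set" where
  "gamma_grid n = {\<gamma>. \<gamma> < 1 \<and> (\<exists>k::int. 1 / (1 - \<gamma>) = 2 powr real_of_int k) \<and>
                       sqrt (real n) \<le> 1 / (1 - \<gamma>) \<and> 1 / (1 - \<gamma>) \<le> real n}"

definition L_hat :: "nat \<Rightarrow> nat \<Rightarrow> real \<Rightarrow> nat
    \<Rightarrow> ((nat \<Rightarrow> nat \<Rightarrow> nat pmf) \<Rightarrow> real \<Rightarrow> (nat \<Rightarrow> nat) \<times> (nat \<Rightarrow> real))
    \<Rightarrow> (nat \<times> nat \<times> nat \<Rightarrow> nat) \<Rightarrow> real \<Rightarrow> real" where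
  "L_hat S A \<delta> n solve \<omega> \<gamma> =
     (let V = snd (solve (emp_kernel n \<omega>) \<gamma>) in
      (1 - \<gamma>) * Min (V ` {..<S}) - 2 * (1 - \<gamma>) / real n
        - alpha S A \<delta> n * sqrt ((sp_norm S V + 3 / real n + 1) / real n))"

end

(*
  Fix the discount factor and let V be the optimal value of the empirical model Q. Integrating the
  Bellman equation of Q against the stationary law mu of the returned policy in the true model P
  shows that its gain is at least (1 - gamma) min V up to mu |(Q - P) V|. By Bernstein's inequality
  |(Q - P) V| is bounded by l * Var_P(V) + const / (l n) for a fixed rate l, and because mu is
  P-invariant, mu (Var_P V) = mu (V - P V)(V + P V) is at most of the order sp(V) (1 + mu |(Q - P) V|),
  linear and not quadratic in the span. With l of the order sqrt (1 / (n sp(V))) this gives an error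
  of the order sqrt (sp(V) / n), so the empirical quantity L-hat is a valid lower bound. V depends on
  the samples, so it is compared with value functions in which the value of the current state is
  pinned to a grid point.

  Conversely, integrate the average-reward optimality equation for the bias h of P against the
  discounted occupation law of Q. The same telescoping bounds (1 - gamma) V - rho by
  (1 - gamma) sp(h) plus an error of the order sqrt (sp(h) / n). At 1 / (1 - gamma) of the order
  sqrt (n sp(h)) this makes sp(V) of the order sp(h), and L-hat is close to rho.
*)
theory Submission
  imports Defs "Jordan_Normal_Form.Determinant"
begin

text \<open>Bernstein is kept in its unoptimised linear form because a linear bound survives
  integration: if x is the integrated error and sp the span, it gives x <= l * 2 * sp * (2 + x) + b,
  and once l * sp is small the x on the right is absorbed, so no a priori bound on the variance is
  required. When l * sp is not small, the claimed error exceeds 1 and the bound is trivial, since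
  gains and (1 - \<gamma>) V lie in [0, 1]. The rate has to follow the span of V and is therefore
  random. This is harmless as long as rate and test function are both independent of the samples
  they are tested on, which is what pinning achieves. A grid of mesh 1/n on [0, n] costs n^2 + 1
  events per discount factor and state-action pair, hence only a logarithm. The square of \<alpha>
  in the final bound has two sources: one factor is the explicit weight in \<open>L_hat\<close>, the
  other pays for the span of V, which is only known to be of order sqrt L * (sp(h) + 1). Weak
  communication enters once, to make the gain of a Blackwell-optimal policy constant.\<close>

section \<open>Cesaro limits and discounted occupation of a finite stochastic matrix\<close>

text \<open>The only use of matrix theory: a trivial kernel rules out a zero determinant, and the
  inverse matrix supplies the solution. It is applied to the fundamental matrix in
  \<open>poisson_equation\<close>.\<close>

lemma injective_imp_solvable:
  fixes M :: "nat \<Rightarrow> nat \<Rightarrow> real" and b :: "nat \<Rightarrow> real"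
  assumes inj: "\<And>v. (\<forall>x<n. (\<Sum>y<n. M x y * v y) = 0) \<Longrightarrow> \<forall>x<n. v x = 0"
  shows "\<exists>v. \<forall>x<n. (\<Sum>y<n. M x y * v y) = b x"
proof -
  define A where "A = mat n n (\<lambda>(i, j). M i j)"
  have A: "A \<in> carrier_mat n n" by (simp add: A_def)
  have mv: "vec_index (A *\<^sub>v v) x = (\<Sum>y<n. M x y * vec_index v y)" if "v \<in> carrier_vec n" "x < n" for v x
    using that by (simp add: A_def mult_mat_vec_def scalar_prod_def atLeast0LessThan)
  have "Determinant.det A \<noteq> 0"
  proof
    assume "Determinant.det A = 0"
    then obtain v where v: "v \<in> carrier_vec n" "v \<noteq> 0\<^sub>v n" "A *\<^sub>v v = 0\<^sub>v n"
      using det_0_iff_vec_prod_zero_field[OF A] by blast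
    have "\<forall>x<n. (\<Sum>y<n. M x y * vec_index v y) = 0"
      using mv[OF v(1)] v(3) by (metis index_zero_vec(1))
    then have "\<forall>x<n. vec_index v x = 0" by (rule inj)
    with v(1,2) show False by auto
  qed
  from det_non_zero_imp_unit[OF A this, where b = "()"]
  obtain B where B: "B \<in> carrier_mat n n" "A * B = 1\<^sub>m n"
    by (auto simp: Units_def ring_mat_def)
  define v where "v = B *\<^sub>v vec n b"
  have v: "v \<in> carrier_vec n" using B(1) by (simp add: v_def mult_mat_vec_carrier)
  have "A *\<^sub>v v = (A * B) *\<^sub>v vec n b"
    unfolding v_def by (rule assoc_mult_mat_vec[symmetric, OF A B(1)]) simp
  then have "A *\<^sub>v v = vec n b" by (simp add: B(2))
  then have "\<forall>x<n. (\<Sum>y<n. M x y * vec_index v y) = b x"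
    using mv[OF v] by auto
  then show ?thesis by blast
qed

text \<open>Subsequences are extracted one index after another; for a finite family no diagonal
  argument is involved.\<close>

lemma bounded_family_subseq:
  fixes a :: "'k \<Rightarrow> nat \<Rightarrow> real"
  assumes "finite K" "\<And>k t. k \<in> K \<Longrightarrow> \<bar>a k t\<bar> \<le> B"
  shows "\<exists>\<sigma>. strict_mono \<sigma> \<and> (\<forall>k\<in>K. convergent (\<lambda>t. a k (\<sigma> t)))"
  using assms
proof (induction K)
  case empty
  have "strict_mono (id :: nat \<Rightarrow> nat)" by (simp add: strict_mono_def)
  then show ?case by blast
next
  case (insert k K)
  then obtain \<sigma> where \<sigma>: "strict_mono \<sigma>" "\<And>j. j \<in> K \<Longrightarrow> convergent (\<lambda>t. a j (\<sigma> t))" by auto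
  have "bounded (range (\<lambda>t. a k (\<sigma> t)))"
    using insert.prems by (auto simp: bounded_iff)
  then obtain l \<tau> where \<tau>: "strict_mono \<tau>" "((\<lambda>t. a k (\<sigma> t)) \<circ> \<tau>) \<longlonglongrightarrow> l"
    using bounded_imp_convergent_subsequence by blast
  have "convergent (\<lambda>t. a j (\<sigma> (\<tau> t)))" if "j \<in> K" for j
    using convergent_subseq_convergent[OF \<sigma>(2)[OF that] \<tau>(1)] by (simp add: o_def)
  moreover have "convergent (\<lambda>t. a k (\<sigma> (\<tau> t)))"
    using \<tau>(2) by (auto simp: convergent_def o_def)
  ultimately have "\<forall>j\<in>insert k K. convergent (\<lambda>t. a j ((\<sigma> \<circ> \<tau>) t))" by (simp add: o_def)
  moreover have "strict_mono (\<sigma> \<circ> \<tau>)" using \<sigma>(1) \<tau>(1) by (rule strict_mono_o)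
  ultimately show ?case by blast
qed

section \<open>Powers, Cesaro averages and their limits\<close>

definition mv :: "nat \<Rightarrow> (nat \<Rightarrow> nat \<Rightarrow> real) \<Rightarrow> (nat \<Rightarrow> real) \<Rightarrow> nat \<Rightarrow> real" where
  "mv S M v x = (\<Sum>y<S. M x y * v y)"

fun mpow :: "nat \<Rightarrow> (nat \<Rightarrow> nat \<Rightarrow> real) \<Rightarrow> nat \<Rightarrow> nat \<Rightarrow> nat \<Rightarrow> real" where
  "mpow S M 0 x y = (if x = y then 1 else 0)"
| "mpow S M (Suc t) x y = (\<Sum>z<S. mpow S M t x z * M z y)"

definition mavg :: "nat \<Rightarrow> (nat \<Rightarrow> nat \<Rightarrow> real) \<Rightarrow> nat \<Rightarrow> nat \<Rightarrow> nat \<Rightarrow> real" where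
  "mavg S M T x y = (1 / real T) * (\<Sum>t<T. mpow S M t x y)"

definition mlim :: "nat \<Rightarrow> (nat \<Rightarrow> nat \<Rightarrow> real) \<Rightarrow> nat \<Rightarrow> nat \<Rightarrow> real" where
  "mlim S M x y = lim (\<lambda>T. mavg S M T x y)"

text \<open>The factor 1 - \<gamma> normalises the rows to sum 1, so the discounted occupation law
  is again a stochastic matrix and plays the part that the Cesaro limit plays for the average
  reward.\<close>

definition mocc :: "nat \<Rightarrow> (nat \<Rightarrow> nat \<Rightarrow> real) \<Rightarrow> real \<Rightarrow> nat \<Rightarrow> nat \<Rightarrow> real" where
  "mocc S M \<gamma> x y = (1 - \<gamma>) * (\<Sum>t. \<gamma> ^ t * mpow S M t x y)"

lemma mv_add: "mv S M (\<lambda>x. u x + v x) x = mv S M u x + mv S M v x"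
  and mv_diff: "mv S M (\<lambda>x. u x - v x) x = mv S M u x - mv S M v x"
  and mv_cmult: "mv S M (\<lambda>x. c * v x) x = c * mv S M v x"
  by (simp_all add: mv_def algebra_simps sum.distrib sum_subtractf sum_distrib_left)

lemma mv_cong: "(\<And>y. y < S \<Longrightarrow> u y = v y) \<Longrightarrow> mv S M u x = mv S M v x"
  by (simp add: mv_def)

lemma mv_mv: "mv S M (mv S N v) x = mv S (\<lambda>x y. \<Sum>z<S. M x z * N z y) v x"
  unfolding mv_def sum_distrib_left sum_distrib_right
  by (subst sum.swap) (simp add: mult.assoc)

lemma mv_delta: "x < S \<Longrightarrow> mv S (\<lambda>x y. if x = y then 1 else 0) v x = v x"
  by (simp add: mv_def if_distrib[of "\<lambda>c. c * _"] cong: if_cong)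

lemma mv_mpow_Suc: "mv S (mpow S M (Suc t)) v x = mv S (mpow S M t) (mv S M v) x"
  by (simp add: mv_mv) (simp add: mv_def)

lemma mpow_Suc_left:
  "x < S \<Longrightarrow> y < S \<Longrightarrow> mpow S M (Suc t) x y = (\<Sum>z<S. M x z * mpow S M t z y)"
proof (induction t arbitrary: y)
  case 0
  then show ?case
    by (simp add: if_distrib[of "\<lambda>c. c * _"] if_distrib[of "\<lambda>c. _ * c"] cong: if_cong)
next
  case (Suc t)
  have "mpow S M (Suc (Suc t)) x y = (\<Sum>z<S. (\<Sum>w<S. M x w * mpow S M t w z) * M z y)"
    using Suc by (subst mpow.simps(2)) (auto intro!: sum.cong)
  also have "\<dots> = (\<Sum>w<S. M x w * (\<Sum>z<S. mpow S M t w z * M z y))"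
    unfolding sum_distrib_left sum_distrib_right by (subst sum.swap) (simp add: mult.assoc)
  finally show ?case by simp
qed

lemma mv_mpow_Suc_left:
  "x < S \<Longrightarrow> mv S (mpow S M (Suc t)) v x = mv S M (mv S (mpow S M t) v) x"
  by (simp add: mv_mv) (simp add: mv_def mpow_Suc_left[simplified])

locale stochastic =
  fixes S :: nat and M :: "nat \<Rightarrow> nat \<Rightarrow> real"
  assumes nonneg: "x < S \<Longrightarrow> y < S \<Longrightarrow> 0 \<le> M x y"
    and row_sum: "x < S \<Longrightarrow> (\<Sum>y<S. M x y) = 1"
begin

lemma mv_const: "x < S \<Longrightarrow> mv S M (\<lambda>_. c) x = c"
  by (simp add: mv_def row_sum flip: sum_distrib_right)

lemma mv_mono: "x < S \<Longrightarrow> (\<And>y. y < S \<Longrightarrow> u y \<le> v y) \<Longrightarrow> mv S M u x \<le> mv S M v x"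
  unfolding mv_def by (intro sum_mono mult_left_mono) (auto intro: nonneg)

lemma mv_le: "x < S \<Longrightarrow> (\<And>y. y < S \<Longrightarrow> v y \<le> c) \<Longrightarrow> mv S M v x \<le> c"
  using mv_mono[of x v "\<lambda>_. c"] by (simp add: mv_const)

lemma mv_ge: "x < S \<Longrightarrow> (\<And>y. y < S \<Longrightarrow> c \<le> v y) \<Longrightarrow> c \<le> mv S M v x"
  using mv_mono[of x "\<lambda>_. c" v] by (simp add: mv_const)

lemma mv_abs_le:
  assumes "x < S" "\<And>y. y < S \<Longrightarrow> \<bar>v y\<bar> \<le> c"
  shows "\<bar>mv S M v x\<bar> \<le> c"
proof (rule abs_leI)
  show "mv S M v x \<le> c" using assms by (intro mv_le) (auto simp: abs_le_iff)
  have "- c \<le> mv S M v x" using assms by (intro mv_ge) (fastforce simp: abs_le_iff)+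
  then show "- mv S M v x \<le> c" by simp
qed

lemma stochastic_mpow: "stochastic S (mpow S M t)"
proof (induction t)
  case 0
  show ?case by unfold_locales (auto simp: if_distrib cong: if_cong)
next
  case (Suc t)
  interpret p: stochastic S "mpow S M t" by fact
  show ?case
  proof
    fix x y assume "x < S" "y < S"
    then show "0 \<le> mpow S M (Suc t) x y"
      by (auto intro!: sum_nonneg mult_nonneg_nonneg p.nonneg nonneg)
  next
    fix x assume x: "x < S"
    have "(\<Sum>y<S. mpow S M (Suc t) x y) = (\<Sum>z<S. mpow S M t x z * (\<Sum>y<S. M z y))"
      by (simp add: sum_distrib_left) (subst sum.swap, simp)
    then show "(\<Sum>y<S. mpow S M (Suc t) x y) = 1" using x by (simp add: row_sum p.row_sum)
  qed
qed

lemma entry_le_1: "x < S \<Longrightarrow> y < S \<Longrightarrow> M x y \<le> 1"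
  using row_sum[of x] member_le_sum[of y "{..<S}" "M x"] nonneg by auto

lemma mpow_bounds:
  assumes "x < S" "y < S" shows "0 \<le> mpow S M t x y" "mpow S M t x y \<le> 1"
  using stochastic.nonneg[OF stochastic_mpow assms] stochastic.entry_le_1[OF stochastic_mpow assms]
  by auto

lemma mavg_bounds:
  assumes "x < S" "y < S" shows "0 \<le> mavg S M T x y" "mavg S M T x y \<le> 1"
proof -
  show "0 \<le> mavg S M T x y"
    unfolding mavg_def using mpow_bounds[OF assms] by (intro mult_nonneg_nonneg sum_nonneg) auto
  have "(\<Sum>t<T. mpow S M t x y) \<le> (\<Sum>t<T. 1)" by (intro sum_mono mpow_bounds[OF assms])
  then show "mavg S M T x y \<le> 1" unfolding mavg_def by (cases "T = 0") (auto simp: field_simps)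
qed

lemma mavg_sum: "x < S \<Longrightarrow> T > 0 \<Longrightarrow> (\<Sum>y<S. mavg S M T x y) = 1"
  unfolding mavg_def
  by (simp flip: sum_distrib_left sum_divide_distrib add: sum.swap[of _ "{..<T}"] 
      stochastic.row_sum[OF stochastic_mpow])

lemma mavg_telescope:
  "(\<Sum>z<S. mavg S M T x z * M z y) - mavg S M T x y
     = (1 / real T) * (mpow S M T x y - mpow S M 0 x y)"
proof -
  have "(\<Sum>z<S. mavg S M T x z * M z y) = (1 / real T) * (\<Sum>t<T. mpow S M (Suc t) x y)"
    unfolding mavg_def sum_distrib_left sum_distrib_right
    by (subst sum.swap) (simp add: sum_distrib_left sum_divide_distrib mult.assoc)
  then have "(\<Sum>z<S. mavg S M T x z * M z y) - mavg S M T x y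
      = (1 / real T) * (\<Sum>t<T. mpow S M (Suc t) x y - mpow S M t x y)"
    unfolding mavg_def by (simp add: sum_subtractf right_diff_distrib del: mpow.simps)
  also have "(\<Sum>t<T. mpow S M (Suc t) x y - mpow S M t x y) = mpow S M T x y - mpow S M 0 x y"
    by (rule sum_lessThan_telescope)
  finally show ?thesis .
qed

lemma mavg_telescope_left:
  assumes "x < S" "y < S"
  shows "(\<Sum>z<S. M x z * mavg S M T z y) - mavg S M T x y
     = (1 / real T) * (mpow S M T x y - mpow S M 0 x y)"
proof -
  have "(\<Sum>z<S. M x z * mavg S M T z y) = (1 / real T) * (\<Sum>t<T. \<Sum>z<S. M x z * mpow S M t z y)"
    unfolding mavg_def sum_distrib_left
    by (subst sum.swap) (simp add: mult_ac)
  also have "(\<Sum>t<T. \<Sum>z<S. M x z * mpow S M t z y) = (\<Sum>t<T. mpow S M (Suc t) x y)"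
    by (simp only: mpow_Suc_left[OF assms])
  finally have "(\<Sum>z<S. M x z * mavg S M T z y) - mavg S M T x y
      = (1 / real T) * (\<Sum>t<T. mpow S M (Suc t) x y - mpow S M t x y)"
    unfolding mavg_def by (simp add: sum_subtractf right_diff_distrib del: mpow.simps)
  also have "(\<Sum>t<T. mpow S M (Suc t) x y - mpow S M t x y) = mpow S M T x y - mpow S M 0 x y"
    by (rule sum_lessThan_telescope)
  finally show ?thesis .
qed

lemma mavg_telescope_tendsto:
  assumes "x < S" "y < S"
  shows "(\<lambda>T. (1 / real T) * (mpow S M T x y - mpow S M 0 x y)) \<longlonglongrightarrow> 0"
proof (rule Lim_null_comparison)
  show "\<forall>\<^sub>F T in sequentially. norm ((1 / real T) * (mpow S M T x y - mpow S M 0 x y)) \<le> 1 / real T"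
  proof (rule eventuallyI)
    fix T
    have "\<bar>mpow S M T x y - mpow S M 0 x y\<bar> \<le> 1"
      using mpow_bounds[OF assms, of T] mpow_bounds[OF assms, of 0] by linarith
    then have "(1 / real T) * \<bar>mpow S M T x y - mpow S M 0 x y\<bar> \<le> (1 / real T) * 1"
      by (intro mult_left_mono) auto
    then show "norm ((1 / real T) * (mpow S M T x y - mpow S M 0 x y)) \<le> 1 / real T"
      by (simp add: abs_mult)
  qed
  show "(\<lambda>T. 1 / real T) \<longlonglongrightarrow> 0" by (rule lim_1_over_n)
qed

text \<open>By telescoping, the averages fail to be invariant by a term of order 1/T only, so every
  limit point F of the averages satisfies F M = M F = F.\<close>

lemma subseq_limit_invariant:
  assumes \<sigma>: "strict_mono \<sigma>"
    and F: "\<And>x y. x < S \<Longrightarrow> y < S \<Longrightarrow> (\<lambda>T. mavg S M (\<sigma> T) x y) \<longlonglongrightarrow> F x y"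
    and xy: "x < S" "y < S"
  shows "(\<Sum>z<S. F x z * M z y) = F x y" "(\<Sum>z<S. M x z * F z y) = F x y"
proof -
  let ?d = "\<lambda>T. (1 / real T) * (mpow S M T x y - mpow S M 0 x y)"
  have d: "(\<lambda>T. ?d (\<sigma> T)) \<longlonglongrightarrow> 0"
    using LIMSEQ_subseq_LIMSEQ[OF mavg_telescope_tendsto[OF xy] \<sigma>] by (simp add: o_def)
  have "(\<lambda>T. (\<Sum>z<S. mavg S M (\<sigma> T) x z * M z y) - mavg S M (\<sigma> T) x y)
      \<longlonglongrightarrow> (\<Sum>z<S. F x z * M z y) - F x y"
    using xy by (intro tendsto_intros F) auto
  then show "(\<Sum>z<S. F x z * M z y) = F x y"
    using LIMSEQ_unique[OF d] by (simp only: mavg_telescope) fastforce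
  have "(\<lambda>T. (\<Sum>z<S. M x z * mavg S M (\<sigma> T) z y) - mavg S M (\<sigma> T) x y)
      \<longlonglongrightarrow> (\<Sum>z<S. M x z * F z y) - F x y"
    using xy by (intro tendsto_intros F) auto
  then show "(\<Sum>z<S. M x z * F z y) = F x y"
    using LIMSEQ_unique[OF d] by (simp only: mavg_telescope_left[OF xy]) fastforce
qed

lemma left_invariant_mpow:
  assumes "\<And>y. y < S \<Longrightarrow> (\<Sum>z<S. u z * M z y) = u y" "y < S"
  shows "(\<Sum>z<S. u z * mpow S M t z y) = u y"
  using assms(2)
proof (induction t arbitrary: y)
  case 0
  then show ?case by (simp add: if_distrib[of "\<lambda>c. _ * c"] cong: if_cong)
next
  case (Suc t)
  have "(\<Sum>z<S. u z * mpow S M (Suc t) z y) = (\<Sum>w<S. (\<Sum>z<S. u z * mpow S M t z w) * M w y)"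
    by (simp add: sum_distrib_left sum_distrib_right) (subst sum.swap, simp add: mult.assoc)
  also have "\<dots> = u y" using Suc assms(1) by simp
  finally show ?case .
qed

lemma right_invariant_mpow:
  assumes "\<And>x. x < S \<Longrightarrow> mv S M v x = v x" "x < S"
  shows "mv S (mpow S M t) v x = v x"
proof (induction t)
  case 0
  show ?case using assms(2) by (simp add: mv_def if_distrib[of "\<lambda>c. c * _"] cong: if_cong)
next
  case (Suc t)
  have "mv S (mpow S M t) (mv S M v) x = mv S (mpow S M t) v x"
    by (rule mv_cong) (rule assms(1))
  then show ?case by (simp only: mv_mpow_Suc Suc)
qed

lemma left_invariant_mavg:
  assumes "\<And>y. y < S \<Longrightarrow> (\<Sum>z<S. u z * M z y) = u y" "y < S" "T > 0"
  shows "(\<Sum>z<S. u z * mavg S M T z y) = u y"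
proof -
  have "(\<Sum>z<S. u z * mavg S M T z y) = (1 / real T) * (\<Sum>t<T. \<Sum>z<S. u z * mpow S M t z y)"
    unfolding mavg_def sum_distrib_left by (subst sum.swap) (simp add: mult_ac)
  also have "\<dots> = u y" using assms by (simp add: left_invariant_mpow)
  finally show ?thesis .
qed

lemma mv_mavg: "mv S (mavg S M T) v x = (1 / real T) * (\<Sum>t<T. mv S (mpow S M t) v x)"
  unfolding mavg_def mv_def sum_distrib_left sum_distrib_right
  by (subst sum.swap) (simp add: mult_ac)

lemma right_invariant_mavg:
  assumes "\<And>x. x < S \<Longrightarrow> mv S M v x = v x" "x < S" "T > 0"
  shows "mv S (mavg S M T) v x = v x"
  using assms by (simp add: mv_mavg right_invariant_mpow)

text \<open>The product F G is computed twice. F is left invariant under the averages converging to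
  G, so F G = F; G is right invariant under the averages converging to F, so F G = G.\<close>

lemma subseq_limits_unique:
  assumes \<sigma>: "strict_mono \<sigma>"
    and F: "\<And>x y. x < S \<Longrightarrow> y < S \<Longrightarrow> (\<lambda>T. mavg S M (\<sigma> T) x y) \<longlonglongrightarrow> F x y"
    and \<tau>: "strict_mono \<tau>"
    and G: "\<And>x y. x < S \<Longrightarrow> y < S \<Longrightarrow> (\<lambda>T. mavg S M (\<tau> T) x y) \<longlonglongrightarrow> G x y"
    and xy: "x < S" "y < S"
  shows "F x y = G x y"
proof -
  \<comment> \<open>The average over T = 0 steps is the zero matrix (division by zero), so
    invariance of averages holds only once the subsequence has left 0.\<close>
  have pos: "\<forall>\<^sub>F T in sequentially. 0 < \<rho> T" if "strict_mono \<rho>" for \<rho> :: "nat \<Rightarrow> nat"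
    using filterlim_subseq[OF that] eventually_gt_at_top[of 0] by (rule eventually_compose_filterlim[rotated])
  have "(\<lambda>T. \<Sum>z<S. F x z * mavg S M (\<tau> T) z y) \<longlonglongrightarrow> (\<Sum>z<S. F x z * G z y)"
    using xy by (intro tendsto_intros G) auto
  moreover have "(\<lambda>T. \<Sum>z<S. F x z * mavg S M (\<tau> T) z y) \<longlonglongrightarrow> F x y"
  proof (rule tendsto_eventually)
    show "\<forall>\<^sub>F T in sequentially. (\<Sum>z<S. F x z * mavg S M (\<tau> T) z y) = F x y"
      using pos[OF \<tau>]
      by eventually_elim (rule left_invariant_mavg, use xy in \<open>auto intro: subseq_limit_invariant(1)[OF \<sigma> F]\<close>)
  qed
  ultimately have 1: "(\<Sum>z<S. F x z * G z y) = F x y" by (rule LIMSEQ_unique)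
  have "(\<lambda>T. \<Sum>z<S. mavg S M (\<sigma> T) x z * G z y) \<longlonglongrightarrow> (\<Sum>z<S. F x z * G z y)"
    using xy by (intro tendsto_intros F) auto
  moreover have "(\<lambda>T. \<Sum>z<S. mavg S M (\<sigma> T) x z * G z y) \<longlonglongrightarrow> G x y"
  proof (rule tendsto_eventually)
    show "\<forall>\<^sub>F T in sequentially. (\<Sum>z<S. mavg S M (\<sigma> T) x z * G z y) = G x y"
      using pos[OF \<sigma>]
      by eventually_elim (rule right_invariant_mavg[of "\<lambda>z. G z y", unfolded mv_def],
          use xy in \<open>auto intro: subseq_limit_invariant(2)[OF \<tau> G]\<close>)
  qed
  ultimately have "(\<Sum>z<S. F x z * G z y) = G x y" by (rule LIMSEQ_unique)
  with 1 show ?thesis by simp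
qed

lemma mavg_subseq_convergent:
  assumes "strict_mono (\<sigma> :: nat \<Rightarrow> nat)"
  shows "\<exists>\<tau> F. strict_mono \<tau> \<and>
    (\<forall>x<S. \<forall>y<S. (\<lambda>T. mavg S M (\<sigma> (\<tau> T)) x y) \<longlonglongrightarrow> F x y)"
proof -
  have "\<exists>\<tau>. strict_mono \<tau> \<and> (\<forall>k\<in>{..<S} \<times> {..<S}. convergent (\<lambda>t. (\<lambda>k t. mavg S M (\<sigma> t) (fst k) (snd k)) k (\<tau> t)))"
    using mavg_bounds by (intro bounded_family_subseq[where B = 1]) (auto simp: abs_le_iff intro: order_trans[OF _ mavg_bounds(1)])
  then obtain \<tau> where \<tau>: "strict_mono \<tau>"
    "\<forall>k\<in>{..<S} \<times> {..<S}. convergent (\<lambda>t. mavg S M (\<sigma> (\<tau> t)) (fst k) (snd k))"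
    by auto
  have "(\<lambda>T. mavg S M (\<sigma> (\<tau> T)) x y) \<longlonglongrightarrow> lim (\<lambda>T. mavg S M (\<sigma> (\<tau> T)) x y)" if "x < S" "y < S" for x y
    using \<tau>(2) that by (force simp: convergent_LIMSEQ_iff)
  with \<tau>(1) show ?thesis
    by (intro exI[of _ \<tau>] exI[of _ "\<lambda>x y. lim (\<lambda>T. mavg S M (\<sigma> (\<tau> T)) x y)"]) simp
qed

text \<open>Compactness gives a limit point F. A subsequence staying away from F would have a limit
  point of its own, which must again equal F. This replaces any spectral analysis of M, and periodic
  chains need no special treatment.\<close>

lemma mavg_tendsto_mlim:
  assumes "x < S" "y < S"
  shows "(\<lambda>T. mavg S M T x y) \<longlonglongrightarrow> mlim S M x y"
proof -
  have "\<exists>\<tau> F. strict_mono \<tau> \<and> (\<forall>x<S. \<forall>y<S. (\<lambda>T. mavg S M (\<tau> T) x y) \<longlonglongrightarrow> F x y)"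
    using mavg_subseq_convergent[of "\<lambda>t. t"] by (simp add: strict_mono_def)
  then obtain \<tau> F where "strict_mono \<tau> \<and> (\<forall>x<S. \<forall>y<S. (\<lambda>T. mavg S M (\<tau> T) x y) \<longlonglongrightarrow> F x y)"
    by (elim exE)
  then have \<tau>: "strict_mono \<tau>"
    and F: "\<And>x y. x < S \<Longrightarrow> y < S \<Longrightarrow> (\<lambda>T. mavg S M (\<tau> T) x y) \<longlonglongrightarrow> F x y"
    by auto
  have "(\<lambda>T. mavg S M T x y) \<longlonglongrightarrow> F x y"
  proof (rule ccontr)
    assume "\<not> ?thesis"
    then obtain e where e: "e > 0" "\<not> (\<forall>\<^sub>F T in sequentially. dist (mavg S M T x y) (F x y) < e)"
      by (auto simp: tendsto_iff)
    then have "\<exists>\<^sub>\<infinity>T. \<not> dist (mavg S M T x y) (F x y) < e"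
      by (simp add: INFM_nat_le eventually_sequentially) 
    then have "infinite {T. \<not> dist (mavg S M T x y) (F x y) < e}" by (simp add: INFM_iff_infinite)
    then obtain \<sigma> where \<sigma>: "strict_mono (\<sigma> :: nat \<Rightarrow> nat)"
      "\<And>T. \<sigma> T \<in> {T. \<not> dist (mavg S M T x y) (F x y) < e}"
      using infinite_enumerate by blast
    obtain \<tau>' G where "strict_mono \<tau>' \<and> (\<forall>x<S. \<forall>y<S. (\<lambda>T. mavg S M (\<sigma> (\<tau>' T)) x y) \<longlonglongrightarrow> G x y)"
      using mavg_subseq_convergent[OF \<sigma>(1)] by (elim exE)
    then have \<tau>': "strict_mono \<tau>'"
      and G: "\<And>x y. x < S \<Longrightarrow> y < S \<Longrightarrow> (\<lambda>T. mavg S M (\<sigma> (\<tau>' T)) x y) \<longlonglongrightarrow> G x y"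
      by auto
    have "F x y = G x y"
      by (rule subseq_limits_unique[OF \<tau> F strict_mono_o[OF \<sigma>(1) \<tau>']]) (use G assms in \<open>auto simp: o_def\<close>)
    then have "\<forall>\<^sub>F T in sequentially. dist (mavg S M (\<sigma> (\<tau>' T)) x y) (F x y) < e"
      using G[OF assms] e(1) by (auto simp: tendsto_iff)
    then obtain T where "dist (mavg S M (\<sigma> (\<tau>' T)) x y) (F x y) < e"
      by (auto simp: eventually_sequentially)
    with \<sigma>(2)[of "\<tau>' T"] show False by simp
  qed
  then show ?thesis by (simp add: mlim_def limI)
qed

lemma mlim_left: "x < S \<Longrightarrow> y < S \<Longrightarrow> (\<Sum>z<S. mlim S M x z * M z y) = mlim S M x y"
  and mlim_right: "x < S \<Longrightarrow> y < S \<Longrightarrow> (\<Sum>z<S. M x z * mlim S M z y) = mlim S M x y"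
  using subseq_limit_invariant[of id "mlim S M"] mavg_tendsto_mlim by (auto simp: strict_mono_def)

lemma mv_mlim_mv: "x < S \<Longrightarrow> mv S (mlim S M) (mv S M v) x = mv S (mlim S M) v x"
  by (simp add: mv_mv) (simp add: mv_def mlim_left)

lemma mv_mv_mlim: "x < S \<Longrightarrow> mv S M (mv S (mlim S M) v) x = mv S (mlim S M) v x"
  by (simp add: mv_mv) (simp add: mv_def mlim_right)

lemma mavg_mv_tendsto: "x < S \<Longrightarrow> (\<lambda>T. mv S (mavg S M T) v x) \<longlonglongrightarrow> mv S (mlim S M) v x"
  unfolding mv_def by (intro tendsto_intros mavg_tendsto_mlim) auto

lemma stochastic_mlim: "stochastic S (mlim S M)"
proof
  fix x y assume "x < S" "y < S"
  then show "0 \<le> mlim S M x y"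
    by (intro LIMSEQ_le_const[OF mavg_tendsto_mlim]) (auto simp: mavg_bounds)
next
  fix x assume x: "x < S"
  have "(\<lambda>T. \<Sum>y<S. mavg S M T x y) \<longlonglongrightarrow> (\<Sum>y<S. mlim S M x y)"
    using x by (intro tendsto_intros mavg_tendsto_mlim) auto
  moreover have "(\<lambda>T. \<Sum>y<S. mavg S M T x y) \<longlonglongrightarrow> 1"
    by (rule tendsto_eventually) (use x in \<open>auto simp: eventually_sequentially mavg_sum intro!: exI[of _ 1]\<close>)
  ultimately show "(\<Sum>y<S. mlim S M x y) = 1" by (rule LIMSEQ_unique)
qed

lemma mlim_right_invariant:
  assumes "\<And>x. x < S \<Longrightarrow> mv S M v x = v x" "x < S"
  shows "mv S (mlim S M) v x = v x"
proof (rule LIMSEQ_unique[OF mavg_mv_tendsto[OF assms(2)]])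
  show "(\<lambda>T. mv S (mavg S M T) v x) \<longlonglongrightarrow> v x"
    by (rule tendsto_eventually)
      (use assms in \<open>auto simp: eventually_sequentially right_invariant_mavg intro!: exI[of _ 1]\<close>)
qed

lemma mlim_idem: "x < S \<Longrightarrow> mv S (mlim S M) (mv S (mlim S M) v) x = mv S (mlim S M) v x"
  by (rule mlim_right_invariant) (auto simp: mv_mv_mlim)

text \<open>The fundamental matrix \<open>I - M + M\<^sup>\<infinity>\<close> is invertible: its kernel consists of
  \<open>M\<close>-invariant vectors annihilated by the Cesaro limit \<open>M\<^sup>\<infinity>\<close>.\<close>

lemma poisson_equation:
  "\<exists>h. (\<forall>x<S. f x = mv S (mlim S M) f x + h x - mv S M h x) \<and> (\<forall>x<S. mv S (mlim S M) h x = 0)"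
proof -
  let ?E = "mlim S M"
  let ?Z = "\<lambda>x y. (if x = y then 1 else 0) - M x y + ?E x y"
  have Z: "(\<Sum>y<S. ?Z x y * v y) = v x - mv S M v x + mv S ?E v x" if "x < S" for v x
    using mv_delta[OF that, of v]
    by (simp add: mv_def algebra_simps sum.distrib sum_subtractf)
  have E0: "mv S ?E (\<lambda>x. v x - mv S M v x + mv S ?E v x) x = mv S ?E v x" if "x < S" for v x
    using that by (simp add: mv_add mv_diff mv_mlim_mv mlim_idem)
  have "\<exists>g. \<forall>x<S. (\<Sum>y<S. ?Z x y * g y) = f x"
  proof (rule injective_imp_solvable)
    fix v assume "\<forall>x<S. (\<Sum>y<S. ?Z x y * v y) = 0"
    then have v: "v x - mv S M v x + mv S ?E v x = 0" if "x < S" for x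
      using that Z by metis
    have Ev: "mv S ?E v x = 0" if "x < S" for x
    proof -
      have "mv S ?E (\<lambda>x. v x - mv S M v x + mv S ?E v x) x = mv S ?E (\<lambda>_. 0) x"
        by (rule mv_cong) (rule v)
      with E0[OF that, of v] show ?thesis by (simp add: mv_def)
    qed
    have "mv S M v x = v x" if "x < S" for x using v[OF that] Ev[OF that] by simp
    from mlim_right_invariant[OF this] Ev show "\<forall>x<S. v x = 0" by auto
  qed
  then obtain g where g: "\<And>x. x < S \<Longrightarrow> g x - mv S M g x + mv S ?E g x = f x"
    using Z by metis
  have Ef: "mv S ?E f x = mv S ?E g x" if "x < S" for x
    using E0[OF that, of g] mv_cong[of S _ f ?E x, OF g] by simp
  \<comment> \<open>The subtracted vector is M-invariant, so g - M g is unchanged, and the Cesaro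
    limit now annihilates h. This normalisation is the one that singles out the bias.\<close>
  define h where "h x = g x - mv S ?E g x" for x
  have "f x = mv S ?E f x + h x - mv S M h x" if "x < S" for x
    using g[OF that] Ef[OF that] mv_mv_mlim[OF that, of g] mv_diff[of S M g "mv S ?E g" x]
    unfolding h_def by simp
  moreover have "mv S ?E h x = 0" if "x < S" for x
    using mlim_idem[OF that, of g] unfolding h_def by (simp add: mv_diff)
  ultimately show ?thesis by blast
qed

section \<open>Discounted sums and occupation measures\<close>

lemma summable_mpow:
  assumes "0 \<le> \<gamma>" "\<gamma> < 1" "x < S" "y < S"
  shows "summable (\<lambda>t. \<gamma> ^ t * mpow S M t x y)"
proof (rule summable_comparison_test[OF exI[of _ 0]])
  show "\<forall>n\<ge>0. norm (\<gamma> ^ n * mpow S M n x y) \<le> \<gamma> ^ n"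
    using mpow_bounds[OF assms(3,4)] assms(1) by (auto simp: abs_mult intro!: mult_left_le)
  show "summable (\<lambda>n. \<gamma> ^ n)" using assms by (intro summable_geometric) auto
qed

lemma summable_disc:
  assumes "0 \<le> \<gamma>" "\<gamma> < 1" "x < S"
  shows "summable (\<lambda>t. \<gamma> ^ t * mv S (mpow S M t) f x)"
  unfolding mv_def sum_distrib_left mult.assoc[symmetric]
  using assms by (intro summable_sum summable_mult2 summable_mpow) auto

lemma mv_mocc:
  assumes "0 \<le> \<gamma>" "\<gamma> < 1" "x < S"
  shows "mv S (mocc S M \<gamma>) f x = (1 - \<gamma>) * (\<Sum>t. \<gamma> ^ t * mv S (mpow S M t) f x)"
proof -
  have "(\<Sum>t. \<gamma> ^ t * mv S (mpow S M t) f x) = (\<Sum>t. \<Sum>y<S. \<gamma> ^ t * mpow S M t x y * f y)"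
    by (simp add: mv_def sum_distrib_left mult.assoc)
  also have "\<dots> = (\<Sum>y<S. \<Sum>t. \<gamma> ^ t * mpow S M t x y * f y)"
    using assms by (intro suminf_sum summable_mult2 summable_mpow) auto
  also have "\<dots> = (\<Sum>y<S. (\<Sum>t. \<gamma> ^ t * mpow S M t x y) * f y)"
    using assms by (intro sum.cong refl suminf_mult2[symmetric] summable_mpow) auto
  finally show ?thesis by (simp add: mv_def mocc_def sum_distrib_left mult.assoc)
qed

text \<open>The same series is peeled at its first step in two ways: with M applied to the sum it is
  the policy's Bellman equation, with M applied to the reward it becomes the flow balance
  \<open>mocc_unfold\<close>.\<close>

lemma disc_unfold:
  fixes f :: "nat \<Rightarrow> real"
  assumes "0 \<le> \<gamma>" "\<gamma> < 1" "x < S"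
  defines "D \<equiv> \<lambda>x. (\<Sum>t. \<gamma> ^ t * mv S (mpow S M t) f x)"
  shows "D x = f x + \<gamma> * mv S M D x"
    "D x = f x + \<gamma> * (\<Sum>t. \<gamma> ^ t * mv S (mpow S M t) (mv S M f) x)"
proof -
  have "D x = mv S (mpow S M 0) f x + (\<Sum>t. \<gamma> ^ Suc t * mv S (mpow S M (Suc t)) f x)"
    unfolding D_def using suminf_split_head[OF summable_disc[OF assms(1-3), of f]] by simp
  then have D: "D x = f x + (\<Sum>t. \<gamma> ^ Suc t * mv S (mpow S M (Suc t)) f x)"
    using mv_delta[OF assms(3), of f] by (simp add: mv_def del: power_Suc)
  show "D x = f x + \<gamma> * (\<Sum>t. \<gamma> ^ t * mv S (mpow S M t) (mv S M f) x)"
    unfolding D mv_mpow_Suc using suminf_mult[OF summable_disc[OF assms(1-3)], of \<gamma>]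
    by (simp add: mult.assoc)
  have "(\<Sum>t. \<gamma> ^ Suc t * mv S (mpow S M (Suc t)) f x)
      = (\<Sum>t. \<Sum>y<S. \<gamma> * M x y * (\<gamma> ^ t * mv S (mpow S M t) f y))"
    by (simp only: mv_mpow_Suc_left[OF assms(3)]) (simp add: mv_def[of S M] sum_distrib_left mult_ac)
  also have "\<dots> = (\<Sum>y<S. \<Sum>t. \<gamma> * M x y * (\<gamma> ^ t * mv S (mpow S M t) f y))"
    using assms(1-3) by (intro suminf_sum summable_mult summable_disc) auto
  also have "\<dots> = (\<Sum>y<S. \<gamma> * M x y * D y)"
    unfolding D_def using assms(1-3) by (intro sum.cong refl suminf_mult summable_disc) auto
  finally show "D x = f x + \<gamma> * mv S M D x"
    unfolding D by (simp add: mv_def sum_distrib_left mult.assoc)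
qed

text \<open>Flow balance: the occupation law is M-invariant up to a term of weight 1 - \<gamma>. All
  discounted telescoping arguments rest on this identity.\<close>

lemma mocc_unfold:
  assumes "0 \<le> \<gamma>" "\<gamma> < 1" "x < S"
  shows "mv S (mocc S M \<gamma>) f x = (1 - \<gamma>) * f x + \<gamma> * mv S (mocc S M \<gamma>) (mv S M f) x"
  using disc_unfold(2)[OF assms, of f] by (simp add: mv_mocc[OF assms] algebra_simps)

lemma stochastic_mocc:
  assumes "0 \<le> \<gamma>" "\<gamma> < 1"
  shows "stochastic S (mocc S M \<gamma>)"
proof
  fix x y assume "x < S" "y < S"
  then show "0 \<le> mocc S M \<gamma> x y"
    unfolding mocc_def using assms mpow_bounds(1)
    by (intro mult_nonneg_nonneg suminf_nonneg summable_mpow) auto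
next
  fix x assume x: "x < S"
  have "mv S (mocc S M \<gamma>) (\<lambda>_. 1) x = 1"
    using x assms stochastic.mv_const[OF stochastic_mpow x, of _ 1] 
    by (simp add: mv_mocc suminf_geometric)
  then show "(\<Sum>y<S. mocc S M \<gamma> x y) = 1" by (simp add: mv_def)
qed

end

section \<open>Hitting times and policies\<close>

context stochastic
begin

definition first_passage :: "nat \<Rightarrow> nat \<Rightarrow> nat \<Rightarrow> real" where
  "first_passage s s' t = taboo S M s s' (Suc t) s'"

text \<open>Mass that has avoided s' at times 1 to t. Time 0 is exempt, so for s = s' the associated
  \<open>first_passage\<close> is the first return, as \<open>transient\<close> requires.\<close>

definition survival :: "nat \<Rightarrow> nat \<Rightarrow> nat \<Rightarrow> nat \<Rightarrow> real" where
  "survival s s' t x = (if t \<noteq> 0 \<and> x = s' then 0 else taboo S M s s' t x)"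

lemma taboo_Suc: "taboo S M s s' (Suc t) y = (\<Sum>x<S. survival s s' t x * M x y)"
  by (simp add: survival_def)

lemma taboo_nonneg: "y < S \<Longrightarrow> 0 \<le> taboo S M s s' t y"
  by (induction t arbitrary: y) (auto intro!: sum_nonneg mult_nonneg_nonneg nonneg)

lemma survival_nonneg: "y < S \<Longrightarrow> 0 \<le> survival s s' t y"
  by (simp add: survival_def taboo_nonneg)

lemma first_passage_nonneg: "s' < S \<Longrightarrow> 0 \<le> first_passage s s' t"
  unfolding first_passage_def by (rule taboo_nonneg)

lemma taboo_Suc_split:
  "taboo S M s s' (Suc t) y = survival s s' (Suc t) y + (if y = s' then first_passage s s' t else 0)"
  by (simp add: survival_def first_passage_def)

text \<open>Optional stopping at the first passage to s': by induction on T, the absorbed mass times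
  v s' plus the v-weighted surviving mass never exceeds v s.\<close>

lemma superharmonic_first_passage:
  assumes v: "\<And>x. x < S \<Longrightarrow> 0 \<le> v x" "\<And>x. x < S \<Longrightarrow> mv S M v x \<le> v x"
    and s: "s < S" "s' < S"
  shows "(\<Sum>t<T. first_passage s s' t) * v s' \<le> v s"
proof -
  have "(\<Sum>t<T. first_passage s s' t) * v s' + (\<Sum>x<S. survival s s' T x * v x) \<le> v s"
  proof (induction T)
    case 0
    show ?case using s by (simp add: survival_def if_distrib[of "\<lambda>c. c * _"] cong: if_cong)
  next
    case (Suc T)
    have "(\<Sum>y<S. taboo S M s s' (Suc T) y * v y) = (\<Sum>x<S. survival s s' T x * mv S M v x)"
      unfolding taboo_Suc mv_def sum_distrib_left sum_distrib_right
      by (subst sum.swap) (simp add: mult.assoc)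
    also have "\<dots> \<le> (\<Sum>x<S. survival s s' T x * v x)"
      by (intro sum_mono mult_left_mono) (auto intro: v survival_nonneg)
    also have "(\<Sum>y<S. taboo S M s s' (Suc T) y * v y)
        = (\<Sum>y<S. survival s s' (Suc T) y * v y) + first_passage s s' T * v s'"
      unfolding taboo_Suc_split using s(2)
      by (simp add: distrib_right sum.distrib if_distrib[of "\<lambda>c. c * _"] cong: if_cong)
    finally show ?case using Suc by (simp add: algebra_simps)
  qed
  moreover have "0 \<le> (\<Sum>x<S. survival s s' T x * v x)"
    using v by (intro sum_nonneg mult_nonneg_nonneg) (auto intro: survival_nonneg)
  ultimately show ?thesis by linarith
qed

lemma first_passage_sum_le_1: "s < S \<Longrightarrow> s' < S \<Longrightarrow> (\<Sum>t<T. first_passage s s' t) \<le> 1"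
  using superharmonic_first_passage[of "\<lambda>_. 1" s s' T] by (simp add: mv_const)

lemma first_passage_summable: "s < S \<Longrightarrow> s' < S \<Longrightarrow> summable (first_passage s s')"
  using first_passage_sum_le_1 by (intro summableI_nonneg_bounded[where x = 1]) (auto simp: first_passage_nonneg)

text \<open>If s' is hit with certainty, all mass is absorbed in the limit. Applied in both
  directions, this makes a superharmonic function constant on a communicating set.\<close>

lemma superharmonic_hit:
  assumes "\<And>x. x < S \<Longrightarrow> 0 \<le> v x" "\<And>x. x < S \<Longrightarrow> mv S M v x \<le> v x"
    and s: "s < S" "s' < S" and hit: "suminf (first_passage s s') = 1"
  shows "v s' \<le> v s"
proof -
  have "(\<lambda>T. (\<Sum>t<T. first_passage s s' t) * v s') \<longlonglongrightarrow> suminf (first_passage s s') * v s'"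
    by (intro tendsto_intros summable_LIMSEQ first_passage_summable s)
  then have "suminf (first_passage s s') * v s' \<le> v s"
    by (rule LIMSEQ_le_const2) (use superharmonic_first_passage[OF assms(1-2) s] in auto)
  then show ?thesis by (simp add: hit)
qed

text \<open>Split according to the first passage to s'. Index k of \<open>first_passage\<close>
  stands for time k + 1, which leaves t - k of the t + 1 steps.\<close>

lemma mpow_renewal:
  assumes "s < S" "s' < S" "y < S"
  shows "mpow S M (Suc t) s y
    = survival s s' (Suc t) y + (\<Sum>k\<le>t. first_passage s s' k * mpow S M (t - k) s' y)"
  using assms(3)
proof (induction t arbitrary: y)
  case 0
  have "mpow S M (Suc 0) s y = taboo S M s s' (Suc 0) y"
    using assms by (simp add: if_distrib[of "\<lambda>c. c * _"] cong: if_cong)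
  then show ?case unfolding taboo_Suc_split by (simp del: mpow.simps(2))
next
  case (Suc t)
  have "mpow S M (Suc (Suc t)) s y = (\<Sum>z<S. survival s s' (Suc t) z * M z y)
     + (\<Sum>z<S. (\<Sum>k\<le>t. first_passage s s' k * mpow S M (t - k) s' z) * M z y)"
    unfolding mpow.simps(2)[of _ _ "Suc t"] sum.distrib[symmetric]
    by (intro sum.cong refl) (simp only: Suc.IH lessThan_iff distrib_right)
  also have "(\<Sum>z<S. (\<Sum>k\<le>t. first_passage s s' k * mpow S M (t - k) s' z) * M z y)
      = (\<Sum>k\<le>t. first_passage s s' k * mpow S M (Suc (t - k)) s' y)"
    by (simp add: sum_distrib_left sum_distrib_right) (subst sum.swap, simp add: mult.assoc)
  also have "\<dots> = (\<Sum>k\<le>t. first_passage s s' k * mpow S M (Suc t - k) s' y)"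
    by (intro sum.cong refl) (simp add: Suc_diff_le del: mpow.simps)
  also have "(\<Sum>z<S. survival s s' (Suc t) z * M z y) = taboo S M s s' (Suc (Suc t)) y"
    by (simp only: taboo_Suc)
  finally show ?case
    unfolding taboo_Suc_split by (simp del: mpow.simps(2))
qed

text \<open>Let U z T be the expected number of visits to x before time T from z. Renewal gives U x
  T <= 1 + f * U x T with return probability f < 1, so U is bounded in T, first from x and then from
  s, and its average over time tends to 0.\<close>

lemma mlim_transient_eq_0:
  assumes s: "s < S" "x < S" and tr: "suminf (first_passage x x) < 1"
  shows "mlim S M s x = 0"
proof -
  define U where "U z T = (\<Sum>t<T. mpow S M t z x)" for z T
  have U_nonneg: "0 \<le> U z T" if "z < S" for z T
    unfolding U_def using mpow_bounds(1)[OF that s(2)] by (intro sum_nonneg) auto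
  have fp: "(\<Sum>t<T. first_passage z x t) \<le> suminf (first_passage z x)" if "z < S" for z T
    using that s by (intro sum_le_suminf first_passage_summable) (auto simp: first_passage_nonneg)
  have U_le: "U z T \<le> 1 + suminf (first_passage z x) * U x T" if z: "z < S" for z T
  proof -
    have "U z T \<le> U z (Suc T)"
      using mpow_bounds(1)[OF z s(2)] by (simp add: U_def)
    also have "\<dots> = mpow S M 0 z x + (\<Sum>t<T. mpow S M (Suc t) z x)"
      unfolding U_def by (rule sum.lessThan_Suc_shift)
    also have "\<dots> \<le> 1 + (\<Sum>t<T. mpow S M (Suc t) z x)" by simp
    also have "(\<Sum>t<T. mpow S M (Suc t) z x)
        = (\<Sum>t<T. \<Sum>k\<le>t. first_passage z x k * mpow S M (t - k) x x)"
      by (simp only: mpow_renewal[OF z s(2) s(2)]) (simp add: survival_def)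
    also have "\<dots> = (\<Sum>(i, j)\<in>{(i, j). i + j < T}. first_passage z x i * mpow S M j x x)"
      by (rule sum.triangle_reindex[symmetric])
    \<comment> \<open>The triangle i + j < T is enlarged to a square so that the double sum
      factors.\<close>
    also have "\<dots> \<le> (\<Sum>(i, j)\<in>{..<T} \<times> {..<T}. first_passage z x i * mpow S M j x x)"
      using mpow_bounds(1)[OF s(2) s(2)] first_passage_nonneg[OF s(2)]
      by (intro sum_mono2) (auto intro!: mult_nonneg_nonneg)
    also have "\<dots> = (\<Sum>t<T. first_passage z x t) * U x T"
      by (simp add: U_def sum_product sum.cartesian_product)
    also have "\<dots> \<le> suminf (first_passage z x) * U x T"
      by (intro mult_right_mono fp z U_nonneg s)
    finally show ?thesis by simp
  qed
  have sub: "suminf (first_passage z x) \<le> 1" if "z < S" for z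
    using first_passage_sum_le_1[OF that s(2)] that s
    by (intro suminf_le_const first_passage_summable) auto
  let ?B = "1 / (1 - suminf (first_passage x x))"
  have Ux: "U x T \<le> ?B" for T
    using U_le[OF s(2), of T] tr by (simp add: field_simps)
  have Us: "U s T \<le> 1 + ?B" for T
  proof -
    have "suminf (first_passage s x) * U x T \<le> 1 * U x T"
      by (intro mult_right_mono sub s U_nonneg)
    then show ?thesis using U_le[OF s(1), of T] Ux[of T] by linarith
  qed
  have "(\<lambda>T. mavg S M T s x) \<longlonglongrightarrow> 0"
  proof (rule Lim_null_comparison)
    show "\<forall>\<^sub>F T in sequentially. norm (mavg S M T s x) \<le> (1 + ?B) * (1 / real T)"
    proof (rule eventuallyI)
      fix T
      have "1 / real T * U s T \<le> 1 / real T * (1 + ?B)" by (intro mult_left_mono Us) simp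
      then show "norm (mavg S M T s x) \<le> (1 + ?B) * (1 / real T)"
        using mavg_bounds(1)[OF s, of T] by (simp add: mavg_def U_def mult.commute)
    qed
    show "(\<lambda>T. (1 + ?B) * (1 / real T)) \<longlonglongrightarrow> 0"
      by (rule tendsto_mult_right_zero) (rule lim_1_over_n)
  qed
  then show ?thesis using mavg_tendsto_mlim[OF s] LIMSEQ_unique by blast
qed

end

section \<open>Policies as stochastic matrices\<close>

definition polM :: "(nat \<Rightarrow> nat \<Rightarrow> nat pmf) \<Rightarrow> (nat \<Rightarrow> nat pmf) \<Rightarrow> nat \<Rightarrow> nat \<Rightarrow> real" where
  "polM P \<pi> x y = pmf (pol_step P \<pi> x) y"

definition polr :: "(nat \<Rightarrow> nat \<Rightarrow> real) \<Rightarrow> (nat \<Rightarrow> nat pmf) \<Rightarrow> nat \<Rightarrow> real" where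
  "polr f \<pi> x = measure_pmf.expectation (\<pi> x) (f x)"

definition pv :: "nat \<Rightarrow> (nat \<Rightarrow> nat \<Rightarrow> nat pmf) \<Rightarrow> nat \<Rightarrow> nat \<Rightarrow> (nat \<Rightarrow> real) \<Rightarrow> real" where
  "pv S P s a v = (\<Sum>y<S. pmf (P s a) y * v y)"

lemma hit_prob_eq:
  "hit_prob S P \<pi> s s' = suminf (stochastic.first_passage S (polM P \<pi>) s s')"
  if "stochastic S (polM P \<pi>)"
  unfolding hit_prob_def stochastic.first_passage_def[OF that, abs_def]
  by (simp only: polM_def[abs_def])

lemma valid_det_pol: "valid_policy S A (det_pol d) \<longleftrightarrow> (\<forall>s<S. d s < A)"
  by (auto simp: valid_policy_def det_pol_def)

lemma polM_det_pol: "polM P (det_pol d) x y = pmf (P x (d x)) y"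
  by (simp add: polM_def pol_step_def det_pol_def bind_return_pmf)

lemma polr_det_pol: "polr f (det_pol d) x = f x (d x)"
  by (simp add: polr_def det_pol_def)

lemma mv_det_pol: "mv S (polM P (det_pol d)) v x = pv S P x (d x) v"
  by (simp add: mv_def pv_def polM_det_pol)

lemma pv_add: "pv S P s a (\<lambda>x. u x + v x) = pv S P s a u + pv S P s a v"
  and pv_diff: "pv S P s a (\<lambda>x. u x - v x) = pv S P s a u - pv S P s a v"
  and pv_cmult: "pv S P s a (\<lambda>x. c * v x) = c * pv S P s a v"
  by (simp_all add: pv_def algebra_simps sum.distrib sum_subtractf sum_distrib_left)

lemma pv_cong: "(\<And>y. y < S \<Longrightarrow> u y = v y) \<Longrightarrow> pv S P s a u = pv S P s a v"
  by (simp add: pv_def)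

lemma pv_mono: "(\<And>y. y < S \<Longrightarrow> u y \<le> v y) \<Longrightarrow> pv S P s a u \<le> pv S P s a v"
  unfolding pv_def by (intro sum_mono mult_left_mono) auto

locale finite_mdp =
  fixes S A :: nat and P :: "nat \<Rightarrow> nat \<Rightarrow> nat pmf"
  assumes kernel: "valid_kernel S A P" and A_pos: "A \<ge> 1"
begin

lemma pv_const: "s < S \<Longrightarrow> a < A \<Longrightarrow> pv S P s a (\<lambda>_. c) = c"
  using kernel sum_pmf_eq_1[of "{..<S}" "P s a"]
  by (simp add: pv_def valid_kernel_def flip: sum_distrib_right)

lemma pv_le: "s < S \<Longrightarrow> a < A \<Longrightarrow> (\<And>y. y < S \<Longrightarrow> v y \<le> c) \<Longrightarrow> pv S P s a v \<le> c"
  using pv_mono[of S v "\<lambda>_. c" P s a] by (simp add: pv_const)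

lemma pv_ge: "s < S \<Longrightarrow> a < A \<Longrightarrow> (\<And>y. y < S \<Longrightarrow> c \<le> v y) \<Longrightarrow> c \<le> pv S P s a v"
  using pv_mono[of S "\<lambda>_. c" v P s a] by (simp add: pv_const)

lemma pv_abs_le:
  assumes "s < S" "a < A" "\<And>y. y < S \<Longrightarrow> \<bar>v y\<bar> \<le> c"
  shows "\<bar>pv S P s a v\<bar> \<le> c"
proof (rule abs_leI)
  show "pv S P s a v \<le> c" using assms by (intro pv_le) (auto simp: abs_le_iff)
  have "- c \<le> pv S P s a v" using assms by (intro pv_ge) (fastforce simp: abs_le_iff)+
  then show "- pv S P s a v \<le> c" by simp
qed

lemma polr_eq:
  assumes "valid_policy S A \<pi>" "x < S"
  shows "polr f \<pi> x = (\<Sum>a<A. pmf (\<pi> x) a * f x a)"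
  unfolding polr_def using assms
  by (subst integral_measure_pmf_real[of "{..<A}"]) (auto simp: valid_policy_def mult.commute)

lemma polM_eq:
  assumes "valid_policy S A \<pi>" "x < S"
  shows "polM P \<pi> x y = (\<Sum>a<A. pmf (\<pi> x) a * pmf (P x a) y)"
  unfolding polM_def pol_step_def pmf_bind using assms
  by (subst integral_measure_pmf_real[of "{..<A}"]) (auto simp: valid_policy_def mult.commute)

lemma mv_polM_eq:
  assumes "valid_policy S A \<pi>" "x < S"
  shows "mv S (polM P \<pi>) v x = (\<Sum>a<A. pmf (\<pi> x) a * pv S P x a v)"
  unfolding mv_def pv_def using assms
  by (simp add: polM_eq sum_distrib_left sum_distrib_right mult.assoc) (rule sum.swap)

lemma policy_sum: "valid_policy S A \<pi> \<Longrightarrow> x < S \<Longrightarrow> (\<Sum>a<A. pmf (\<pi> x) a) = 1"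
  by (intro sum_pmf_eq_1) (auto simp: valid_policy_def)

lemma policy_avg_le:
  assumes "valid_policy S A \<pi>" "x < S" "\<And>a. a < A \<Longrightarrow> F a \<le> c"
  shows "(\<Sum>a<A. pmf (\<pi> x) a * F a) \<le> c"
proof -
  have "(\<Sum>a<A. pmf (\<pi> x) a * F a) \<le> (\<Sum>a<A. pmf (\<pi> x) a * c)"
    using assms(3) by (intro sum_mono mult_left_mono) auto
  also have "\<dots> = c" using policy_sum[OF assms(1,2)] by (simp flip: sum_distrib_right)
  finally show ?thesis .
qed

lemma pol_step_subset: "valid_policy S A \<pi> \<Longrightarrow> x < S \<Longrightarrow> set_pmf (pol_step P \<pi> x) \<subseteq> {..<S}"
  using kernel by (fastforce simp: pol_step_def valid_policy_def valid_kernel_def)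

lemma stochastic_polM:
  assumes "valid_policy S A \<pi>" shows "stochastic S (polM P \<pi>)"
proof
  fix x assume "x < S"
  then show "(\<Sum>y<S. polM P \<pi> x y) = 1"
    unfolding polM_def by (intro sum_pmf_eq_1 pol_step_subset assms) auto
qed (simp add: polM_def)

lemma state_dist_mpow:
  assumes pol: "valid_policy S A \<pi>" and s: "s < S"
  shows "set_pmf (state_dist P \<pi> s t) \<subseteq> {..<S} \<and>
    (\<forall>y<S. pmf (state_dist P \<pi> s t) y = mpow S (polM P \<pi>) t s y)"
proof (induction t)
  case 0
  show ?case using s by (auto simp: pmf_return)
next
  case (Suc t)
  have "pmf (state_dist P \<pi> s (Suc t)) y = mpow S (polM P \<pi>) (Suc t) s y" if "y < S" for y
    unfolding state_dist.simps pmf_bind using Suc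
    by (subst integral_measure_pmf_real[of "{..<S}"]) (auto simp: polM_def[symmetric] mult.commute)
  moreover have "set_pmf (state_dist P \<pi> s (Suc t)) \<subseteq> {..<S}"
    using Suc pol_step_subset[OF pol] by fastforce
  ultimately show ?case by blast
qed

lemma exp_at_eq:
  assumes pol: "valid_policy S A \<pi>" and s: "s < S"
  shows "exp_at P f \<pi> s t = mv S (mpow S (polM P \<pi>) t) (polr f \<pi>) s"
  unfolding exp_at_def mv_def using state_dist_mpow[OF assms, of t]
  by (subst integral_measure_pmf_real[of "{..<S}"]) (auto simp: polr_def mult.commute)

lemma disc_value_eq:
  assumes "valid_policy S A \<pi>" "s < S"
  shows "disc_value P r \<pi> \<gamma> s = (\<Sum>t. \<gamma> ^ t * mv S (mpow S (polM P \<pi>) t) (polr r \<pi>) s)"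
  by (simp add: disc_value_def exp_at_eq[OF assms])

lemma disc_value_mocc:
  assumes "valid_policy S A \<pi>" "s < S" "0 \<le> \<gamma>" "\<gamma> < 1"
  shows "(1 - \<gamma>) * disc_value P r \<pi> \<gamma> s = mv S (mocc S (polM P \<pi>) \<gamma>) (polr r \<pi>) s"
  using stochastic.mv_mocc[OF stochastic_polM[OF assms(1)] assms(3,4,2)]
  by (simp add: disc_value_eq[OF assms(1,2)])

lemma gain_eq:
  assumes "valid_policy S A \<pi>" "s < S"
  shows "gain P r \<pi> s = mv S (mlim S (polM P \<pi>)) (polr r \<pi>) s"
proof -
  interpret stochastic S "polM P \<pi>" by (rule stochastic_polM) fact
  show ?thesis
    unfolding gain_def exp_at_eq[OF assms] mv_mavg[symmetric]
    by (rule limI) (rule mavg_mv_tendsto[OF assms(2)])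
qed

text \<open>For a solution h of the Poisson equation the centred partial sums telescope to h - M^T
  h. Their Cesaro mean is h because the Cesaro limit matrix kills h.\<close>

lemma bias_eq:
  assumes pol: "valid_policy S A \<pi>" and s: "s < S"
    and h: "\<And>x. x < S \<Longrightarrow> polr r \<pi> x = gain P r \<pi> x + h x - mv S (polM P \<pi>) h x"
    and h0: "\<And>x. x < S \<Longrightarrow> mv S (mlim S (polM P \<pi>)) h x = 0"
  shows "bias P r \<pi> s = h s"
proof -
  interpret stochastic S "polM P \<pi>" by (rule stochastic_polM) fact
  let ?M = "polM P \<pi>"
  have centered: "polr (\<lambda>x a. r x a - gain P r \<pi> x) \<pi> x = h x - mv S ?M h x" if "x < S" for x
    using h[OF that] policy_sum[OF pol that]
    by (simp add: polr_eq[OF pol that] right_diff_distrib sum_subtractf flip: sum_distrib_right)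
  have "(\<Sum>t<T. exp_at P (\<lambda>x a. r x a - gain P r \<pi> x) \<pi> s t) = h s - mv S (mpow S ?M T) h s" for T
  proof -
    have "exp_at P (\<lambda>x a. r x a - gain P r \<pi> x) \<pi> s t
        = mv S (mpow S ?M t) h s - mv S (mpow S ?M (Suc t)) h s" for t
      unfolding exp_at_eq[OF pol s] mv_mpow_Suc mv_diff[symmetric]
      by (rule mv_cong) (rule centered)
    then have "(\<Sum>t<T. exp_at P (\<lambda>x a. r x a - gain P r \<pi> x) \<pi> s t)
        = mv S (mpow S ?M 0) h s - mv S (mpow S ?M T) h s"
      using sum_lessThan_telescope'[of "\<lambda>t. mv S (mpow S ?M t) h s" T] by (simp only:)
    then show ?thesis using mv_delta[OF s, of h] by (simp add: mv_def)
  qed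
  then have "bias P r \<pi> s = lim (\<lambda>N. (1 / real N) * (\<Sum>T=1..N. h s - mv S (mpow S ?M T) h s))"
    by (simp add: bias_def cesaro_lim_def)
  also have "\<dots> = h s"
  proof (rule limI, rule Lim_transform_eventually)
    show "(\<lambda>N. h s - mv S (mavg S ?M N) (mv S ?M h) s) \<longlonglongrightarrow> h s"
      using tendsto_diff[OF tendsto_const mavg_mv_tendsto[OF s], of "h s" "mv S ?M h"]
      by (simp add: mv_mlim_mv[OF s] h0[OF s])
    show "\<forall>\<^sub>F N in sequentially. h s - mv S (mavg S ?M N) (mv S ?M h) s
        = (1 / real N) * (\<Sum>T=1..N. h s - mv S (mpow S ?M T) h s)"
      using eventually_gt_at_top[of 0]
    proof eventually_elim
      case (elim N)
      \<comment> \<open>\<open>cesaro_lim\<close> runs over 1..N but \<open>mavg\<close> over times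
        below N; the shift by one costs a factor M in front of h, which the limit matrix
        absorbs.\<close>
      have "(\<Sum>T=1..N. h s - mv S (mpow S ?M T) h s) = (\<Sum>t<N. h s - mv S (mpow S ?M (Suc t)) h s)"
        using sum.shift_bounds_Suc_ivl[of "\<lambda>T. h s - mv S (mpow S ?M T) h s" 0 N]
        by (simp only: atLeast0LessThan One_nat_def atLeastLessThanSuc_atLeastAtMost)
      also have "\<dots> = real N * h s - (\<Sum>t<N. mv S (mpow S ?M t) (mv S ?M h) s)"
        by (simp only: mv_mpow_Suc sum_subtractf) simp
      finally show ?case using elim by (simp add: mv_mavg field_simps)
    qed
  qed
  finally show ?thesis .
qed

text \<open>Integrate the optimality inequality against the Cesaro limit law of the policy: h and
  its one-step image cancel by invariance and c remains.\<close>

lemma gain_le: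
  assumes pol: "valid_policy S A \<pi>" and s: "s < S"
    and le: "\<And>x a. x < S \<Longrightarrow> a < A \<Longrightarrow> r x a + pv S P x a h \<le> c + h x"
  shows "gain P r \<pi> s \<le> c"
proof -
  interpret stochastic S "polM P \<pi>" by (rule stochastic_polM) fact
  interpret lim: stochastic S "mlim S (polM P \<pi>)" by (rule stochastic_mlim)
  have "polr r \<pi> x \<le> (c + h x) - mv S (polM P \<pi>) h x" if "x < S" for x
  proof -
    have "(\<Sum>a<A. pmf (\<pi> x) a * (r x a + pv S P x a h)) \<le> c + h x"
      by (rule policy_avg_le[OF pol that]) (rule le[OF that])
    then show ?thesis
      by (simp add: polr_eq[OF pol that] mv_polM_eq[OF pol that] distrib_left sum.distrib)
  qed
  then have "gain P r \<pi> s \<le> mv S (mlim S (polM P \<pi>)) (\<lambda>x. (c + h x) - mv S (polM P \<pi>) h x) s"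
    unfolding gain_eq[OF pol s] by (rule lim.mv_mono[OF s])
  also have "\<dots> = c" using s by (simp add: mv_diff mv_add mv_mlim_mv lim.mv_const)
  finally show ?thesis .
qed

text \<open>On the communicating set C, v is constant since it is superharmonic under every policy,
  in particular under those that surely reach one state from another. States outside C are transient
  and carry no mass of the Cesaro limit of \<pi>, under which v is its own average; so v takes the
  same value there.\<close>

lemma weakly_communicating_superharmonic_const:
  assumes wc: "weakly_communicating S A P"
    and v: "\<And>x. x < S \<Longrightarrow> 0 \<le> v x" "\<And>x a. x < S \<Longrightarrow> a < A \<Longrightarrow> pv S P x a v \<le> v x"
    and pol: "valid_policy S A \<pi>" and inv: "\<And>x. x < S \<Longrightarrow> mv S (polM P \<pi>) v x = v x"
  shows "\<exists>c. \<forall>x<S. v x = c"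
proof (cases "S = 0")
  case False
  interpret stochastic S "polM P \<pi>" by (rule stochastic_polM) fact
  interpret lim: stochastic S "mlim S (polM P \<pi>)" by (rule stochastic_mlim)
  obtain C where C1: "C \<subseteq> {..<S}"
    and C2: "\<forall>s\<in>{..<S} - C. \<forall>\<pi>. valid_policy S A \<pi> \<longrightarrow> transient S P \<pi> s"
    and C3: "\<forall>s\<in>C. \<forall>s'\<in>C. s \<noteq> s' \<longrightarrow> (\<exists>\<pi>. valid_policy S A \<pi> \<and> hit_prob S P \<pi> s s' = 1)"
    using wc unfolding weakly_communicating_def by (elim exE conjE)
  have le: "v s' \<le> v s" if ss: "s \<in> C" "s' \<in> C" for s s'
  proof (cases "s = s'")
    case ne: False
    obtain \<pi>' where \<pi>': "valid_policy S A \<pi>'" "hit_prob S P \<pi>' s s' = 1"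
      using C3 ss ne by blast
    interpret q: stochastic S "polM P \<pi>'" by (rule stochastic_polM) fact
    show ?thesis
    proof (rule q.superharmonic_hit)
      show "mv S (polM P \<pi>') v x \<le> v x" if "x < S" for x
        using policy_avg_le[OF \<pi>'(1) that v(2)[OF that]] by (simp add: mv_polM_eq[OF \<pi>'(1) that])
      show "suminf (q.first_passage s s') = 1"
        using \<pi>'(2) hit_prob_eq[OF q.stochastic_axioms] by simp
    qed (use ss C1 v(1) in auto)
  qed simp
  have E0: "mlim S (polM P \<pi>) s x = 0" if "s < S" "x < S" "x \<notin> C" for s x
  proof (rule mlim_transient_eq_0[OF that(1,2)])
    have "hit_prob S P \<pi> x x < 1" using C2 pol that(2,3) by (simp add: transient_def)
    then show "suminf (first_passage x x) < 1" by (simp only: hit_prob_eq[OF stochastic_axioms])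
  qed
  \<comment> \<open>If every state were transient, a row of the limit matrix would vanish instead of
    summing to 1.\<close>
  have "C \<noteq> {}"
  proof
    assume "C = {}"
    then have "(\<Sum>y<S. mlim S (polM P \<pi>) 0 y) = 0" using E0[of 0] False by simp
    then show False using lim.row_sum[of 0] False by simp
  qed
  then obtain s0 where s0: "s0 \<in> C" by blast
  have "v x = v s0" if x: "x < S" for x
  proof -
    have "v x = mv S (mlim S (polM P \<pi>)) v x" by (rule mlim_right_invariant[symmetric]) (use inv x in auto)
    also have "\<dots> = mv S (mlim S (polM P \<pi>)) (\<lambda>_. v s0) x"
      unfolding mv_def
    proof (intro sum.cong refl)
      fix y assume y: "y \<in> {..<S}"
      show "mlim S (polM P \<pi>) x y * v y = mlim S (polM P \<pi>) x y * v s0"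
        using E0[OF x, of y] y le[of y s0] le[of s0 y] s0 by (cases "y \<in> C") auto
    qed
    finally show ?thesis using x by (simp add: lim.mv_const)
  qed
  then show ?thesis by blast
qed simp

end

section \<open>The discounted Bellman equation\<close>

definition bellman :: "nat \<Rightarrow> nat \<Rightarrow> (nat \<Rightarrow> nat \<Rightarrow> nat pmf) \<Rightarrow> (nat \<Rightarrow> nat \<Rightarrow> real)
    \<Rightarrow> real \<Rightarrow> (nat \<Rightarrow> real) \<Rightarrow> nat \<Rightarrow> real" where
  "bellman S A P r \<gamma> v s = Max ((\<lambda>a. r s a + \<gamma> * pv S P s a v) ` {..<A})"

text \<open>Value iteration in which the value of one state \<open>s0\<close> is pinned to \<open>c\<close>, so that the limit does
  not depend on the transitions out of \<open>s0\<close>. Nothing is pinned when \<open>s0 \<ge> S\<close>.\<close>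

fun pinned_iter :: "nat \<Rightarrow> nat \<Rightarrow> (nat \<Rightarrow> nat \<Rightarrow> nat pmf) \<Rightarrow> (nat \<Rightarrow> nat \<Rightarrow> real)
    \<Rightarrow> real \<Rightarrow> nat \<Rightarrow> real \<Rightarrow> nat \<Rightarrow> nat \<Rightarrow> real" where
  "pinned_iter S A P r \<gamma> s0 c 0 s = 0"
| "pinned_iter S A P r \<gamma> s0 c (Suc k) s =
     (if s = s0 then c else bellman S A P r \<gamma> (pinned_iter S A P r \<gamma> s0 c k) s)"

text \<open>The default 0 outside the state space makes \<open>pinned_val_cong\<close> an equality
  of functions, which is the form the independence hypotheses of the concentration lemmas ask
  for.\<close>

definition pinned_val :: "nat \<Rightarrow> nat \<Rightarrow> (nat \<Rightarrow> nat \<Rightarrow> nat pmf) \<Rightarrow> (nat \<Rightarrow> nat \<Rightarrow> real)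
    \<Rightarrow> real \<Rightarrow> nat \<Rightarrow> real \<Rightarrow> nat \<Rightarrow> real" where
  "pinned_val S A P r \<gamma> s0 c s = (if s < S then lim (\<lambda>k. pinned_iter S A P r \<gamma> s0 c k s) else 0)"

lemma bellman_cong:
  assumes "\<And>a. a < A \<Longrightarrow> P s a = P' s a" "\<And>y. y < S \<Longrightarrow> u y = v y"
  shows "bellman S A P r \<gamma> u s = bellman S A P' r \<gamma> v s"
  unfolding bellman_def using assms by (intro arg_cong[of _ _ Max] image_cong) (auto simp: pv_def)

lemma pinned_iter_cong:
  assumes "\<And>x a. x < S \<Longrightarrow> x \<noteq> s0 \<Longrightarrow> a < A \<Longrightarrow> P x a = P' x a" "s < S"
  shows "pinned_iter S A P r \<gamma> s0 c k s = pinned_iter S A P' r \<gamma> s0 c k s"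
  using assms(2)
proof (induction k arbitrary: s)
  case (Suc k)
  then show ?case using assms(1) by (auto intro!: bellman_cong)
qed simp

lemma pinned_val_cong:
  assumes "\<And>x a. x < S \<Longrightarrow> x \<noteq> s0 \<Longrightarrow> a < A \<Longrightarrow> P x a = P' x a"
  shows "pinned_val S A P r \<gamma> s0 c = pinned_val S A P' r \<gamma> s0 c"
  using pinned_iter_cong[of S s0 A P P', OF assms] by (auto simp: pinned_val_def fun_eq_iff)

locale discounted_mdp = finite_mdp S A P for S A :: nat and P :: "nat \<Rightarrow> nat \<Rightarrow> nat pmf" +
  fixes r :: "nat \<Rightarrow> nat \<Rightarrow> real" and \<gamma> :: real
  assumes r_bounds: "s < S \<Longrightarrow> a < A \<Longrightarrow> 0 \<le> r s a" "s < S \<Longrightarrow> a < A \<Longrightarrow> r s a \<le> 1"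
    and \<gamma>_bounds: "0 \<le> \<gamma>" "\<gamma> < 1"
begin

abbreviation "B \<equiv> bellman S A P r \<gamma>"

lemma bellman_ge: "a < A \<Longrightarrow> r s a + \<gamma> * pv S P s a v \<le> B v s"
  unfolding bellman_def by (intro Max_ge) auto

lemma bellman_attained: "\<exists>a<A. B v s = r s a + \<gamma> * pv S P s a v"
proof -
  have "B v s \<in> (\<lambda>a. r s a + \<gamma> * pv S P s a v) ` {..<A}"
    unfolding bellman_def using A_pos by (intro Max_in) (auto simp: lessThan_empty_iff)
  then show ?thesis by auto
qed

lemma bellman_le: "(\<And>a. a < A \<Longrightarrow> r s a + \<gamma> * pv S P s a v \<le> c) \<Longrightarrow> B v s \<le> c"
  using bellman_attained[of v s] by auto

lemma bellman_mono: "(\<And>y. y < S \<Longrightarrow> u y \<le> v y) \<Longrightarrow> B u s \<le> B v s"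
  using \<gamma>_bounds by (intro bellman_le order_trans[OF _ bellman_ge]) (auto intro!: mult_left_mono pv_mono)

lemma bellman_le_add:
  assumes "s < S" "\<And>y. y < S \<Longrightarrow> u y \<le> v y + e"
  shows "B u s \<le> B v s + \<gamma> * e"
proof (rule bellman_le)
  fix a assume a: "a < A"
  have "pv S P s a u \<le> pv S P s a v + e"
    using pv_mono[of S u "\<lambda>y. v y + e" P s a] assms pv_const[OF assms(1) a] by (simp add: pv_add)
  then have "\<gamma> * pv S P s a u \<le> \<gamma> * (pv S P s a v + e)" using \<gamma>_bounds by (intro mult_left_mono) auto
  then show "r s a + \<gamma> * pv S P s a u \<le> B v s + \<gamma> * e"
    using bellman_ge[OF a, of s v] by (simp add: distrib_left)
qed

lemma bellman_contraction:
  assumes "s < S" "\<And>y. y < S \<Longrightarrow> \<bar>u y - v y\<bar> \<le> e"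
  shows "\<bar>B u s - B v s\<bar> \<le> \<gamma> * e"
proof -
  have "u y \<le> v y + e" "v y \<le> u y + e" if "y < S" for y using assms(2)[OF that] by auto
  then have "B u s \<le> B v s + \<gamma> * e" "B v s \<le> B u s + \<gamma> * e"
    using bellman_le_add[OF assms(1)] by auto
  then show ?thesis by linarith
qed

lemma bellman_tendsto:
  assumes "s < S" "\<And>y. y < S \<Longrightarrow> (\<lambda>k. u k y) \<longlonglongrightarrow> v y"
  shows "(\<lambda>k. B (u k) s) \<longlonglongrightarrow> B v s"
proof (rule tendstoI)
  fix e :: real assume e: "e > 0"
  have "\<forall>\<^sub>F k in sequentially. \<forall>y\<in>{..<S}. dist (u k y) (v y) < e"
    using e assms(2) by (intro eventually_ball_finite) (auto simp: tendsto_iff)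
  then show "\<forall>\<^sub>F k in sequentially. dist (B (u k) s) (B v s) < e"
  proof eventually_elim
    case (elim k)
    then have "\<bar>B (u k) s - B v s\<bar> \<le> \<gamma> * e"
      by (intro bellman_contraction assms(1)) (auto simp: dist_real_def less_imp_le)
    also have "\<dots> < e" using e \<gamma>_bounds by simp
    finally show ?case by (simp add: dist_real_def)
  qed
qed

text \<open>Maximum principle: at a state where the difference is largest, either the state is s0,
  or the contraction bounds the difference by \<gamma> times itself and it vanishes.\<close>

lemma bellman_fixpoint_dist:
  assumes u: "\<And>s. s < S \<Longrightarrow> s \<noteq> s0 \<Longrightarrow> u s = B u s"
    and v: "\<And>s. s < S \<Longrightarrow> s \<noteq> s0 \<Longrightarrow> v s = B v s"
    and d: "s0 < S \<Longrightarrow> \<bar>u s0 - v s0\<bar> \<le> d" "0 \<le> d" and s: "s < S"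
  shows "\<bar>u s - v s\<bar> \<le> d"
proof -
  let ?D = "(\<lambda>s. \<bar>u s - v s\<bar>) ` {..<S}"
  have "Max ?D \<in> ?D" using s by (intro Max_in) auto
  then obtain x where x: "x < S" "Max ?D = \<bar>u x - v x\<bar>" by auto
  have le: "\<bar>u y - v y\<bar> \<le> \<bar>u x - v x\<bar>" if "y < S" for y
    unfolding x(2)[symmetric] using that by (intro Max_ge) auto
  have "\<bar>u x - v x\<bar> \<le> d"
  proof (cases "x = s0")
    case False
    have "\<bar>u x - v x\<bar> = \<bar>B u x - B v x\<bar>" using u[OF x(1) False] v[OF x(1) False] by simp
    also have "\<dots> \<le> \<gamma> * \<bar>u x - v x\<bar>" by (rule bellman_contraction[OF x(1) le])
    finally have "(1 - \<gamma>) * \<bar>u x - v x\<bar> \<le> 0" by (simp add: algebra_simps)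
    then have "\<bar>u x - v x\<bar> \<le> 0" using \<gamma>_bounds by (simp add: mult_le_0_iff)
    then show ?thesis using d(2) by linarith
  qed (use d(1) x in auto)
  then show ?thesis using le[OF s] by linarith
qed

text \<open>Value iteration started at 0 increases and stays bounded, so it converges by
  monotonicity; continuity of the Bellman operator identifies the limit.\<close>

lemma pinned_val_fixpoint:
  assumes c: "0 \<le> c" and s: "s < S"
  shows "pinned_val S A P r \<gamma> s0 c s = (if s = s0 then c else B (pinned_val S A P r \<gamma> s0 c) s)"
    and "0 \<le> pinned_val S A P r \<gamma> s0 c s"
    and "pinned_val S A P r \<gamma> s0 c s \<le> max c (1 / (1 - \<gamma>))"
proof -
  let ?u = "pinned_iter S A P r \<gamma> s0 c" and ?W = "pinned_val S A P r \<gamma> s0 c"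
  let ?m = "max c (1 / (1 - \<gamma>))"
  have bell0: "0 \<le> B v x" if "\<And>y. y < S \<Longrightarrow> 0 \<le> v y" "x < S" for v x
    using A_pos that r_bounds(1)[of x 0] pv_ge[of x 0 0 v] \<gamma>_bounds
    by (intro order_trans[OF _ bellman_ge[of 0]]) auto
  have nonneg: "0 \<le> ?u k x" if "x < S" for k x
    using that by (induction k arbitrary: x) (auto simp: c intro!: bell0)
  have step: "?u k x \<le> ?u (Suc k) x" if "x < S" for k x
    using that
  proof (induction k arbitrary: x)
    case 0
    then show ?case using nonneg[of x "Suc 0"] by simp
  next
    case (Suc k)
    then show ?case by (auto intro!: bellman_mono)
  qed
  \<comment> \<open>With rewards at most 1, this inequality says that the Bellman operator preserves
    the bound \<open>?m\<close>.\<close>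
  have m: "1 + \<gamma> * ?m \<le> ?m"
  proof -
    have "1 \<le> (1 - \<gamma>) * ?m" using \<gamma>_bounds by (simp add: max_def field_simps)
    then show ?thesis by (simp add: algebra_simps)
  qed
  have m0: "0 \<le> ?m" using c by simp
  have bound: "?u k x \<le> ?m" if "x < S" for k x
    using that
  proof (induction k arbitrary: x)
    case (Suc k)
    have "B (?u k) x \<le> ?m"
    proof (rule bellman_le)
      fix a assume a: "a < A"
      have "\<gamma> * pv S P x a (?u k) \<le> \<gamma> * ?m"
        using Suc a \<gamma>_bounds by (intro mult_left_mono pv_le) auto
      then show "r x a + \<gamma> * pv S P x a (?u k) \<le> ?m" using r_bounds(2)[OF Suc.prems a] m by linarith
    qed
    then show ?case by simp
  qed (use m0 in simp)
  have lim: "(\<lambda>k. ?u k x) \<longlonglongrightarrow> ?W x" if x: "x < S" for x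
  proof -
    have "incseq (\<lambda>k. ?u k x)" by (rule incseq_SucI) (rule step[OF x])
    then obtain L where "(\<lambda>k. ?u k x) \<longlonglongrightarrow> L"
      using bound[OF x] by (elim incseq_convergent[where B = ?m]) auto
    then show ?thesis using x by (simp add: pinned_val_def limI)
  qed
  have "(\<lambda>k. ?u (Suc k) s) \<longlonglongrightarrow> (if s = s0 then c else B ?W s)"
    using s by (auto intro!: bellman_tendsto lim)
  with lim[OF s] show "?W s = (if s = s0 then c else B ?W s)"
    using LIMSEQ_Suc LIMSEQ_unique by blast
  show "0 \<le> ?W s" by (rule LIMSEQ_le_const[OF lim[OF s]]) (use nonneg[OF s] in auto)
  show "?W s \<le> ?m" by (rule LIMSEQ_le_const2[OF lim[OF s]]) (use bound[OF s] in blast)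
qed

text \<open>The verification identity: a one-step inequality between the reward and W - \<gamma> M
  W, integrated against the occupation law, becomes an inequality between the discounted value and
  W.\<close>

lemma mocc_telescope:
  assumes "valid_policy S A \<pi>" "s < S"
  shows "mv S (mocc S (polM P \<pi>) \<gamma>) (\<lambda>x. W x - \<gamma> * mv S (polM P \<pi>) W x) s = (1 - \<gamma>) * W s"
  using stochastic.mocc_unfold[OF stochastic_polM[OF assms(1)] \<gamma>_bounds assms(2), of W]
  by (simp add: mv_diff mv_cmult)

lemma disc_value_le:
  assumes pol: "valid_policy S A \<pi>" and s: "s < S"
    and le: "\<And>x. x < S \<Longrightarrow> polr r \<pi> x \<le> W x - \<gamma> * mv S (polM P \<pi>) W x"
  shows "disc_value P r \<pi> \<gamma> s \<le> W s"
proof -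
  interpret occ: stochastic S "mocc S (polM P \<pi>) \<gamma>"
    by (intro stochastic.stochastic_mocc stochastic_polM pol \<gamma>_bounds)
  have "(1 - \<gamma>) * disc_value P r \<pi> \<gamma> s \<le> (1 - \<gamma>) * W s"
    unfolding disc_value_mocc[OF pol s \<gamma>_bounds] mocc_telescope[OF pol s, of W, symmetric]
    by (intro occ.mv_mono s le)
  then show ?thesis using \<gamma>_bounds by simp
qed

lemma disc_value_ge:
  assumes pol: "valid_policy S A \<pi>" and s: "s < S"
    and le: "\<And>x. x < S \<Longrightarrow> W x - \<gamma> * mv S (polM P \<pi>) W x \<le> polr r \<pi> x"
  shows "W s \<le> disc_value P r \<pi> \<gamma> s"
proof -
  interpret occ: stochastic S "mocc S (polM P \<pi>) \<gamma>"
    by (intro stochastic.stochastic_mocc stochastic_polM pol \<gamma>_bounds)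
  have "(1 - \<gamma>) * W s \<le> (1 - \<gamma>) * disc_value P r \<pi> \<gamma> s"
    unfolding disc_value_mocc[OF pol s \<gamma>_bounds] mocc_telescope[OF pol s, of W, symmetric]
    by (intro occ.mv_mono s le)
  then show ?thesis using \<gamma>_bounds by simp
qed

lemma disc_value_det_pol:
  assumes "\<And>s. s < S \<Longrightarrow> d s < A" "s < S"
  shows "disc_value P r (det_pol d) \<gamma> s = r s (d s) + \<gamma> * pv S P s (d s) (disc_value P r (det_pol d) \<gamma>)"
proof -
  have pol: "valid_policy S A (det_pol d)" using assms(1) by (simp add: valid_det_pol)
  let ?D = "\<lambda>x. \<Sum>t. \<gamma> ^ t * mv S (mpow S (polM P (det_pol d)) t) (polr r (det_pol d)) x"
  have "disc_value P r (det_pol d) \<gamma> s = r s (d s) + \<gamma> * pv S P s (d s) ?D"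
    using stochastic.disc_unfold(1)[OF stochastic_polM[OF pol] \<gamma>_bounds assms(2), of "polr r (det_pol d)"]
    by (simp add: disc_value_eq[OF pol assms(2)] polr_det_pol mv_det_pol)
  also have "pv S P s (d s) ?D = pv S P s (d s) (disc_value P r (det_pol d) \<gamma>)"
    by (rule pv_cong) (simp add: disc_value_eq[OF pol])
  finally show ?thesis .
qed

lemma disc_value_le_fixpoint:
  assumes W: "\<And>x. x < S \<Longrightarrow> W x = B W x" and pol: "valid_policy S A \<pi>" and s: "s < S"
  shows "disc_value P r \<pi> \<gamma> s \<le> W s"
proof (rule disc_value_le[OF pol s])
  fix x assume x: "x < S"
  have "(\<Sum>a<A. pmf (\<pi> x) a * (r x a + \<gamma> * pv S P x a W)) \<le> W x"
    using bellman_ge W[OF x] by (intro policy_avg_le[OF pol x]) simp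
  moreover have "(\<Sum>a<A. pmf (\<pi> x) a * (\<gamma> * pv S P x a W)) = \<gamma> * mv S (polM P \<pi>) W x"
    by (simp add: mv_polM_eq[OF pol x] sum_distrib_left mult_ac)
  ultimately show "polr r \<pi> x \<le> W x - \<gamma> * mv S (polM P \<pi>) W x"
    by (simp add: polr_eq[OF pol x] distrib_left sum.distrib)
qed

definition opt where "opt = opt_disc_value S A P r \<gamma>"

text \<open>Verification: no policy exceeds a Bellman fixed point W, and the policy greedy for W
  attains it, so the supremum is a maximum.\<close>

lemma opt_eq_bellman_fixpoint:
  assumes W: "\<And>s. s < S \<Longrightarrow> W s = B W s" and s: "s < S"
  shows "opt s = W s"
    and "\<exists>d. (\<forall>s<S. d s < A) \<and> (\<forall>s<S. disc_value P r (det_pol d) \<gamma> s = W s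
      \<and> W s = r s (d s) + \<gamma> * pv S P s (d s) W)"
proof -
  have "\<forall>s. \<exists>a<A. B W s = r s a + \<gamma> * pv S P s a W" using bellman_attained by blast
  then obtain d where d: "\<And>s. d s < A" "\<And>s. B W s = r s (d s) + \<gamma> * pv S P s (d s) W" by metis
  have d_val: "valid_policy S A (det_pol d)" using d(1) by (simp add: valid_det_pol)
  have d_eq: "disc_value P r (det_pol d) \<gamma> s = W s" if "s < S" for s
  proof (rule antisym)
    have *: "polr r (det_pol d) x = W x - \<gamma> * mv S (polM P (det_pol d)) W x" if "x < S" for x
      using W[OF that] d(2)[of x] by (simp add: polr_det_pol mv_det_pol)
    show "disc_value P r (det_pol d) \<gamma> s \<le> W s"
      by (rule disc_value_le[OF d_val that]) (simp add: *)
    show "W s \<le> disc_value P r (det_pol d) \<gamma> s"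
      by (rule disc_value_ge[OF d_val that]) (simp add: *)
  qed
  show "opt s = W s"
    unfolding opt_def opt_disc_value_def
    by (rule cSup_eq_maximum) (use d_val d_eq[OF s] disc_value_le_fixpoint[OF W _ s] in \<open>force+\<close>)
  show "\<exists>d. (\<forall>s<S. d s < A) \<and> (\<forall>s<S. disc_value P r (det_pol d) \<gamma> s = W s
      \<and> W s = r s (d s) + \<gamma> * pv S P s (d s) W)"
    using d d_eq W by (intro exI[of _ d]) auto
qed

lemma opt_bellman:
  assumes "s < S"
  shows "opt s = B opt s" "0 \<le> opt s" "opt s \<le> 1 / (1 - \<gamma>)"
proof -
  \<comment> \<open>The index S lies outside the state space, so this is plain value iteration and
    supplies the fixed point.\<close>
  let ?W = "pinned_val S A P r \<gamma> S 0"
  have W: "?W x = B ?W x" if "x < S" for x using pinned_val_fixpoint(1)[of 0 x S] that by simp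
  have eq: "opt x = ?W x" if "x < S" for x by (rule opt_eq_bellman_fixpoint(1)[OF W that])
  have "B opt s = B ?W s" by (rule bellman_cong) (simp_all add: eq)
  then show "opt s = B opt s" using W[OF assms] eq[OF assms] by simp
  show "0 \<le> opt s" "opt s \<le> 1 / (1 - \<gamma>)"
    using pinned_val_fixpoint(2,3)[of 0 s S] assms \<gamma>_bounds by (simp_all add: eq)
qed

lemma opt_greedy:
  obtains d where "\<And>s. s < S \<Longrightarrow> d s < A" "\<And>s. s < S \<Longrightarrow> disc_value P r (det_pol d) \<gamma> s = opt s"
    "\<And>s. s < S \<Longrightarrow> opt s = r s (d s) + \<gamma> * pv S P s (d s) opt"
proof (cases "S = 0")
  case False
  then obtain d where d: "\<forall>s<S. d s < A" "\<forall>s<S. disc_value P r (det_pol d) \<gamma> s = opt s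
      \<and> opt s = r s (d s) + \<gamma> * pv S P s (d s) opt"
    using opt_eq_bellman_fixpoint(2)[of opt 0, OF opt_bellman(1)] by auto
  show ?thesis by (rule that[of d]) (use d in blast)+
qed (use that in auto)

lemma opt_ge: "s < S \<Longrightarrow> a < A \<Longrightarrow> r s a + \<gamma> * pv S P s a opt \<le> opt s"
  using opt_bellman(1) bellman_ge by metis

lemma disc_value_le_opt: "valid_policy S A \<pi> \<Longrightarrow> s < S \<Longrightarrow> disc_value P r \<pi> \<gamma> s \<le> opt s"
  by (rule disc_value_le_fixpoint[OF opt_bellman(1)])

text \<open>Away from s0 both functions solve the same Bellman equation, so an error in the pinned
  value is not amplified anywhere.\<close>

lemma pinned_val_opt_dist:
  assumes "0 \<le> c" "\<bar>opt s0 - c\<bar> \<le> e" "0 \<le> e" "s < S"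
  shows "\<bar>opt s - pinned_val S A P r \<gamma> s0 c s\<bar> \<le> e"
proof (rule bellman_fixpoint_dist[of s0])
  show "opt x = B opt x" if "x < S" for x using opt_bellman(1)[OF that] .
  show "pinned_val S A P r \<gamma> s0 c x = B (pinned_val S A P r \<gamma> s0 c) x" if "x < S" "x \<noteq> s0" for x
    using pinned_val_fixpoint(1)[OF assms(1) that(1), of s0] that(2) by simp
  show "\<bar>opt s0 - pinned_val S A P r \<gamma> s0 c s0\<bar> \<le> e" if "s0 < S"
    using pinned_val_fixpoint(1)[OF assms(1) that, of s0] assms(2) by simp
qed (use assms in auto)

end

section \<open>The average-reward optimality equation\<close>

context finite_mdp
begin

text \<open>The first two terms of the Laurent expansion of the value at \<gamma> = 1. Flow balance
  gives the exact remainder formula (h - \<nu> h) / \<gamma> with \<nu> the occupation law, so it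
  suffices that \<nu> h tends to 0.\<close>

lemma disc_value_laurent:
  assumes pol: "valid_policy S A \<pi>"
    and h: "\<And>x. x < S \<Longrightarrow> polr r \<pi> x = g x + h x - mv S (polM P \<pi>) h x"
    and g: "\<And>x. x < S \<Longrightarrow> mv S (polM P \<pi>) g x = g x"
    and h0: "\<And>x. x < S \<Longrightarrow> mv S (mlim S (polM P \<pi>)) h x = 0"
    and x: "x < S"
  shows "((\<lambda>\<gamma>. disc_value P r \<pi> \<gamma> x - g x / (1 - \<gamma>)) \<longlongrightarrow> h x) (at_left 1)"
proof -
  let ?M = "polM P \<pi>"
  interpret stochastic S ?M by (rule stochastic_polM) fact
  let ?\<nu> = "\<lambda>\<gamma>. mv S (mocc S ?M \<gamma>)"
  have near: "\<forall>\<^sub>F \<gamma> in at_left (1::real). \<gamma> \<in> {0<..<1}"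
    by (rule eventually_at_left_real) simp
  \<comment> \<open>A second Poisson equation, now with h as its right-hand side: since the limit
    matrix kills h, h = k - M k, and flow balance makes \<nu> h of order 1 - \<gamma>.\<close>
  obtain k where k: "\<And>y. y < S \<Longrightarrow> h y = k y - mv S ?M k y"
    using poisson_equation[of h] h0 by auto
  define K where "K = (\<Sum>y<S. \<bar>k y\<bar>)"
  have K: "\<bar>k y\<bar> \<le> K" if "y < S" for y
    unfolding K_def using that by (intro member_le_sum) auto
  have diff: "\<gamma> * ?\<nu> \<gamma> (\<lambda>y. v y - mv S ?M v y) x = (1 - \<gamma>) * (v x - ?\<nu> \<gamma> v x)"
    if "\<gamma> \<in> {0<..<1}" for v \<gamma>
    using mocc_unfold[of \<gamma> x v] that x by (simp add: mv_diff algebra_simps)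
  have inv: "?\<nu> \<gamma> g x = g x" if \<gamma>: "\<gamma> \<in> {0<..<1}" for \<gamma>
  proof -
    have "?\<nu> \<gamma> (mv S ?M g) x = ?\<nu> \<gamma> g x" by (rule mv_cong) (rule g)
    then have "(1 - \<gamma>) * ?\<nu> \<gamma> g x = (1 - \<gamma>) * g x"
      using mocc_unfold[of \<gamma> x g] \<gamma> x by (simp add: algebra_simps)
    then show ?thesis using \<gamma> by simp
  qed
  have \<nu>h_bound: "norm (?\<nu> \<gamma> h x) \<le> 2 * K * ((1 - \<gamma>) / \<gamma>)" if \<gamma>: "\<gamma> \<in> {0<..<1}" for \<gamma>
  proof -
    have "?\<nu> \<gamma> h x = ?\<nu> \<gamma> (\<lambda>y. k y - mv S ?M k y) x" by (rule mv_cong) (rule k)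
    then have "\<gamma> * \<bar>?\<nu> \<gamma> h x\<bar> = (1 - \<gamma>) * \<bar>k x - ?\<nu> \<gamma> k x\<bar>"
      using arg_cong[OF diff[OF \<gamma>, of k], of abs] \<gamma> by (simp add: abs_mult)
    also have "\<dots> \<le> (1 - \<gamma>) * (2 * K)"
    proof (rule mult_left_mono)
      have "\<bar>?\<nu> \<gamma> k x\<bar> \<le> K"
        using \<gamma> x K by (intro stochastic.mv_abs_le stochastic_mocc) auto
      then show "\<bar>k x - ?\<nu> \<gamma> k x\<bar> \<le> 2 * K" using K[OF x] by linarith
    qed (use \<gamma> in auto)
    finally show ?thesis using \<gamma> by (simp add: field_simps)
  qed
  have "((\<lambda>\<gamma>. 2 * K * ((1 - \<gamma>) / \<gamma>)) \<longlongrightarrow> 2 * K * ((1 - 1) / 1)) (at_left (1::real))"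
    by (intro tendsto_intros) auto
  then have "((\<lambda>\<gamma>. 2 * K * ((1 - \<gamma>) / \<gamma>)) \<longlongrightarrow> 0) (at_left (1::real))" by simp
  then have \<nu>h: "((\<lambda>\<gamma>. ?\<nu> \<gamma> h x) \<longlongrightarrow> 0) (at_left 1)"
    by (rule Lim_null_comparison[rotated]) (rule eventually_mono[OF near \<nu>h_bound])
  have "((\<lambda>\<gamma>. (h x - ?\<nu> \<gamma> h x) / \<gamma>) \<longlongrightarrow> (h x - 0) / 1) (at_left 1)"
    by (intro tendsto_intros \<nu>h) auto
  then have lim: "((\<lambda>\<gamma>. (h x - ?\<nu> \<gamma> h x) / \<gamma>) \<longlongrightarrow> h x) (at_left 1)" by simp
  have "disc_value P r \<pi> \<gamma> x - g x / (1 - \<gamma>) = (h x - ?\<nu> \<gamma> h x) / \<gamma>" if \<gamma>: "\<gamma> \<in> {0<..<1}" for \<gamma>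
  proof -
    have "(1 - \<gamma>) * disc_value P r \<pi> \<gamma> x = ?\<nu> \<gamma> (polr r \<pi>) x"
      using disc_value_mocc[OF pol x] \<gamma> by simp
    also have "\<dots> = ?\<nu> \<gamma> (\<lambda>y. g y + (h y - mv S ?M h y)) x"
      by (rule mv_cong) (simp add: h)
    finally have "(1 - \<gamma>) * disc_value P r \<pi> \<gamma> x = g x + ?\<nu> \<gamma> (\<lambda>y. h y - mv S ?M h y) x"
      by (simp add: mv_add inv[OF \<gamma>])
    moreover have "?\<nu> \<gamma> (\<lambda>y. h y - mv S ?M h y) x = (1 - \<gamma>) * ((h x - ?\<nu> \<gamma> h x) / \<gamma>)"
      using diff[OF \<gamma>, of h] \<gamma> by (simp add: field_simps)
    ultimately have "(1 - \<gamma>) * (disc_value P r \<pi> \<gamma> x - g x / (1 - \<gamma>))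
        = (1 - \<gamma>) * ((h x - ?\<nu> \<gamma> h x) / \<gamma>)"
      using \<gamma> by (simp add: right_diff_distrib)
    then show ?thesis using \<gamma> by (metis mult_cancel_left diff_eq_eq add_0 greaterThanLessThan_iff less_irrefl)
  qed
  from eventually_mono[OF near this] show ?thesis
    using lim by (subst tendsto_cong)
qed

lemma pv_tendsto: "(\<And>y. y < S \<Longrightarrow> ((\<lambda>k. u k y) \<longlongrightarrow> v y) F) \<Longrightarrow> ((\<lambda>k. pv S P s a (u k)) \<longlongrightarrow> pv S P s a v) F"
  unfolding pv_def by (intro tendsto_intros) auto

text \<open>The discounted Bellman inequality for the Blackwell-optimal policy, expanded in powers of
  \<open>1 - \<gamma>\<close>: the leading order says that the gain is superharmonic, the next order is the average-reward
  optimality equation.\<close>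

lemma blackwell_average_optimality:
  assumes S: "S \<ge> 1" and wc: "weakly_communicating S A P"
    and r: "\<And>s a. s < S \<Longrightarrow> a < A \<Longrightarrow> 0 \<le> r s a" "\<And>s a. s < S \<Longrightarrow> a < A \<Longrightarrow> r s a \<le> 1"
    and bw: "blackwell_optimal S A P r \<pi>"
  obtains \<rho> where "\<rho> \<le> 1" "\<And>s. s < S \<Longrightarrow> opt_gain S A P r s = \<rho>"
    "\<And>s a. s < S \<Longrightarrow> a < A \<Longrightarrow> r s a + pv S P s a (bias P r \<pi>) \<le> \<rho> + bias P r \<pi> s"
    "\<And>s. s < S \<Longrightarrow> \<exists>a<A. r s a + pv S P s a (bias P r \<pi>) = \<rho> + bias P r \<pi> s"
proof -
  have pol: "valid_policy S A \<pi>" using bw by (simp add: blackwell_optimal_def)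
  let ?M = "polM P \<pi>" and ?g = "gain P r \<pi>"
  interpret stochastic S ?M by (rule stochastic_polM) fact
  interpret lim: stochastic S "mlim S ?M" by (rule stochastic_mlim)
  obtain h where h': "\<And>x. x < S \<Longrightarrow> polr r \<pi> x = mv S (mlim S ?M) (polr r \<pi>) x + h x - mv S ?M h x"
    and h0: "\<And>x. x < S \<Longrightarrow> mv S (mlim S ?M) h x = 0"
    using poisson_equation[of "polr r \<pi>"] by auto
  have h: "polr r \<pi> x = ?g x + h x - mv S ?M h x" if "x < S" for x
    using h'[OF that] by (simp add: gain_eq[OF pol that])
  have bias: "bias P r \<pi> s = h s" if "s < S" for s by (rule bias_eq[OF pol that h h0])
  have g_inv: "mv S ?M ?g x = ?g x" if "x < S" for x
  proof -
    have "mv S ?M ?g x = mv S ?M (mv S (mlim S ?M) (polr r \<pi>)) x"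
      by (rule mv_cong) (simp add: gain_eq[OF pol])
    then show ?thesis using that by (simp add: mv_mv_mlim gain_eq[OF pol])
  qed
  have polr: "0 \<le> polr r \<pi> x" "polr r \<pi> x \<le> 1" if "x < S" for x
    unfolding polr_eq[OF pol that] using r that
    by (auto intro!: sum_nonneg mult_nonneg_nonneg policy_avg_le pol)
  have g_bounds: "0 \<le> ?g x" "?g x \<le> 1" if "x < S" for x
    unfolding gain_eq[OF pol that] using that polr by (auto intro!: lim.mv_ge lim.mv_le)
  let ?V = "disc_value P r \<pi>"
  obtain \<gamma>0 where \<gamma>0: "\<gamma>0 < 1"
    "\<forall>\<gamma>. \<gamma>0 < \<gamma> \<and> \<gamma> < 1 \<longrightarrow> (\<forall>\<pi>'. valid_policy S A \<pi>' \<longrightarrow> (\<forall>s<S. disc_value P r \<pi>' \<gamma> s \<le> ?V \<gamma> s))"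
    using bw by (auto simp: blackwell_optimal_def)
  \<comment> \<open>For \<gamma> close to 1 the value of the Blackwell-optimal policy coincides with
    the optimal value and inherits its Bellman inequality for every action.\<close>
  have bell: "r s a + \<gamma> * pv S P s a (?V \<gamma>) \<le> ?V \<gamma> s"
    if \<gamma>: "\<gamma> \<in> {max \<gamma>0 0<..<1}" and s: "s < S" and a: "a < A" for \<gamma> s a
  proof -
    interpret d: discounted_mdp S A P r \<gamma> using r \<gamma> by unfold_locales auto
    obtain d where d: "\<And>s. s < S \<Longrightarrow> d s < A" "\<And>s. s < S \<Longrightarrow> disc_value P r (det_pol d) \<gamma> s = d.opt s"
      using d.opt_greedy by metis
    have "valid_policy S A (det_pol d)" using d(1) by (simp add: valid_det_pol)
    then have "d.opt x \<le> ?V \<gamma> x" if "x < S" for x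
      using \<gamma>0(2)[rule_format, of \<gamma> "det_pol d" x] \<gamma> d(2)[OF that] that by auto
    then have eq: "?V \<gamma> x = d.opt x" if "x < S" for x
      using d.disc_value_le_opt[OF pol that] that by (simp add: antisym)
    have "pv S P s a (?V \<gamma>) = pv S P s a d.opt" by (rule pv_cong) (rule eq)
    then show ?thesis using d.opt_ge[OF s a] eq[OF s] by simp
  qed
  have near: "\<forall>\<^sub>F \<gamma> in at_left (1::real). \<gamma> \<in> {max \<gamma>0 0<..<1}"
    by (rule eventually_at_left_real) (simp add: \<gamma>0(1))
  define w where "w \<gamma> x = ?V \<gamma> x - ?g x / (1 - \<gamma>)" for \<gamma> x
  have w: "((\<lambda>\<gamma>. w \<gamma> x) \<longlongrightarrow> h x) (at_left 1)" if "x < S" for x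
    unfolding w_def by (rule disc_value_laurent[OF pol h g_inv h0 that])
  have nt: "at_left (1::real) \<noteq> bot" by simp
  have superharmonic: "pv S P s a ?g \<le> ?g s" if s: "s < S" and a: "a < A" for s a
  proof -
    have u: "((\<lambda>\<gamma>. (1 - \<gamma>) * w \<gamma> x + ?g x) \<longlongrightarrow> ?g x) (at_left 1)" if "x < S" for x
    proof -
      have "((\<lambda>\<gamma>. (1 - \<gamma>) * w \<gamma> x + ?g x) \<longlongrightarrow> (1 - 1) * h x + ?g x) (at_left 1)"
        by (intro tendsto_intros w that)
      then show ?thesis by simp
    qed
    have "((\<lambda>\<gamma>. (1 - \<gamma>) * r s a + \<gamma> * pv S P s a (\<lambda>x. (1 - \<gamma>) * w \<gamma> x + ?g x))
        \<longlongrightarrow> (1 - 1) * r s a + 1 * pv S P s a ?g) (at_left 1)"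
      by (intro tendsto_intros pv_tendsto u)
    then have l: "((\<lambda>\<gamma>. (1 - \<gamma>) * r s a + \<gamma> * pv S P s a (\<lambda>x. (1 - \<gamma>) * w \<gamma> x + ?g x))
        \<longlongrightarrow> pv S P s a ?g) (at_left 1)" by simp
    have "\<forall>\<^sub>F \<gamma> in at_left 1. (1 - \<gamma>) * r s a + \<gamma> * pv S P s a (\<lambda>x. (1 - \<gamma>) * w \<gamma> x + ?g x)
        \<le> (1 - \<gamma>) * w \<gamma> s + ?g s"
      using near
    proof eventually_elim
      case (elim \<gamma>)
      have V: "(1 - \<gamma>) * w \<gamma> x + ?g x = (1 - \<gamma>) * ?V \<gamma> x" for x
        using elim by (simp add: w_def right_diff_distrib)
      have "(1 - \<gamma>) * (r s a + \<gamma> * pv S P s a (?V \<gamma>)) \<le> (1 - \<gamma>) * ?V \<gamma> s"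
        using elim by (intro mult_left_mono bell s a) auto
      then show ?case unfolding V pv_cmult by (simp add: algebra_simps)
    qed
    from tendsto_le[OF nt u[OF s] l this] show ?thesis .
  qed
  \<comment> \<open>A constant gain is what makes the diverging terms \<rho> / (1 - \<gamma>) cancel
    between the two sides of the Bellman inequality at the next order.\<close>
  obtain \<rho> where \<rho>: "\<And>x. x < S \<Longrightarrow> ?g x = \<rho>"
    using weakly_communicating_superharmonic_const[OF wc g_bounds(1) superharmonic pol g_inv] by blast
  have opt_ineq: "r s a + pv S P s a h \<le> \<rho> + h s" if s: "s < S" and a: "a < A" for s a
  proof -
    have "((\<lambda>\<gamma>. r s a + \<gamma> * pv S P s a (w \<gamma>)) \<longlongrightarrow> r s a + 1 * pv S P s a h) (at_left 1)"
      by (intro tendsto_intros pv_tendsto w)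
    then have l: "((\<lambda>\<gamma>. r s a + \<gamma> * pv S P s a (w \<gamma>)) \<longlongrightarrow> r s a + pv S P s a h) (at_left 1)" by simp
    have u: "((\<lambda>\<gamma>. \<rho> + w \<gamma> s) \<longlongrightarrow> \<rho> + h s) (at_left 1)" by (intro tendsto_intros w s)
    have "\<forall>\<^sub>F \<gamma> in at_left 1. r s a + \<gamma> * pv S P s a (w \<gamma>) \<le> \<rho> + w \<gamma> s"
      using near
    proof eventually_elim
      case (elim \<gamma>)
      define q where "q = \<rho> / (1 - \<gamma>)"
      have q: "(1 - \<gamma>) * q = \<rho>" using elim by (simp add: q_def)
      have "pv S P s a (?V \<gamma>) = pv S P s a (\<lambda>x. w \<gamma> x + q)"
        by (rule pv_cong) (simp add: w_def \<rho> q_def)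
      also have "\<dots> = pv S P s a (w \<gamma>) + q" using s a by (simp add: pv_add pv_const)
      finally have "r s a + \<gamma> * (pv S P s a (w \<gamma>) + q) \<le> w \<gamma> s + q"
        using bell[OF elim s a] by (simp add: w_def \<rho>[OF s] q_def)
      with q show ?case by (simp add: algebra_simps)
    qed
    from tendsto_le[OF nt u l this] show ?thesis .
  qed
  \<comment> \<open>The Poisson equation of \<pi> says that the action values averaged over \<pi>
    equal \<rho> + h s, so the best action reaches at least this much.\<close>
  have attained: "\<exists>a<A. r s a + pv S P s a h = \<rho> + h s" if s: "s < S" for s
  proof -
    let ?Q = "(\<lambda>a. r s a + pv S P s a h) ` {..<A}"
    have "Max ?Q \<in> ?Q" using A_pos by (intro Max_in) (auto simp: lessThan_empty_iff)
    then obtain a where a: "a < A" "Max ?Q = r s a + pv S P s a h" by auto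
    have "(\<Sum>a<A. pmf (\<pi> s) a * (r s a + pv S P s a h)) \<le> Max ?Q"
      by (intro policy_avg_le[OF pol s] Max_ge) auto
    moreover have "(\<Sum>a<A. pmf (\<pi> s) a * (r s a + pv S P s a h)) = polr r \<pi> s + mv S ?M h s"
      by (simp add: polr_eq[OF pol s] mv_polM_eq[OF pol s] distrib_left sum.distrib)
    ultimately have "\<rho> + h s \<le> r s a + pv S P s a h" using h[OF s] \<rho>[OF s] a(2) by simp
    with opt_ineq[OF s a(1)] a(1) show ?thesis by (auto intro!: exI[of _ a])
  qed
  have pv_bias: "pv S P s a (bias P r \<pi>) = pv S P s a h" for s a by (rule pv_cong) (rule bias)
  show ?thesis
  proof (rule that[of \<rho>])
    show "\<rho> \<le> 1" using g_bounds(2)[of 0] \<rho>[of 0] S by simp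
    show "opt_gain S A P r s = \<rho>" if "s < S" for s
      unfolding opt_gain_def
    proof (rule cSup_eq_maximum)
      show "\<rho> \<in> (\<lambda>\<pi>. gain P r \<pi> s) ` {\<pi>. valid_policy S A \<pi>}"
        using pol \<rho>[OF that] by (auto intro!: image_eqI[of _ _ \<pi>])
      show "x \<le> \<rho>" if "x \<in> (\<lambda>\<pi>. gain P r \<pi> s) ` {\<pi>. valid_policy S A \<pi>}" for x
        using that gain_le[OF _ \<open>s < S\<close> opt_ineq] by auto
    qed
  qed (use opt_ineq attained in \<open>auto simp: bias pv_bias\<close>)
qed

end

section \<open>Bernstein bounds for the empirical kernel\<close>

definition pvar :: "nat \<Rightarrow> (nat \<Rightarrow> nat \<Rightarrow> nat pmf) \<Rightarrow> nat \<Rightarrow> nat \<Rightarrow> (nat \<Rightarrow> real) \<Rightarrow> real" where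
  "pvar S P s a v = pv S P s a (\<lambda>x. (v x)\<^sup>2) - (pv S P s a v)\<^sup>2"

text \<open>Only an upper bound on x is imposed, so the exponential moment needs a one-sided range
  condition. For x = - y < 0 the bound follows from exp y >= 1 + y and (1 - y + y^2)(1 + y) = 1 +
  y^3.\<close>

lemma exp_le_quadratic:
  fixes x :: real assumes "x \<le> 1" shows "exp x \<le> 1 + x + x\<^sup>2"
proof (cases "0 \<le> x")
  case True
  then show ?thesis using exp_bound[of x] assms by simp
next
  case False
  define y where "y = - x"
  have y: "y > 0" using False by (simp add: y_def)
  have "exp x = 1 / exp y" by (simp add: y_def exp_minus field_simps)
  also have "\<dots> \<le> 1 / (1 + y)" using y exp_ge_add_one_self[of y] by (intro divide_left_mono) auto
  also have "\<dots> \<le> 1 - y + y\<^sup>2"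
  proof -
    have "(1 - y + y\<^sup>2) * (1 + y) = 1 + y ^ 3" by (simp add: algebra_simps power2_eq_square power3_eq_cube)
    moreover have "0 \<le> y ^ 3" using y by simp
    ultimately have "1 \<le> (1 - y + y\<^sup>2) * (1 + y)" by linarith
    then show ?thesis using y by (simp add: divide_le_eq)
  qed
  finally show ?thesis by (simp add: y_def)
qed

lemma (in finite_mdp) pvar_eq:
  assumes "s < S" "a < A"
  shows "pvar S P s a v = pv S P s a (\<lambda>x. (v x - pv S P s a v)\<^sup>2)"
proof -
  let ?m = "pv S P s a v"
  have "pv S P s a (\<lambda>x. (v x - ?m)\<^sup>2) = pv S P s a (\<lambda>x. ((v x)\<^sup>2 - (2 * ?m) * v x) + ?m\<^sup>2)"
    by (rule pv_cong) (simp add: power2_eq_square algebra_simps)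
  also have "\<dots> = pv S P s a (\<lambda>x. (v x)\<^sup>2) - 2 * ?m * ?m + ?m\<^sup>2"
    by (simp only: pv_add pv_diff pv_cmult pv_const[OF assms])
  finally show ?thesis by (simp add: pvar_def power2_eq_square)
qed

lemma (in finite_mdp) pvar_nonneg: "s < S \<Longrightarrow> a < A \<Longrightarrow> 0 \<le> pvar S P s a v"
  by (simp add: pvar_eq) (intro pv_ge, auto)

lemma (in finite_mdp) exp_moment_le:
  assumes sa: "s < S" "a < A" and le: "\<And>y. y < S \<Longrightarrow> \<eta> * (v y - pv S P s a v) \<le> 1"
  shows "pv S P s a (\<lambda>y. exp (\<eta> * (v y - pv S P s a v))) \<le> exp (\<eta>\<^sup>2 * pvar S P s a v)"
proof -
  let ?m = "pv S P s a v"
  have "pv S P s a (\<lambda>y. exp (\<eta> * (v y - ?m)))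
      \<le> pv S P s a (\<lambda>y. 1 + \<eta> * (v y - ?m) + (\<eta> * (v y - ?m))\<^sup>2)"
    by (intro pv_mono exp_le_quadratic le)
  also have "\<dots> = 1 + \<eta>\<^sup>2 * pvar S P s a v"
    unfolding pvar_eq[OF sa] power_mult_distrib pv_add pv_cmult pv_diff pv_const[OF sa] by simp
  also have "\<dots> \<le> exp (\<eta>\<^sup>2 * pvar S P s a v)" by (rule exp_ge_add_one_self)
  finally show ?thesis .
qed

text \<open>Chernoff's method with the parameter \<eta> left free. Optimising it would produce a
  square root of the variance, whereas the present form is linear in the variance.\<close>

lemma (in finite_mdp) bernstein_iid:
  assumes J: "finite J" and sa: "s < S" "a < A"
    and le: "\<And>y. y < S \<Longrightarrow> \<eta> * (v y - pv S P s a v) \<le> 1" and \<eta>: "\<eta> > 0"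
  shows "measure_pmf.prob (Pi_pmf J d (\<lambda>_. P s a))
     {\<omega>. (\<Sum>j\<in>J. v (\<omega> j) - pv S P s a v) \<ge> real (card J) * (\<eta> * pvar S P s a v) + L / \<eta>} \<le> exp (- L)"
proof -
  let ?m = "pv S P s a v" and ?V = "pvar S P s a v" and ?n = "real (card J)"
  let ?p = "Pi_pmf J d (\<lambda>_. P s a)"
  let ?Z = "\<lambda>\<omega>. \<Prod>j\<in>J. exp (\<eta> * (v (\<omega> j) - ?m))"
  have supp: "set_pmf (P s a) \<subseteq> {..<S}" using kernel sa by (simp add: valid_kernel_def)
  then have fin: "finite (set_pmf (P s a))" by (rule finite_subset) simp
  have "set_pmf ?p \<subseteq> PiE_dflt J d (\<lambda>_. set_pmf (P s a))"
    using set_Pi_pmf_subset'[OF J, of d "\<lambda>_. P s a"] by (simp add: o_def)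
  moreover have "finite (PiE_dflt J d (\<lambda>_. set_pmf (P s a)))"
    using J fin by (rule finite_PiE_dflt)
  ultimately have fin': "finite (set_pmf ?p)" by (rule finite_subset)
  have E: "measure_pmf.expectation (P s a) (\<lambda>y. exp (\<eta> * (v y - ?m))) = pv S P s a (\<lambda>y. exp (\<eta> * (v y - ?m)))"
    unfolding pv_def using supp by (subst integral_measure_pmf_real[of "{..<S}"]) (auto simp: mult.commute)
  let ?t = "exp (?n * (\<eta>\<^sup>2 * ?V) + L)"
  have "measure_pmf.prob ?p {\<omega>. (\<Sum>j\<in>J. v (\<omega> j) - ?m) \<ge> ?n * (\<eta> * ?V) + L / \<eta>}
      \<le> measure_pmf.prob ?p {\<omega> \<in> space ?p. ?t \<le> ?Z \<omega>}"
  proof (rule measure_pmf.finite_measure_mono, safe)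
    fix \<omega> assume "(\<Sum>j\<in>J. v (\<omega> j) - ?m) \<ge> ?n * (\<eta> * ?V) + L / \<eta>"
    then have "\<eta> * (?n * (\<eta> * ?V) + L / \<eta>) \<le> \<eta> * (\<Sum>j\<in>J. v (\<omega> j) - ?m)"
      using \<eta> by (intro mult_left_mono) auto
    moreover have "\<eta> * (?n * (\<eta> * ?V) + L / \<eta>) = ?n * (\<eta>\<^sup>2 * ?V) + L"
      using \<eta> by (simp add: field_simps power2_eq_square)
    ultimately have "?n * (\<eta>\<^sup>2 * ?V) + L \<le> (\<Sum>j\<in>J. \<eta> * (v (\<omega> j) - ?m))"
      by (simp add: sum_distrib_left)
    then show "?t \<le> ?Z \<omega>" using J by (simp add: exp_sum[symmetric])
  qed auto
  also have "\<dots> \<le> measure_pmf.expectation ?p ?Z / ?t"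
    by (rule integral_Markov_inequality_measure[where A = UNIV])
      (auto intro!: integrable_measure_pmf_finite fin' prod_nonneg)
  also have "measure_pmf.expectation ?p ?Z = (\<Prod>j\<in>J. pv S P s a (\<lambda>y. exp (\<eta> * (v y - ?m))))"
    unfolding E[symmetric] using J fin
    by (intro expectation_prod_Pi_pmf) (auto intro: integrable_measure_pmf_finite)
  also have "\<dots> / ?t \<le> (\<Prod>j\<in>J. exp (\<eta>\<^sup>2 * ?V)) / ?t"
    using exp_moment_le[OF sa le] by (intro divide_right_mono prod_mono) (auto intro!: pv_ge sa)
  also have "(\<Prod>j\<in>J. exp (\<eta>\<^sup>2 * ?V)) = exp (?n * (\<eta>\<^sup>2 * ?V))" by (simp add: exp_of_nat_mult)
  also have "exp (?n * (\<eta>\<^sup>2 * ?V)) / ?t = exp (- L)" by (simp add: exp_diff[symmetric])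
  finally show ?thesis .
qed

text \<open>Condition on the samples outside the block J. Test function and rate are then constants,
  the block is still i.i.d., and the uniform bound on the slices integrates to the same
  bound.\<close>

lemma (in finite_mdp) bernstein_block:
  fixes F :: "('i \<Rightarrow> nat) \<Rightarrow> nat \<Rightarrow> real" and \<Lambda> :: "('i \<Rightarrow> nat) \<Rightarrow> real"
  assumes I: "finite I" "J \<subseteq> I" and q: "\<And>j. j \<in> J \<Longrightarrow> q j = P s a" and sa: "s < S" "a < A"
    and indep: "\<And>\<omega> \<omega>'. (\<And>i. i \<in> I - J \<Longrightarrow> \<omega> i = \<omega>' i) \<Longrightarrow> F \<omega> = F \<omega>' \<and> \<Lambda> \<omega> = \<Lambda> \<omega>'"
  shows "measure_pmf.prob (Pi_pmf I d q)
     {\<omega>. \<Lambda> \<omega> > 0 \<and> (\<forall>y<S. \<Lambda> \<omega> * (F \<omega> y - pv S P s a (F \<omega>)) \<le> 1) \<and>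
       (\<Sum>j\<in>J. F \<omega> (\<omega> j) - pv S P s a (F \<omega>))
         \<ge> real (card J) * (\<Lambda> \<omega> * pvar S P s a (F \<omega>)) + L / \<Lambda> \<omega>} \<le> exp (- L)"
    (is "measure_pmf.prob _ ?X \<le> _")
proof -
  have J: "finite J" using I finite_subset by blast
  let ?h = "\<lambda>f g x. if x \<in> I - J then f x else g x"
  have "Pi_pmf I d q = Pi_pmf ((I - J) \<union> J) d q" using I by (simp add: Un_absorb2)
  also have "\<dots> = map_pmf (\<lambda>(f, g). ?h f g) (pair_pmf (Pi_pmf (I - J) d q) (Pi_pmf J d q))"
    using I J by (subst Pi_pmf_union) auto
  also have "\<dots> = bind_pmf (Pi_pmf (I - J) d q) (\<lambda>f. map_pmf (?h f) (Pi_pmf J d q))"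
    by (simp add: pair_pmf_def map_bind_pmf map_pmf_def bind_assoc_pmf bind_return_pmf)
  finally have decomp: "Pi_pmf I d q = \<dots>" .
  have "Pi_pmf J d q = Pi_pmf J d (\<lambda>_. P s a)" using J q by (intro Pi_pmf_cong) auto
  note J_iid = this
  have slice: "emeasure (map_pmf (?h f) (Pi_pmf J d q)) ?X \<le> ennreal (exp (- L))" for f
  proof -
    \<comment> \<open>The zeros on J are an arbitrary filler: by independence F and \<Lambda> do not
      read these coordinates.\<close>
    define v where "v = F (?h f (\<lambda>_. 0))"
    define \<eta> where "\<eta> = \<Lambda> (?h f (\<lambda>_. 0))"
    have eq: "F (?h f g) = v" "\<Lambda> (?h f g) = \<eta>" for g
      using indep[of "?h f g" "?h f (\<lambda>_. 0)"] by (simp_all add: v_def \<eta>_def)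
    have sum: "(\<Sum>j\<in>J. v (?h f g j) - c) = (\<Sum>j\<in>J. v (g j) - c)" for g c
      by (intro sum.cong refl) auto
    have "measure_pmf.prob (Pi_pmf J d q) (?h f -` ?X) \<le> exp (- L)"
    proof (cases "\<eta> > 0 \<and> (\<forall>y<S. \<eta> * (v y - pv S P s a v) \<le> 1)")
      case True
      then have "?h f -` ?X = {g. (\<Sum>j\<in>J. v (g j) - pv S P s a v)
          \<ge> real (card J) * (\<eta> * pvar S P s a v) + L / \<eta>}"
        unfolding vimage_def mem_Collect_eq eq sum by simp
      then show ?thesis using bernstein_iid[OF J sa, of \<eta> v d L] True by (simp add: J_iid)
    next
      case False
      then have "?h f -` ?X = {}" unfolding vimage_def mem_Collect_eq eq by auto
      then show ?thesis by (simp only: measure_empty exp_ge_zero)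
    qed
    then show ?thesis by (simp add: measure_pmf.emeasure_eq_measure)
  qed
  have "emeasure (Pi_pmf I d q) ?X \<le> (\<integral>\<^sup>+ f. ennreal (exp (- L)) \<partial>measure_pmf (Pi_pmf (I - J) d q))"
    unfolding decomp emeasure_bind_pmf by (intro nn_integral_mono slice)
  then show ?thesis by (simp add: measure_pmf.emeasure_eq_measure)
qed

section \<open>The empirical kernel as an average over samples\<close>

lemma samples_support:
  assumes "\<omega> \<in> set_pmf (samples S A n P)" "valid_kernel S A P" "s < S" "a < A" "i < n"
  shows "\<omega> (s, a, i) < S"
proof -
  have "\<omega> \<in> PiE_dflt ({..<S} \<times> {..<A} \<times> {..<n}) 0 (set_pmf \<circ> (\<lambda>(s, a, i). P s a))"
    using assms(1) set_Pi_pmf_subset'[of "{..<S} \<times> {..<A} \<times> {..<n}" 0 "\<lambda>(s, a, i). P s a"]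
    unfolding samples_def by blast
  then have "\<omega> (s, a, i) \<in> set_pmf (P s a)" using assms by (auto simp: PiE_dflt_def)
  then show ?thesis using assms by (auto simp: valid_kernel_def)
qed

lemma emp_kernel_set: "n \<ge> 1 \<Longrightarrow> set_pmf (emp_kernel n \<omega> s a) = (\<lambda>i. \<omega> (s, a, i)) ` {..<n}"
  unfolding emp_kernel_def by (subst set_map_pmf, subst set_pmf_of_set) (auto simp: lessThan_empty_iff)

lemma valid_emp_kernel:
  assumes "\<omega> \<in> set_pmf (samples S A n P)" "valid_kernel S A P" "n \<ge> 1"
  shows "valid_kernel S A (emp_kernel n \<omega>)"
  unfolding valid_kernel_def using assms by (auto simp: emp_kernel_set intro: samples_support)

lemma pv_emp_kernel:
  assumes "\<omega> \<in> set_pmf (samples S A n P)" "valid_kernel S A P" "n \<ge> 1" "s < S" "a < A"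
  shows "real n * pv S (emp_kernel n \<omega>) s a v = (\<Sum>i<n. v (\<omega> (s, a, i)))"
proof -
  have "pv S (emp_kernel n \<omega>) s a v = measure_pmf.expectation (emp_kernel n \<omega> s a) v"
    unfolding pv_def using valid_emp_kernel[OF assms(1-3)] assms(4,5)
    by (subst integral_measure_pmf_real[of "{..<S}"]) (auto simp: mult.commute valid_kernel_def)
  also have "\<dots> = (\<Sum>i<n. v (\<omega> (s, a, i))) / real n"
    unfolding emp_kernel_def using assms(3)
    by (simp add: integral_pmf_of_set lessThan_empty_iff)
  finally show ?thesis using assms(3) by simp
qed

lemma (in finite_mdp) emp_kernel_bernstein:
  fixes F :: "(nat \<times> nat \<times> nat \<Rightarrow> nat) \<Rightarrow> nat \<Rightarrow> real"
  assumes n: "n \<ge> 1" and sa: "s < S" "a < A"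
    and indep: "\<And>\<omega> \<omega>'. (\<And>s' a' i. s' < S \<Longrightarrow> a' < A \<Longrightarrow> i < n \<Longrightarrow> (s', a') \<noteq> (s, a)
      \<Longrightarrow> \<omega> (s', a', i) = \<omega>' (s', a', i)) \<Longrightarrow> F \<omega> = F \<omega>' \<and> \<Lambda> \<omega> = \<Lambda> \<omega>'"
  shows "measure_pmf.prob (samples S A n P)
     {\<omega>. \<Lambda> \<omega> > 0 \<and> (\<forall>y<S. \<Lambda> \<omega> * (F \<omega> y - pv S P s a (F \<omega>)) \<le> 1) \<and>
       pv S (emp_kernel n \<omega>) s a (F \<omega>) - pv S P s a (F \<omega>)
         \<ge> \<Lambda> \<omega> * pvar S P s a (F \<omega>) + L / (\<Lambda> \<omega> * real n)} \<le> exp (- L)"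
    (is "measure_pmf.prob _ ?X \<le> _")
proof -
  let ?I = "{..<S} \<times> {..<A} \<times> {..<n}" and ?J = "{s} \<times> {a} \<times> {..<n}"
  have cardJ: "card ?J = n" by (simp add: card_cartesian_product)
  have "?J = (\<lambda>i. (s, a, i)) ` {..<n}" by auto
  then have sumJ: "(\<Sum>j\<in>?J. u (\<omega> j) - c) = (\<Sum>i<n. u (\<omega> (s, a, i))) - real n * c" for u :: "nat \<Rightarrow> real" and \<omega> c
    by (simp add: sum.reindex inj_on_def sum_subtractf card_image)
  let ?Y = "{\<omega>. \<Lambda> \<omega> > 0 \<and> (\<forall>y<S. \<Lambda> \<omega> * (F \<omega> y - pv S P s a (F \<omega>)) \<le> 1) \<and>
       (\<Sum>j\<in>?J. F \<omega> (\<omega> j) - pv S P s a (F \<omega>))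
         \<ge> real (card ?J) * (\<Lambda> \<omega> * pvar S P s a (F \<omega>)) + L / \<Lambda> \<omega>}"
  \<comment> \<open>On the support every sample is a state, which is what lets the sum over states
    in \<open>pv\<close> be rewritten as a sum over the n samples.\<close>
  have "measure_pmf.prob (samples S A n P) ?X
      = measure_pmf.prob (samples S A n P) (?X \<inter> set_pmf (samples S A n P))"
    by (simp add: measure_Int_set_pmf)
  also have "\<dots> \<le> measure_pmf.prob (samples S A n P) ?Y"
  proof (rule measure_pmf.finite_measure_mono, rule subsetI)
    fix \<omega> assume \<omega>: "\<omega> \<in> ?X \<inter> set_pmf (samples S A n P)"
    let ?m = "pv S P s a (F \<omega>)" and ?V = "\<Lambda> \<omega> * pvar S P s a (F \<omega>)"
    have \<Lambda>: "\<Lambda> \<omega> > 0" using \<omega> by simp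
    have "real n * (?V + L / (\<Lambda> \<omega> * real n)) \<le> real n * (pv S (emp_kernel n \<omega>) s a (F \<omega>) - ?m)"
      using \<omega> by (intro mult_left_mono) auto
    then have "real n * ?V + L / \<Lambda> \<omega> \<le> (\<Sum>i<n. F \<omega> (\<omega> (s, a, i))) - real n * ?m"
      using n \<Lambda> pv_emp_kernel[of \<omega> S A n P s a "F \<omega>"] kernel sa \<omega>
      by (simp add: distrib_left right_diff_distrib)
    then show "\<omega> \<in> ?Y" using \<omega> by (simp only: sumJ cardJ mem_Collect_eq Int_iff) blast
  qed simp
  also have "\<dots> \<le> exp (- L)"
    unfolding samples_def
  proof (rule bernstein_block)
    fix \<omega> \<omega>' :: "nat \<times> nat \<times> nat \<Rightarrow> nat"
    assume "\<And>i. i \<in> ?I - ?J \<Longrightarrow> \<omega> i = \<omega>' i"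
    then show "F \<omega> = F \<omega>' \<and> \<Lambda> \<omega> = \<Lambda> \<omega>'" by (intro indep) auto
  qed (use sa in auto)
  finally show ?thesis .
qed

section \<open>Accumulated one-step errors\<close>

text \<open>The mean minimises the second moment about a constant, so a variance may be bounded by
  recentring at any convenient point.\<close>

lemma (in finite_mdp) pvar_le:
  assumes sa: "s < S" "a < A"
  shows "pvar S P s a v \<le> pv S P s a (\<lambda>x. (v x - c)\<^sup>2)"
proof -
  let ?m = "pv S P s a v"
  have "pv S P s a (\<lambda>x. (v x - c)\<^sup>2) = pv S P s a (\<lambda>x. ((v x - ?m)\<^sup>2 + 2 * (?m - c) * (v x - ?m)) + (?m - c)\<^sup>2)"
    by (rule pv_cong) (simp add: power2_eq_square algebra_simps)
  also have "\<dots> = pvar S P s a v + 2 * (?m - c) * (?m - ?m) + (?m - c)\<^sup>2"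
    by (simp only: pv_add pv_cmult pv_diff pv_const[OF sa] pvar_eq[OF sa])
  finally show ?thesis by simp
qed

lemma (in finite_mdp) pvar_shift:
  assumes sa: "s < S" "a < A"
  shows "pvar S P s a (\<lambda>x. v x - c) = pvar S P s a v"
  by (simp add: pvar_eq[OF sa] pv_diff pv_const[OF sa])

lemma (in finite_mdp) pvar_perturb:
  assumes sa: "s < S" "a < A" and e: "\<And>y. y < S \<Longrightarrow> \<bar>u y - v y\<bar> \<le> e"
  shows "pvar S P s a u \<le> 2 * pvar S P s a v + 2 * e\<^sup>2"
proof -
  let ?m = "pv S P s a v"
  have "pvar S P s a u \<le> pv S P s a (\<lambda>x. (u x - ?m)\<^sup>2)" by (rule pvar_le[OF sa])
  also have "\<dots> \<le> pv S P s a (\<lambda>x. 2 * (v x - ?m)\<^sup>2 + 2 * e\<^sup>2)"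
  proof (rule pv_mono)
    fix y assume y: "y < S"
    have "(u y - v y)\<^sup>2 \<le> e\<^sup>2" using e[OF y] by (metis abs_ge_zero power2_abs power_mono)
    moreover have "(u y - ?m)\<^sup>2 \<le> 2 * (v y - ?m)\<^sup>2 + 2 * (u y - v y)\<^sup>2"
      using zero_le_power2[of "(v y - ?m) - (u y - v y)"] by (simp add: power2_eq_square algebra_simps)
    ultimately show "(u y - ?m)\<^sup>2 \<le> 2 * (v y - ?m)\<^sup>2 + 2 * e\<^sup>2" by linarith
  qed
  also have "\<dots> = 2 * pvar S P s a v + 2 * e\<^sup>2"
    by (simp only: pv_add pv_cmult pv_const[OF sa] pvar_eq[OF sa])
  finally show ?thesis .
qed

text \<open>Squaring is 2B-Lipschitz on [0, B]. This returns a deviation bound for h^2 to the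
  variance of h, so that it can be absorbed.\<close>

lemma (in finite_mdp) pvar_square:
  assumes sa: "s < S" "a < A" and v: "\<And>y. y < S \<Longrightarrow> 0 \<le> v y" "\<And>y. y < S \<Longrightarrow> v y \<le> B"
  shows "pvar S P s a (\<lambda>x. (v x)\<^sup>2) \<le> 4 * B\<^sup>2 * pvar S P s a v"
proof -
  let ?m = "pv S P s a v"
  have m: "0 \<le> ?m" "?m \<le> B" using v by (auto intro!: pv_ge pv_le sa)
  have "pvar S P s a (\<lambda>x. (v x)\<^sup>2) \<le> pv S P s a (\<lambda>x. ((v x)\<^sup>2 - ?m\<^sup>2)\<^sup>2)" by (rule pvar_le[OF sa])
  also have "\<dots> \<le> pv S P s a (\<lambda>x. (4 * B\<^sup>2) * (v x - ?m)\<^sup>2)"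
  proof (rule pv_mono)
    fix y assume y: "y < S"
    have "(v y + ?m)\<^sup>2 \<le> (2 * B)\<^sup>2" using v[OF y] m by (intro power_mono) auto
    then have "(v y + ?m)\<^sup>2 * (v y - ?m)\<^sup>2 \<le> (4 * B\<^sup>2) * (v y - ?m)\<^sup>2"
      by (intro mult_right_mono) (auto simp: power2_eq_square)
    also have "(v y + ?m)\<^sup>2 * (v y - ?m)\<^sup>2 = ((v y)\<^sup>2 - ?m\<^sup>2)\<^sup>2"
      by (simp add: power2_eq_square algebra_simps)
    finally show "((v y)\<^sup>2 - ?m\<^sup>2)\<^sup>2 \<le> (4 * B\<^sup>2) * (v y - ?m)\<^sup>2" .
  qed
  also have "\<dots> = 4 * B\<^sup>2 * pvar S P s a v" by (simp only: pv_cmult pvar_eq[OF sa])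
  finally show ?thesis .
qed

text \<open>Under a stationary law \<open>\<mu>\<close> of \<open>P\<close> the one-step variance of \<open>V\<close> telescopes:
  \<open>\<mu> (P V\<^sup>2 - (P V)\<^sup>2) = \<mu> ((V - P V) (V + P V))\<close>, so it is of the order of the span of \<open>V\<close>, not its
  square.\<close>

lemma (in finite_mdp) stationary_error_le:
  fixes d :: "nat \<Rightarrow> nat" and V e :: "nat \<Rightarrow> real"
  defines "M \<equiv> polM P (det_pol d)"
  assumes d: "\<And>x. x < S \<Longrightarrow> d x < A" and s: "s < S"
    and V: "\<And>x. x < S \<Longrightarrow> m \<le> V x" "\<And>x. x < S \<Longrightarrow> V x \<le> m + \<sigma>"
    and step: "\<And>x. x < S \<Longrightarrow> \<bar>V x - pv S P x (d x) V\<bar> \<le> 2 + \<bar>e x\<bar>"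
    and e: "\<And>x. x < S \<Longrightarrow> \<bar>e x\<bar> \<le> l * pvar S P x (d x) V + b"
    and l: "0 \<le> l" "4 * l * \<sigma> \<le> 1"
  shows "mv S (mlim S M) (\<lambda>x. \<bar>e x\<bar>) s \<le> 8 * l * \<sigma> + 2 * b"
proof -
  have pol: "valid_policy S A (det_pol d)" using d by (simp add: valid_det_pol)
  interpret stochastic S M unfolding M_def by (rule stochastic_polM[OF pol])
  interpret lim: stochastic S "mlim S M" by (rule stochastic_mlim)
  let ?E = "mv S (mlim S M)" and ?V = "\<lambda>x. V x - m"
  let ?K = "\<lambda>v x. pv S P x (d x) v"
  let ?x = "?E (\<lambda>x. \<bar>e x\<bar>) s" and ?v = "?E (\<lambda>x. pvar S P x (d x) V) s"
  have K: "mv S M v x = ?K v x" for v :: "nat \<Rightarrow> real" and x by (simp add: M_def mv_det_pol)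
  have \<sigma>: "0 \<le> \<sigma>" using V[OF s] by linarith
  have KV: "0 \<le> ?K ?V x" "?K ?V x \<le> \<sigma>" if "x < S" for x
    using V by (auto intro!: pv_ge pv_le that d simp: algebra_simps)
  have "?v = ?E (\<lambda>x. pvar S P x (d x) ?V) s"
    by (rule mv_cong) (simp add: pvar_shift d)
  \<comment> \<open>Stationarity removes the operator M in front of the square; what is left factors
    as a difference of squares, whose sum factor is at most 2 \<sigma> after the shift by m.\<close>
  also have "\<dots> = ?E (\<lambda>x. mv S M (\<lambda>y. (?V y)\<^sup>2) x - (?K ?V x)\<^sup>2) s"
    by (simp only: pvar_def K)
  also have "\<dots> = ?E (\<lambda>y. (?V y)\<^sup>2) s - ?E (\<lambda>x. (?K ?V x)\<^sup>2) s"
    by (simp only: mv_diff mv_mlim_mv[OF s])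
  also have "\<dots> = ?E (\<lambda>x. (?V x)\<^sup>2 - (?K ?V x)\<^sup>2) s" by (simp only: mv_diff)
  also have "\<dots> \<le> ?E (\<lambda>x. 2 * \<sigma> * (2 + \<bar>e x\<bar>)) s"
  proof (rule lim.mv_mono[OF s])
    fix x assume x: "x < S"
    have "?V x - ?K ?V x = V x - ?K V x" using d[OF x] x by (simp add: pv_diff pv_const)
    then have "\<bar>?V x - ?K ?V x\<bar> \<le> 2 + \<bar>e x\<bar>" using step[OF x] by simp
    moreover have "0 \<le> ?V x + ?K ?V x" "?V x + ?K ?V x \<le> 2 * \<sigma>"
      using V[OF x] KV[OF x] by linarith+
    ultimately have "(?V x + ?K ?V x) * (?V x - ?K ?V x) \<le> (2 * \<sigma>) * (2 + \<bar>e x\<bar>)"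
      using \<sigma> by (intro order_trans[OF mult_left_mono[OF abs_ge_self] mult_mono]) auto
    then show "(?V x)\<^sup>2 - (?K ?V x)\<^sup>2 \<le> 2 * \<sigma> * (2 + \<bar>e x\<bar>)"
      by (simp add: power2_eq_square algebra_simps)
  qed
  also have "\<dots> = 2 * \<sigma> * (2 + ?x)" by (simp only: mv_cmult mv_add lim.mv_const[OF s])
  finally have v: "?v \<le> 2 * \<sigma> * (2 + ?x)" .
  have x0: "0 \<le> ?x" by (intro lim.mv_ge s) auto
  have "?x \<le> ?E (\<lambda>x. l * pvar S P x (d x) V + b) s" by (intro lim.mv_mono s e)
  also have "\<dots> = l * ?v + b" by (simp only: mv_cmult mv_add lim.mv_const[OF s])
  also have "\<dots> \<le> l * (2 * \<sigma> * (2 + ?x)) + b" using v l by (intro add_right_mono mult_left_mono) auto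
  also have "\<dots> = 4 * l * \<sigma> + (4 * l * \<sigma>) * ?x / 2 + b" by (simp add: algebra_simps)
  \<comment> \<open>Since 4 l \<sigma> <= 1, at most half of \<open>?x\<close> stands on the right.
    Absorbing it doubles the remaining terms.\<close>
  also have "\<dots> \<le> 4 * l * \<sigma> + 1 * ?x / 2 + b"
    using l x0 by (intro add_right_mono add_left_mono divide_right_mono mult_right_mono) auto
  finally show ?thesis by simp
qed

text \<open>Here e is the model error (Q - P) V. Integrated against the stationary law of P, the
  approximate Bellman inequality leaves (1 - \<gamma>) times the mean of V, which is at least (1 -
  \<gamma>) m, minus the errors.\<close>

lemma (in finite_mdp) gain_ge:
  fixes d :: "nat \<Rightarrow> nat" and V e :: "nat \<Rightarrow> real"
  assumes d: "\<And>x. x < S \<Longrightarrow> d x < A" and s: "s < S" and \<gamma>: "0 \<le> \<gamma>" "\<gamma> \<le> 1"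
    and V: "\<And>x. x < S \<Longrightarrow> m \<le> V x"
    and r: "\<And>x. x < S \<Longrightarrow> V x - \<gamma> * (pv S P x (d x) V + e x) - \<epsilon> \<le> r x (d x)"
  shows "(1 - \<gamma>) * m - mv S (mlim S (polM P (det_pol d))) (\<lambda>x. \<bar>e x\<bar>) s - \<epsilon> \<le> gain P r (det_pol d) s"
proof -
  have pol: "valid_policy S A (det_pol d)" using d by (simp add: valid_det_pol)
  let ?M = "polM P (det_pol d)"
  interpret stochastic S ?M by (rule stochastic_polM[OF pol])
  interpret lim: stochastic S "mlim S ?M" by (rule stochastic_mlim)
  let ?E = "mv S (mlim S ?M)"
  have "(1 - \<gamma>) * m \<le> (1 - \<gamma>) * ?E V s"
    using \<gamma> V by (intro mult_left_mono lim.mv_ge s) auto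
  moreover have "\<gamma> * ?E e s \<le> ?E (\<lambda>x. \<bar>e x\<bar>) s"
    unfolding mv_cmult[symmetric]
  proof (rule lim.mv_mono[OF s])
    fix x
    have "\<gamma> * e x \<le> \<gamma> * \<bar>e x\<bar>" using \<gamma> by (intro mult_left_mono) auto
    also have "\<dots> \<le> 1 * \<bar>e x\<bar>" using \<gamma> by (intro mult_right_mono) auto
    finally show "\<gamma> * e x \<le> \<bar>e x\<bar>" by simp
  qed
  moreover have "(1 - \<gamma>) * ?E V s - \<gamma> * ?E e s - \<epsilon> = ?E (\<lambda>x. V x - \<gamma> * (mv S ?M V x + e x) - \<epsilon>) s"
    by (simp only: mv_diff mv_cmult mv_add mv_mlim_mv[OF s] lim.mv_const[OF s]) (simp add: algebra_simps)
  moreover have "\<dots> \<le> ?E (polr r (det_pol d)) s"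
    using r by (intro lim.mv_mono s) (simp add: mv_det_pol polr_det_pol)
  ultimately show ?thesis unfolding gain_eq[OF pol s] by linarith
qed

text \<open>The same telescoping for the discounted occupation measure \<open>\<nu>\<close> of \<open>Q\<close>, with \<open>Q\<close> replaced by
  \<open>P\<close> inside the variance at the cost of the deviation of \<open>Q - P\<close> on \<open>h\<^sup>2\<close>.\<close>

lemma occupation_error_le:
  fixes P Q :: "nat \<Rightarrow> nat \<Rightarrow> nat pmf" and h :: "nat \<Rightarrow> real" and d :: "nat \<Rightarrow> nat"
  defines "M \<equiv> polM Q (det_pol d)"
  assumes mdp: "finite_mdp S A P" "finite_mdp S A Q"
    and d: "\<And>x. x < S \<Longrightarrow> d x < A" and s: "s < S" and \<gamma>: "0 \<le> \<gamma>" "\<gamma> < 1"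
    and h: "\<And>x. x < S \<Longrightarrow> 0 \<le> h x" "\<And>x. x < S \<Longrightarrow> h x \<le> B"
    and step: "\<And>x. x < S \<Longrightarrow> - 1 \<le> h x - pv S P x (d x) h"
    and dev: "\<And>x. x < S \<Longrightarrow> \<bar>pv S Q x (d x) h - pv S P x (d x) h\<bar> \<le> l * pvar S P x (d x) h + b"
    and dev2: "\<And>x. x < S \<Longrightarrow> \<bar>pv S Q x (d x) (\<lambda>y. (h y)\<^sup>2) - pv S P x (d x) (\<lambda>y. (h y)\<^sup>2)\<bar>
        \<le> pvar S P x (d x) h / 2 + b2"
    and l: "0 \<le> l" "l * B \<le> q" "b \<le> q" "q \<le> 1 / 8" "b2 \<le> B / 8" and \<gamma>B: "(1 - \<gamma>) * B \<le> 1"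
  shows "\<bar>mv S (mocc S M \<gamma>) (\<lambda>x. h x - pv S P x (d x) h) s\<bar> \<le> (1 - \<gamma>) * B + 24 * q"
proof -
  interpret P: finite_mdp S A P by fact
  interpret Q: finite_mdp S A Q by fact
  have pol: "valid_policy S A (det_pol d)" using d by (simp add: valid_det_pol)
  interpret stochastic S M unfolding M_def by (rule Q.stochastic_polM[OF pol])
  interpret occ: stochastic S "mocc S M \<gamma>" by (rule stochastic_mocc[OF \<gamma>])
  let ?N = "\<lambda>v. mv S (mocc S M \<gamma>) v s"
  let ?K = "\<lambda>v x. pv S P x (d x) v" and ?L = "\<lambda>v x. pv S Q x (d x) v"
  let ?h2 = "\<lambda>y. (h y)\<^sup>2"
  define e where "e x = ?L h x - ?K h x" for x
  define e2 where "e2 x = ?L ?h2 x - ?K ?h2 x" for x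
  define V where "V x = pvar S P x (d x) h" for x
  let ?x = "?N (\<lambda>x. \<bar>e x\<bar>)" and ?v = "?N V"
  have B: "0 \<le> B" using h[OF s] by linarith
  have stepQ: "mv S M v x = ?L v x" for v :: "nat \<Rightarrow> real" and x by (simp add: M_def mv_det_pol)
  \<comment> \<open>The occupation law is invariant for Q only up to 1 - \<gamma>, so each
    telescoping pays (1 - \<gamma>) times the range of the function.\<close>
  have flow: "?N (?L v) - ?N v = (1 - \<gamma>) * (?N (?L v) - v s)" for v
    using mocc_unfold[OF \<gamma> s, of v] unfolding stepQ by (simp add: algebra_simps)
  have x0: "0 \<le> ?x" by (intro occ.mv_ge s) auto
  have Ne: "\<bar>?N e\<bar> \<le> ?x"
  proof (rule abs_leI)
    show "?N e \<le> ?x" by (intro occ.mv_mono s) auto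
    have "?N (\<lambda>x. (- 1) * e x) \<le> ?x" by (intro occ.mv_mono s) auto
    then show "- ?N e \<le> ?x" unfolding mv_cmult by simp
  qed
  have Lh: "0 \<le> ?N (?L h)" "?N (?L h) \<le> B"
    using h by (auto intro!: occ.mv_ge occ.mv_le Q.pv_ge Q.pv_le s d)
  have "?N (\<lambda>x. h x - ?K h x) = ?N (\<lambda>x. (h x - ?L h x) + e x)" by (simp add: e_def)
  also have "\<dots> = ?N e - (?N (?L h) - ?N h)" by (simp only: mv_add mv_diff)
  also have "\<dots> = ?N e - (1 - \<gamma>) * (?N (?L h) - h s)" by (simp only: flow)
  finally have drift: "?N (\<lambda>x. h x - ?K h x) = ?N e - (1 - \<gamma>) * (?N (?L h) - h s)" .
  have "\<bar>(1 - \<gamma>) * (?N (?L h) - h s)\<bar> \<le> (1 - \<gamma>) * B"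
    using Lh h[OF s] \<gamma> unfolding abs_mult by (intro mult_mono) auto
  then have drift_le: "\<bar>?N (\<lambda>x. h x - ?K h x)\<bar> \<le> (1 - \<gamma>) * B + ?x"
    using drift Ne by linarith
  have "?v = ?N (\<lambda>x. ?L ?h2 x - e2 x - (?K h x)\<^sup>2)"
    by (rule mv_cong) (simp add: V_def e2_def pvar_def)
  also have "\<dots> = ?N (?L ?h2) - ?N e2 - ?N (\<lambda>x. (?K h x)\<^sup>2)" by (simp only: mv_diff)
  finally have v_eq: "?v = (?N (?L ?h2) - ?N ?h2) - ?N e2 + ?N (\<lambda>x. (h x)\<^sup>2 - (?K h x)\<^sup>2)"
    by (simp add: mv_diff)
  have "?N (\<lambda>x. (- 1) * e2 x) \<le> ?N (\<lambda>x. (1 / 2) * V x + b2)"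
  proof (rule occ.mv_mono[OF s])
    fix x assume "x < S"
    then show "(- 1) * e2 x \<le> (1 / 2) * V x + b2" using dev2[of x] by (simp add: e2_def V_def)
  qed
  then have e2_le: "- ?N e2 \<le> ?v / 2 + b2"
    unfolding mv_cmult mv_add occ.mv_const[OF s] by simp
  have "?N (?L ?h2) \<le> B\<^sup>2"
    using h by (intro occ.mv_le Q.pv_le power_mono s d) auto
  then have "(1 - \<gamma>) * (?N (?L ?h2) - ?h2 s) \<le> (1 - \<gamma>) * B\<^sup>2"
    using \<gamma> zero_le_power2[of "h s"] by (intro mult_left_mono) linarith+
  also have "\<dots> = ((1 - \<gamma>) * B) * B" by (simp add: power2_eq_square)
  also have "\<dots> \<le> 1 * B" using B by (intro mult_right_mono \<gamma>B)
  finally have L2_le: "?N (?L ?h2) - ?N ?h2 \<le> B" unfolding flow by simp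
  \<comment> \<open>Adding 1 makes the drift factor nonnegative by \<open>step\<close>, so the other
    factor can be replaced by its maximum 2B; the signed drift that remains is controlled by
    \<open>drift_le\<close>.\<close>
  have "?N (\<lambda>x. (h x)\<^sup>2 - (?K h x)\<^sup>2) \<le> ?N (\<lambda>x. 2 * B * (1 + (h x - ?K h x)))"
  proof (rule occ.mv_mono[OF s])
    fix x assume x: "x < S"
    have K: "0 \<le> ?K h x" "?K h x \<le> B" using h by (auto intro!: P.pv_ge P.pv_le x d)
    have c: "0 \<le> h x + ?K h x" "h x + ?K h x \<le> 2 * B" using h[OF x] K by linarith+
    have "(h x)\<^sup>2 - (?K h x)\<^sup>2 = (h x + ?K h x) * (h x - ?K h x)"
      by (simp add: power2_eq_square algebra_simps)
    also have "\<dots> \<le> (h x + ?K h x) * (1 + (h x - ?K h x))" using c by (intro mult_left_mono) auto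
    also have "\<dots> \<le> 2 * B * (1 + (h x - ?K h x))" using c step[OF x] by (intro mult_right_mono) auto
    finally show "(h x)\<^sup>2 - (?K h x)\<^sup>2 \<le> 2 * B * (1 + (h x - ?K h x))" .
  qed
  also have "\<dots> = 2 * B * (1 + ?N (\<lambda>x. h x - ?K h x))"
    unfolding mv_cmult by (simp only: mv_add occ.mv_const[OF s])
  also have "\<dots> \<le> 2 * B * (1 + (1 + ?x))"
    using B drift_le \<gamma>B by (intro mult_left_mono) auto
  finally have "?v \<le> B + (?v / 2 + b2) + 2 * B * (1 + (1 + ?x))" using v_eq e2_le L2_le by linarith
  then have v_le: "?v \<le> 11 * B + 4 * (B * ?x)"
    using l(5) B by (simp add: algebra_simps)
  have "?x \<le> ?N (\<lambda>x. l * V x + b)"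
    using dev by (intro occ.mv_mono s) (simp add: e_def V_def)
  also have "\<dots> = l * ?v + b" by (simp only: mv_add mv_cmult occ.mv_const[OF s])
  also have "\<dots> \<le> l * (11 * B + 4 * (B * ?x)) + b" using v_le l(1) by (intro add_right_mono mult_left_mono) auto
  also have "\<dots> = 11 * (l * B) + 4 * ((l * B) * ?x) + b" by (simp add: algebra_simps)
  \<comment> \<open>As l B <= q <= 1/8, the term 4 (l B) \<open>?x\<close> is at most
    \<open>?x\<close> / 2, which turns 12 q into 24 q.\<close>
  also have "\<dots> \<le> 11 * q + 4 * ((1 / 8) * ?x) + q"
  proof -
    have "(l * B) * ?x \<le> (1 / 8) * ?x" using l x0 by (intro mult_right_mono) auto
    then show ?thesis using l by linarith
  qed
  finally have "?x \<le> 24 * q" by simp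
  then show ?thesis using drift_le by linarith
qed

section \<open>Plug-in bounds for a fixed discount factor\<close>

lemma Min_le_value: "x < S \<Longrightarrow> Min (v ` {..<S}) \<le> v x"
  and value_le_Min_sp: "x < S \<Longrightarrow> v x \<le> Min (v ` {..<S}) + sp_norm S v"
  by (auto simp: sp_norm_def)

lemma Min_ge: "S \<ge> 1 \<Longrightarrow> (\<And>x. x < S \<Longrightarrow> c \<le> v x) \<Longrightarrow> c \<le> Min (v ` {..<S})" for v :: "nat \<Rightarrow> real"
  by (subst Min_ge_iff) (auto simp: lessThan_empty_iff)

lemma sp_norm_le:
  assumes "S \<ge> 1" "\<And>x. x < S \<Longrightarrow> c \<le> v x" "\<And>x. x < S \<Longrightarrow> v x \<le> c + w"
  shows "sp_norm S v \<le> w"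
proof -
  have "Max (v ` {..<S}) \<le> c + w" using assms(1,3) by (subst Max_le_iff) (auto simp: lessThan_empty_iff)
  moreover have "c \<le> Min (v ` {..<S})" by (rule Min_ge[OF assms(1,2)])
  ultimately show ?thesis by (simp add: sp_norm_def)
qed

lemma sp_norm_nonneg: "0 \<le> sp_norm S v" if "S \<ge> 1"
proof -
  have "0 < S" using that by simp
  from Min_le_value[OF this, of v] value_le_Min_sp[OF this, of v] show ?thesis by linarith
qed

lemma sp_norm_perturb:
  assumes "S \<ge> 1" "\<And>x. x < S \<Longrightarrow> \<bar>u x - v x\<bar> \<le> e"
  shows "sp_norm S u \<le> sp_norm S v + 2 * e"
proof (rule sp_norm_le[OF assms(1), where c = "Min (v ` {..<S}) - e"])
  fix x assume x: "x < S"
  show "Min (v ` {..<S}) - e \<le> u x" "u x \<le> (Min (v ` {..<S}) - e) + (sp_norm S v + 2 * e)"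
    using assms(2)[OF x] Min_le_value[OF x, of v] value_le_Min_sp[OF x, of v] by linarith+
qed

lemma (in finite_mdp) gain_det_nonneg:
  assumes "\<And>x. x < S \<Longrightarrow> d x < A" "\<And>x a. x < S \<Longrightarrow> a < A \<Longrightarrow> 0 \<le> r x a" "s < S"
  shows "0 \<le> gain P r (det_pol d) s"
  using gain_ge[where \<gamma> = 1 and m = 0 and V = "\<lambda>_. 0" and e = "\<lambda>_. 0" and \<epsilon> = 0, OF assms(1,3)] assms
  by (simp add: pv_const mv_def)

text \<open>The optimal value \<open>V\<close> of the empirical model depends on all samples. At a state \<open>x\<close> it is replaced
  by the value pinned at \<open>x\<close> to a point of the grid \<open>\<nat> / n\<close>, which does not depend on the samples drawn at
  \<open>x\<close>; this costs \<open>1 / n\<close> in the supremum norm.\<close>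

lemma plugin_gain_lower_bound:
  fixes S A :: nat and P Q :: "nat \<Rightarrow> nat \<Rightarrow> nat pmf" and r :: "nat \<Rightarrow> nat \<Rightarrow> real" and \<gamma> :: real
    and d :: "nat \<Rightarrow> nat" and L :: real
  defines "V \<equiv> opt_disc_value S A Q r \<gamma>"
  assumes mdp: "finite_mdp S A P" "discounted_mdp S A Q r \<gamma>"
    and S: "S \<ge> 1" and n: "n \<ge> 1" and L: "L \<ge> 1" and hor: "1 / (1 - \<gamma>) \<le> real n"
    and d: "\<And>x. x < S \<Longrightarrow> d x < A"
    and near: "\<And>x. x < S \<Longrightarrow> V x - 1 / real n \<le> disc_value Q r (det_pol d) \<gamma> x"
    and conc: "\<And>x a j W \<rho>. x < S \<Longrightarrow> a < A \<Longrightarrow> j \<le> n\<^sup>2 \<Longrightarrow> W = pinned_val S A Q r \<gamma> x (real j / real n)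
      \<Longrightarrow> \<rho> = sqrt (L * (sp_norm S W + 1) / real n) \<Longrightarrow> \<rho> \<le> 1
      \<Longrightarrow> \<bar>pv S Q x a W - pv S P x a W\<bar> \<le> \<rho> / (sp_norm S W + 1) * pvar S P x a W + \<rho>"
    and s: "s < S"
  shows "(1 - \<gamma>) * Min (V ` {..<S}) - 49 * sqrt (L * (sp_norm S V + 1) / real n) \<le> gain P r (det_pol d) s"
proof -
  interpret P: finite_mdp S A P by fact
  interpret Q: discounted_mdp S A Q r \<gamma> by fact
  have V: "V = Q.opt" by (simp add: V_def Q.opt_def)
  have V_bounds: "0 \<le> V x" "V x \<le> 1 / (1 - \<gamma>)" if "x < S" for x
    using Q.opt_bellman(2,3)[OF that] by (simp_all add: V)
  have V_le: "(1 - \<gamma>) * V x \<le> 1" if "x < S" for x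
    using V_bounds[OF that] Q.\<gamma>_bounds by (simp add: field_simps)
  define \<sigma> where "\<sigma> = sp_norm S V"
  define m where "m = Min (V ` {..<S})"
  define q where "q = sqrt (L * (\<sigma> + 1) / real n)"
  have \<sigma>: "0 \<le> \<sigma>" unfolding \<sigma>_def by (rule sp_norm_nonneg[OF S])
  have n0: "real n \<ge> 1" using n by simp
  have q0: "0 \<le> q" unfolding q_def using L \<sigma> by simp
  have q2: "q\<^sup>2 = L * (\<sigma> + 1) / real n" unfolding q_def using L \<sigma> by simp
  have qn: "1 / real n \<le> q"
    unfolding q_def
  proof (rule real_le_rsqrt)
    have "(1 / real n)\<^sup>2 \<le> 1 / real n" using n0 by (simp add: power2_eq_square field_simps)
    also have "1 \<le> L * (\<sigma> + 1)" using mult_mono[of 1 L 1 "\<sigma> + 1"] L \<sigma> by simp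
    then have "1 / real n \<le> L * (\<sigma> + 1) / real n" by (rule divide_right_mono) simp
    finally show "(1 / real n)\<^sup>2 \<le> L * (\<sigma> + 1) / real n" .
  qed
  have gain0: "0 \<le> gain P r (det_pol d) s" by (rule P.gain_det_nonneg[OF d Q.r_bounds(1) s])
  have m1: "(1 - \<gamma>) * m \<le> 1"
  proof -
    have "m \<le> V s" unfolding m_def by (rule Min_le_value[OF s])
    then have "(1 - \<gamma>) * m \<le> (1 - \<gamma>) * V s" using Q.\<gamma>_bounds by (intro mult_left_mono) auto
    then show ?thesis using V_le[OF s] by linarith
  qed
  have "(1 - \<gamma>) * m - 49 * q \<le> gain P r (det_pol d) s"
  \<comment> \<open>For larger q the loss 49 q exceeds 1, while (1 - \<gamma>) m <= 1 and the gain
    is nonnegative. The threshold is the absorption condition 4 l \<sigma> <= 16 q <= 1.\<close>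
  proof (cases "q \<le> 1 / 16")
    case False
    then show ?thesis using gain0 m1 by linarith
  next
    case True
    define e where "e x = pv S Q x (d x) V - pv S P x (d x) V" for x
    \<comment> \<open>One factor 2 covers the passage from the rate for W to that for V, the other
      the passage from the variance of W to that of V.\<close>
    define l where "l = 4 * (q / (\<sigma> + 1))"
    have l0: "0 \<le> l" using q0 \<sigma> by (simp add: l_def)
    have l\<sigma>: "l * \<sigma> \<le> 4 * q"
    proof -
      have "q * (\<sigma> / (\<sigma> + 1)) \<le> q * 1" using q0 \<sigma> by (intro mult_left_mono) (auto simp: field_simps)
      then show ?thesis by (simp add: l_def)
    qed
    have e_le: "\<bar>e x\<bar> \<le> l * pvar S P x (d x) V + 8 * q" if x: "x < S" for x
    proof -
      \<comment> \<open>Rounding down to the grid; V x <= 1 / (1 - \<gamma>) <= n keeps the index at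
        most n^2, within the events covered by \<open>conc\<close>.\<close>
      define j where "j = nat \<lfloor>V x * real n\<rfloor>"
      define c where "c = real j / real n"
      define W where "W = pinned_val S A Q r \<gamma> x c"
      define w where "w = sp_norm S W + 1"
      define \<rho> where "\<rho> = sqrt (L * w / real n)"
      let ?a = "d x"
      have a: "?a < A" by (rule d[OF x])
      have Vn: "0 \<le> V x * real n" using V_bounds[OF x] by simp
      then have j: "real j \<le> V x * real n" "V x * real n \<le> real j + 1"
        unfolding j_def by linarith+
      have "real j \<le> real n * real n"
        using j(1) V_bounds(2)[OF x] hor mult_right_mono[of "V x" "real n" "real n"] by simp
      then have jn: "j \<le> n\<^sup>2" by (simp add: power2_eq_square flip: of_nat_mult)
      have Vc: "\<bar>V x - c\<bar> \<le> 1 / real n"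
      proof -
        have "c \<le> V x" using j(1) n0 by (simp add: c_def pos_divide_le_eq)
        moreover have "V x \<le> (real j + 1) / real n" using j(2) n0 by (simp add: pos_le_divide_eq)
        ultimately show ?thesis by (simp add: c_def add_divide_distrib)
      qed
      have VW: "\<bar>V y - W y\<bar> \<le> 1 / real n" if "y < S" for y
        unfolding V W_def
        by (rule Q.pinned_val_opt_dist) (use Vc that in \<open>auto simp: V c_def\<close>)
      have WV: "\<bar>W y - V y\<bar> \<le> 1 / real n" if "y < S" for y using VW[OF that] by (simp add: abs_minus_commute)
      have n1: "1 / real n \<le> 1" using n0 by simp
      have w1: "1 \<le> w" using sp_norm_nonneg[OF S, of W] by (simp add: w_def)
      have sp_WV: "sp_norm S W \<le> sp_norm S V + 2 * 1"
        by (rule sp_norm_perturb[OF S]) (rule order_trans[OF WV n1])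
      have sp_VW: "sp_norm S V \<le> sp_norm S W + 2 * 1"
        by (rule sp_norm_perturb[OF S]) (rule order_trans[OF VW n1])
      \<comment> \<open>The spans of V and W differ by at most 2, so w and \<sigma> + 1 agree up to
        the factor 3, and the data-dependent rates are comparable.\<close>
      have w_le: "w \<le> 3 * (\<sigma> + 1)"
        using sp_WV \<sigma> unfolding w_def \<sigma>_def by simp
      have \<sigma>_le: "\<sigma> + 1 \<le> 3 * w"
        using sp_VW w1 unfolding w_def \<sigma>_def by simp
      have \<sigma>1: "\<sigma> + 1 \<noteq> 0" using \<sigma> by simp
      have \<rho>2: "\<rho>\<^sup>2 = L * w / real n" using L w1 by (simp add: \<rho>_def)
      have \<rho>q: "\<rho> \<le> 2 * q"
      proof (rule power2_le_imp_le)
        have "L * w \<le> L * (4 * (\<sigma> + 1))" using w_le \<sigma> L by (intro mult_left_mono) auto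
        then have "L * w / real n \<le> L * (4 * (\<sigma> + 1)) / real n" by (rule divide_right_mono) simp
        moreover have "(2 * q)\<^sup>2 = L * (4 * (\<sigma> + 1)) / real n"
          unfolding power_mult_distrib q2 by simp
        ultimately show "\<rho>\<^sup>2 \<le> (2 * q)\<^sup>2" by (simp only: \<rho>2)
      qed (use q0 in simp)
      have \<rho>w: "\<rho> / w \<le> 2 * (q / (\<sigma> + 1))"
      proof (rule power2_le_imp_le)
        have "(\<rho> / w)\<^sup>2 = L / (real n * w)"
          unfolding power_divide \<rho>2 using w1 by (simp add: power2_eq_square)
        also have "\<dots> \<le> L / (real n * ((\<sigma> + 1) / 4))"
          using \<sigma>_le w1 L n0 \<sigma> by (intro divide_left_mono mult_left_mono) auto
        also have "\<dots> = (2 * (q / (\<sigma> + 1)))\<^sup>2"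
          unfolding power_mult_distrib power_divide q2 using \<sigma>1 by (simp add: power2_eq_square)
        finally show "(\<rho> / w)\<^sup>2 \<le> (2 * (q / (\<sigma> + 1)))\<^sup>2" .
      qed (use q0 \<sigma> in simp)
      have "\<bar>pv S Q x ?a W - pv S P x ?a W\<bar> \<le> \<rho> / w * pvar S P x ?a W + \<rho>"
        unfolding w_def
      proof (rule conc[OF x a jn])
        show "W = pinned_val S A Q r \<gamma> x (real j / real n)" by (simp add: W_def c_def)
        show "\<rho> = sqrt (L * (sp_norm S W + 1) / real n)" by (simp add: \<rho>_def w_def)
        show "\<rho> \<le> 1" using \<rho>q True by linarith
      qed
      also have "\<dots> \<le> 2 * (q / (\<sigma> + 1)) * (2 * pvar S P x ?a V + 2 * (1 / real n)\<^sup>2) + 2 * q"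
      proof (intro add_mono mult_mono \<rho>w \<rho>q)
        show "pvar S P x ?a W \<le> 2 * pvar S P x ?a V + 2 * (1 / real n)\<^sup>2"
          by (rule P.pvar_perturb[OF x a WV])
      qed (use q0 \<sigma> P.pvar_nonneg[OF x a, of W] in auto)
      also have "\<dots> = l * pvar S P x ?a V + 4 * ((q / (\<sigma> + 1)) * (1 / real n)\<^sup>2) + 2 * q"
        by (simp add: l_def algebra_simps)
      also have "(q / (\<sigma> + 1)) * (1 / real n)\<^sup>2 \<le> q * 1"
      proof (rule mult_mono)
        show "q / (\<sigma> + 1) \<le> q" using q0 \<sigma> by (simp add: divide_le_eq mult_le_cancel_left1)
        show "(1 / real n)\<^sup>2 \<le> 1" using n1 by (intro power_le_one) auto
      qed (use q0 in auto)
      finally have "\<bar>pv S Q x ?a W - pv S P x ?a W\<bar> \<le> l * pvar S P x ?a V + 6 * q" by simp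
      moreover have "\<bar>pv S Q x ?a (\<lambda>y. V y - W y)\<bar> \<le> 1 / real n"
        by (rule Q.pv_abs_le[OF x a VW])
      moreover have "\<bar>pv S P x ?a (\<lambda>y. V y - W y)\<bar> \<le> 1 / real n"
        by (rule P.pv_abs_le[OF x a VW])
      ultimately show ?thesis using qn unfolding e_def pv_diff by linarith
    qed
    have lower: "r x (d x) + \<gamma> * pv S Q x (d x) V \<le> V x" if "x < S" for x
      using Q.opt_ge[OF that d[OF that]] by (simp add: V)
    have upper: "V x \<le> r x (d x) + \<gamma> * pv S Q x (d x) V + 1 / real n" if x: "x < S" for x
    proof -
      let ?D = "disc_value Q r (det_pol d) \<gamma>"
      have pol: "valid_policy S A (det_pol d)" using d by (simp add: valid_det_pol)
      have "?D x = r x (d x) + \<gamma> * pv S Q x (d x) ?D" by (rule Q.disc_value_det_pol[OF d x])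
      also have "\<dots> \<le> r x (d x) + \<gamma> * pv S Q x (d x) V"
        using Q.\<gamma>_bounds Q.disc_value_le_opt[OF pol]
        by (intro add_left_mono mult_left_mono pv_mono) (auto simp: V)
      finally show ?thesis using near[OF x] by linarith
    qed
    \<comment> \<open>The empirical one-step drop of V lies in [0, 2] and (1 - \<gamma>) P V in
      [0, 1]; replacing Q by P adds the error e.\<close>
    have step: "\<bar>V x - pv S P x (d x) V\<bar> \<le> 2 + \<bar>e x\<bar>" if x: "x < S" for x
    proof -
      let ?D = "V x - \<gamma> * pv S Q x (d x) V"
      have D: "0 \<le> ?D" "?D \<le> 2"
        using lower[OF x] upper[OF x] Q.r_bounds[OF x d[OF x]] qn True by linarith+
      have pvP: "0 \<le> pv S P x (d x) V" "pv S P x (d x) V \<le> 1 / (1 - \<gamma>)"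
        using V_bounds by (auto intro!: P.pv_ge P.pv_le x d)
      have "(1 - \<gamma>) * pv S P x (d x) V \<le> 1" using pvP Q.\<gamma>_bounds by (simp add: field_simps)
      moreover have "0 \<le> (1 - \<gamma>) * pv S P x (d x) V"
        using pvP Q.\<gamma>_bounds by (intro mult_nonneg_nonneg) auto
      moreover have "\<bar>\<gamma> * e x\<bar> \<le> \<bar>e x\<bar>"
        using Q.\<gamma>_bounds mult_right_mono[of \<gamma> 1 "\<bar>e x\<bar>"] by (simp add: abs_mult)
      moreover have "V x - pv S P x (d x) V = ?D + \<gamma> * e x - (1 - \<gamma>) * pv S P x (d x) V"
        by (simp add: e_def algebra_simps)
      ultimately show ?thesis using D by linarith
    qed
    have "mv S (mlim S (polM P (det_pol d))) (\<lambda>x. \<bar>e x\<bar>) s \<le> 8 * l * \<sigma> + 2 * (8 * q)"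
    proof (rule P.stationary_error_le[OF d s, where m = m and V = V])
      show "m \<le> V x" "V x \<le> m + \<sigma>" if "x < S" for x
        using Min_le_value[OF that, of V] value_le_Min_sp[OF that, of V] by (simp_all add: m_def \<sigma>_def)
    qed (use step e_le l0 l\<sigma> True in \<open>auto simp: mult.assoc\<close>)
    moreover have "(1 - \<gamma>) * m - mv S (mlim S (polM P (det_pol d))) (\<lambda>x. \<bar>e x\<bar>) s - 1 / real n
        \<le> gain P r (det_pol d) s"
    proof (rule P.gain_ge[OF d s])
      show "m \<le> V x" if "x < S" for x using Min_le_value[OF that, of V] by (simp add: m_def)
      show "V x - \<gamma> * (pv S P x (d x) V + e x) - 1 / real n \<le> r x (d x)" if "x < S" for x
        using upper[OF that] by (simp add: e_def)
    qed (use Q.\<gamma>_bounds in auto)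
    \<comment> \<open>49 = 32 + 16 + 1: the three losses are 8 l \<sigma> <= 32 q, 2 * (8 q), and
      the solver's 1 / n <= q.\<close>
    ultimately show ?thesis using l\<sigma> qn by linarith
  qed
  then show ?thesis by (simp add: m_def q_def \<sigma>_def)
qed

text \<open>Two policies are integrated in the empirical model Q: its own optimal policy, for which
  the optimality equation of P is an inequality, bounds the value above; the policy greedy for h
  under P, for which it is an equality, bounds it below. The rate q / B is tuned so that rate times
  B equals q.\<close>

lemma plugin_value_bounds:
  fixes P Q :: "nat \<Rightarrow> nat \<Rightarrow> nat pmf" and h :: "nat \<Rightarrow> real"
  assumes mdp: "finite_mdp S A P" "discounted_mdp S A Q r \<gamma>"
    and h: "\<And>x. x < S \<Longrightarrow> 0 \<le> h x" "\<And>x. x < S \<Longrightarrow> h x \<le> B" and B: "B > 0"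
    and opt: "\<And>x a. x < S \<Longrightarrow> a < A \<Longrightarrow> r x a + pv S P x a h \<le> \<rho> + h x"
      "\<And>x. x < S \<Longrightarrow> \<exists>a<A. r x a + pv S P x a h = \<rho> + h x" and \<rho>: "\<rho> \<le> 1"
    and dev: "\<And>x a. x < S \<Longrightarrow> a < A \<Longrightarrow> \<bar>pv S Q x a h - pv S P x a h\<bar> \<le> q / B * pvar S P x a h + q"
    and dev2: "\<And>x a. x < S \<Longrightarrow> a < A \<Longrightarrow>
      \<bar>pv S Q x a (\<lambda>y. (h y)\<^sup>2) - pv S P x a (\<lambda>y. (h y)\<^sup>2)\<bar> \<le> pvar S P x a h / 2 + B / 8"
    and q: "0 \<le> q" "q \<le> 1 / 8" and \<gamma>B: "(1 - \<gamma>) * B \<le> 1" and s: "s < S"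
  shows "\<bar>(1 - \<gamma>) * opt_disc_value S A Q r \<gamma> s - \<rho>\<bar> \<le> (1 - \<gamma>) * B + 24 * q"
proof -
  interpret P: finite_mdp S A P by fact
  interpret Q: discounted_mdp S A Q r \<gamma> by fact
  have err: "\<bar>mv S (mocc S (polM Q (det_pol d)) \<gamma>) (\<lambda>x. h x - pv S P x (d x) h) s\<bar> \<le> (1 - \<gamma>) * B + 24 * q"
    if d: "\<And>x. x < S \<Longrightarrow> d x < A" for d
  proof (rule occupation_error_le[OF mdp(1) Q.finite_mdp_axioms d s Q.\<gamma>_bounds h])
    show "- 1 \<le> h x - pv S P x (d x) h" if "x < S" for x
      using opt(1)[OF that d[OF that]] Q.r_bounds(1)[OF that d[OF that]] \<rho> by linarith
    show "\<bar>pv S Q x (d x) h - pv S P x (d x) h\<bar> \<le> q / B * pvar S P x (d x) h + q" if "x < S" for x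
      by (rule dev[OF that d[OF that]])
    show "\<bar>pv S Q x (d x) (\<lambda>y. (h y)\<^sup>2) - pv S P x (d x) (\<lambda>y. (h y)\<^sup>2)\<bar>
        \<le> pvar S P x (d x) h / 2 + B / 8" if "x < S" for x
      by (rule dev2[OF that d[OF that]])
  qed (use B q \<gamma>B in auto)
  have occ_const: "mv S (mocc S (polM Q (det_pol d)) \<gamma>) (\<lambda>_. \<rho>) s = \<rho>"
    if d: "\<And>x. x < S \<Longrightarrow> d x < A" for d
    using d by (intro stochastic.mv_const stochastic.stochastic_mocc Q.stochastic_polM s Q.\<gamma>_bounds)
      (simp add: valid_det_pol)
  have upper: "(1 - \<gamma>) * Q.opt s - \<rho> \<le> (1 - \<gamma>) * B + 24 * q"
  proof -
    obtain d where d: "\<And>s. s < S \<Longrightarrow> d s < A" "\<And>s. s < S \<Longrightarrow> disc_value Q r (det_pol d) \<gamma> s = Q.opt s"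
      using Q.opt_greedy by metis
    have pol: "valid_policy S A (det_pol d)" using d by (simp add: valid_det_pol)
    interpret occ: stochastic S "mocc S (polM Q (det_pol d)) \<gamma>"
      by (intro stochastic.stochastic_mocc Q.stochastic_polM pol Q.\<gamma>_bounds)
    have "(1 - \<gamma>) * Q.opt s = mv S (mocc S (polM Q (det_pol d)) \<gamma>) (polr r (det_pol d)) s"
      using Q.disc_value_mocc[OF pol s Q.\<gamma>_bounds, of r] d(2)[OF s] by simp
    also have "\<dots> \<le> mv S (mocc S (polM Q (det_pol d)) \<gamma>) (\<lambda>x. \<rho> + (h x - pv S P x (d x) h)) s"
    proof (rule occ.mv_mono[OF s])
      fix x assume x: "x < S"
      show "polr r (det_pol d) x \<le> \<rho> + (h x - pv S P x (d x) h)"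
        using opt(1)[OF x d(1)[OF x]] by (simp add: polr_det_pol)
    qed
    also have "\<dots> = \<rho> + mv S (mocc S (polM Q (det_pol d)) \<gamma>) (\<lambda>x. h x - pv S P x (d x) h) s"
      unfolding mv_add[of S _ "\<lambda>_. \<rho>"] by (simp only: occ_const[of d, OF d(1)])
    finally show ?thesis using err[of d, OF d(1)] by (simp add: abs_le_iff)
  qed
  have lower: "\<rho> - (1 - \<gamma>) * Q.opt s \<le> (1 - \<gamma>) * B + 24 * q"
  proof -
    have "\<forall>x. \<exists>a. x < S \<longrightarrow> a < A \<and> r x a + pv S P x a h = \<rho> + h x" using opt(2) by blast
    then obtain d where d: "\<And>x. x < S \<Longrightarrow> d x < A" "\<And>x. x < S \<Longrightarrow> r x (d x) + pv S P x (d x) h = \<rho> + h x"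
      by metis
    have pol: "valid_policy S A (det_pol d)" using d by (simp add: valid_det_pol)
    have "\<rho> + mv S (mocc S (polM Q (det_pol d)) \<gamma>) (\<lambda>x. h x - pv S P x (d x) h) s
        = mv S (mocc S (polM Q (det_pol d)) \<gamma>) (\<lambda>x. \<rho> + (h x - pv S P x (d x) h)) s"
      unfolding mv_add[of S _ "\<lambda>_. \<rho>"] by (simp only: occ_const[of d, OF d(1)])
    also have "\<dots> = mv S (mocc S (polM Q (det_pol d)) \<gamma>) (polr r (det_pol d)) s"
    proof (rule mv_cong)
      fix x assume x: "x < S"
      show "\<rho> + (h x - pv S P x (d x) h) = polr r (det_pol d) x"
        using d(2)[OF x] by (simp add: polr_det_pol)
    qed
    also have "\<dots> = (1 - \<gamma>) * disc_value Q r (det_pol d) \<gamma> s"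
      by (simp add: Q.disc_value_mocc[OF pol s Q.\<gamma>_bounds])
    also have "\<dots> \<le> (1 - \<gamma>) * Q.opt s"
      using Q.\<gamma>_bounds by (intro mult_left_mono Q.disc_value_le_opt pol s) auto
    finally show ?thesis using err[of d, OF d(1)] by (simp add: abs_le_iff)
  qed
  show ?thesis using upper lower by (simp add: Q.opt_def abs_le_iff)
qed

section \<open>The grid of discount factors and the algorithm\<close>

lemma gamma_grid_bounds:
  assumes "\<gamma> \<in> gamma_grid n" "n \<ge> 1"
  shows "0 \<le> \<gamma>" "\<gamma> < 1" "1 / (1 - \<gamma>) \<le> real n"
proof -
  show "\<gamma> < 1" "1 / (1 - \<gamma>) \<le> real n" using assms by (auto simp: gamma_grid_def)
  have "1 \<le> sqrt (real n)" using assms(2) by simp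
  also have "\<dots> \<le> 1 / (1 - \<gamma>)" using assms(1) by (simp add: gamma_grid_def)
  finally show "0 \<le> \<gamma>" using \<open>\<gamma> < 1\<close> by (simp add: field_simps)
qed

text \<open>The horizon is at least 1, so its exponent k is nonnegative, and k < 2^k <= n. The
  resulting count n is crude but suffices for the union bound.\<close>

lemma gamma_grid_subset:
  assumes "n \<ge> 1"
  shows "gamma_grid n \<subseteq> (\<lambda>k. 1 - 1 / 2 ^ k) ` {..<n}"
proof
  fix \<gamma> assume \<gamma>: "\<gamma> \<in> gamma_grid n"
  then obtain k :: int where k: "1 / (1 - \<gamma>) = 2 powr real_of_int k" by (auto simp: gamma_grid_def)
  have "1 \<le> 2 powr real_of_int k"
    using gamma_grid_bounds[OF \<gamma> assms] by (simp add: k[symmetric] field_simps)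
  then have "0 \<le> k" using powr_less_mono[of "real_of_int k" 0 2] by (cases "k < 0") auto
  then have "2 powr real_of_int k = 2 powr real (nat k)" by simp
  then have k': "1 / (1 - \<gamma>) = 2 ^ nat k" using k by (simp add: powr_realpow)
  have "real (nat k) < 2 ^ nat k" by (rule of_nat_less_two_power)
  also have "\<dots> \<le> real n" using gamma_grid_bounds(3)[OF \<gamma> assms] by (simp add: k')
  finally have "nat k < n" by simp
  moreover have "\<gamma> = 1 - 1 / 2 ^ nat k"
    using gamma_grid_bounds(2)[OF \<gamma> assms] k'[symmetric] by simp
  ultimately show "\<gamma> \<in> (\<lambda>k. 1 - 1 / 2 ^ k) ` {..<n}" by blast
qed

lemma gamma_grid_finite_card:
  assumes "n \<ge> 1"
  shows "finite (gamma_grid n)" "card (gamma_grid n) \<le> n"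
proof -
  show "finite (gamma_grid n)" using gamma_grid_subset[OF assms] by (rule finite_subset) simp
  have "card (gamma_grid n) \<le> card ((\<lambda>k. 1 - 1 / 2 ^ k :: real) ` {..<n})"
    by (intro card_mono gamma_grid_subset assms) simp
  also have "\<dots> \<le> n" using card_image_le[of "{..<n}" "\<lambda>k. 1 - 1 / 2 ^ k :: real"] by simp
  finally show "card (gamma_grid n) \<le> n" .
qed

lemma gamma_grid_near:
  assumes n: "n \<ge> 4" and x: "sqrt (real n) \<le> x" "x \<le> real n"
  obtains \<gamma> where "\<gamma> \<in> gamma_grid n" "x / 2 \<le> 1 / (1 - \<gamma>)" "1 / (1 - \<gamma>) \<le> 2 * x"
proof -
  have mem: "1 - 1 / 2 ^ k \<in> gamma_grid n" if "sqrt (real n) \<le> 2 ^ k" "2 ^ k \<le> real n" for k :: nat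
    using that by (auto simp: gamma_grid_def intro!: exI[of _ "int k"] simp: powr_realpow)
  have "1 \<le> sqrt (real n)" using n by simp
  then have x1: "1 \<le> x" using x by linarith
  define k where "k = nat \<lfloor>log 2 x\<rfloor>"
  have "0 \<le> log 2 x" using x1 by simp
  then have k: "real k \<le> log 2 x" "log 2 x < real k + 1" unfolding k_def by linarith+
  have k1: "2 ^ k \<le> x"
    using k(1) x1 by (simp add: le_log_iff powr_realpow)
  have k2: "x < 2 * 2 ^ k"
    using k(2) x1 by (simp add: log_less_iff powr_add powr_realpow)
  show thesis
  \<comment> \<open>Rounding x up to a power of two keeps the horizon above sqrt n but may exceed n.
    If it does, the power below x is more than n / 2, which is at least sqrt n because n >=
    4.\<close>
  proof (cases "2 * 2 ^ k \<le> real n")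
    case True
    then show ?thesis using mem[of "Suc k"] k1 k2 x by (intro that[of "1 - 1 / 2 ^ Suc k"]) auto
  next
    case False
    have "sqrt (real n) \<le> real n / 2"
    proof (rule real_le_lsqrt)
      have "real n * 4 \<le> real n * real n" using n by (intro mult_left_mono) auto
      then show "real n \<le> (real n / 2)\<^sup>2" by (simp add: power2_eq_square)
    qed auto
    then have "sqrt (real n) \<le> 2 ^ k" using False by linarith
    moreover have "2 ^ k \<le> real n" using k1 x(2) by linarith
    ultimately have "1 - 1 / 2 ^ k \<in> gamma_grid n" by (rule mem)
    then show ?thesis by (rule that) (use k1 k2 in auto)
  qed
qed

section \<open>The empirical lower bound \<open>L_hat\<close> under solver errors\<close>

lemma alpha_ge:
  assumes "0 \<le> ln (24 * real S * real A * real n ^ 5 / \<delta>)"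
  shows "96 * sqrt (ln (24 * real S * real A * real n ^ 5 / \<delta>)) \<le> alpha S A \<delta> n"
proof -
  \<comment> \<open>The shift by 4 inside \<open>alpha\<close> makes the iterated logarithm at least
    1 for every n.\<close>
  have "2 = log 2 ((2::real) ^ 2)" by (subst log_pow_cancel) auto
  also have "\<dots> \<le> log 2 (real n + 4)" by simp
  finally have "log 2 2 \<le> log 2 (log 2 (real n + 4))" by (subst log_le_cancel_iff) auto
  then have "1 \<le> log 2 (log 2 (real n + 4))" by simp
  then have "96 * sqrt (ln (24 * real S * real A * real n ^ 5 / \<delta>)) * 1 \<le> alpha S A \<delta> n"
    unfolding alpha_def using assms by (intro mult_left_mono) auto
  then show ?thesis by simp
qed

text \<open>The corrections in \<open>L_hat\<close> pay for the solver: an error 1/n in the values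
  moves the minimum by at most 1/n and the span by at most 2/n. The weight 96 dominates the plug-in
  constant 49.\<close>

lemma Lhat_le_gain:
  fixes V U :: "nat \<Rightarrow> real"
  assumes S: "S \<ge> 1" and n: "n \<ge> 1" and L: "L \<ge> 1" and \<alpha>: "96 * sqrt L \<le> \<alpha>" and \<gamma>: "\<gamma> \<le> 1"
    and U: "\<And>x. x < S \<Longrightarrow> \<bar>U x - V x\<bar> \<le> 1 / real n"
    and g: "(1 - \<gamma>) * Min (V ` {..<S}) - 49 * sqrt (L * (sp_norm S V + 1) / real n) \<le> g"
  shows "(1 - \<gamma>) * Min (U ` {..<S}) - 2 * (1 - \<gamma>) / real n
    - \<alpha> * sqrt ((sp_norm S U + 3 / real n + 1) / real n) \<le> g"
proof -
  have n0: "0 < real n" using n by simp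
  have "Min (U ` {..<S}) - 1 / real n \<le> Min (V ` {..<S})"
  proof (rule Min_ge[OF S])
    fix x assume "x < S"
    then show "Min (U ` {..<S}) - 1 / real n \<le> V x" using U[of x] Min_le_value[of x S U] by linarith
  qed
  then have "(1 - \<gamma>) * (Min (U ` {..<S}) - 1 / real n) \<le> (1 - \<gamma>) * Min (V ` {..<S})"
    using \<gamma> by (intro mult_left_mono) auto
  then have m: "(1 - \<gamma>) * Min (U ` {..<S}) - (1 - \<gamma>) / real n \<le> (1 - \<gamma>) * Min (V ` {..<S})"
    by (simp add: right_diff_distrib)
  have "sp_norm S V \<le> sp_norm S U + 2 * (1 / real n)"
    by (rule sp_norm_perturb[OF S]) (subst abs_minus_commute, rule U)
  then have "sp_norm S V + 1 \<le> sp_norm S U + 3 / real n + 1"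
    using n0 by (simp add: field_simps)
  then have "sqrt ((sp_norm S V + 1) / real n) \<le> sqrt ((sp_norm S U + 3 / real n + 1) / real n)"
    using n0 by (intro real_sqrt_le_mono divide_right_mono) auto
  then have "49 * sqrt L * sqrt ((sp_norm S V + 1) / real n)
      \<le> \<alpha> * sqrt ((sp_norm S U + 3 / real n + 1) / real n)"
    using \<alpha> L sp_norm_nonneg[OF S, of V] n0 real_sqrt_ge_zero[of L]
    by (intro mult_mono) (auto intro: order_trans[OF _ \<alpha>])
  moreover have "sqrt (L * (sp_norm S V + 1) / real n) = sqrt L * sqrt ((sp_norm S V + 1) / real n)"
    by (simp add: real_sqrt_mult[symmetric])
  moreover have "0 \<le> (1 - \<gamma>) / real n" using \<gamma> by simp
  moreover have "2 * (1 - \<gamma>) / real n = 2 * ((1 - \<gamma>) / real n)" by simp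
  ultimately show ?thesis using m g unfolding mult.assoc by linarith
qed

text \<open>With t = sqrt (B / n), a horizon of order sqrt (n B) makes the discounting error (1 -
  \<gamma>) B of order t and the span of V of order sqrt L * B, so the bonus is at most \<alpha> *
  (\<alpha> t).\<close>

lemma Lhat_ge_opt_gain:
  fixes V U :: "nat \<Rightarrow> real"
  assumes S: "S \<ge> 1" and n: "n \<ge> 1" and L: "L \<ge> 1" and \<alpha>: "96 * sqrt L \<le> \<alpha>" and \<gamma>: "0 \<le> \<gamma>" "\<gamma> < 1"
    and B: "1 \<le> B" and hor: "sqrt (real n * B) / 2 \<le> 1 / (1 - \<gamma>)" "1 / (1 - \<gamma>) \<le> 2 * sqrt (real n * B)"
    and U: "\<And>x. x < S \<Longrightarrow> \<bar>U x - V x\<bar> \<le> 1 / real n"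
    and V: "\<And>x. x < S \<Longrightarrow> \<bar>(1 - \<gamma>) * V x - \<rho>\<bar> \<le> (1 - \<gamma>) * B + 24 * sqrt (L * B / real n)"
  shows "\<rho> - 4 * \<alpha>\<^sup>2 * sqrt (B / real n) \<le> (1 - \<gamma>) * Min (U ` {..<S}) - 2 * (1 - \<gamma>) / real n
    - \<alpha> * sqrt ((sp_norm S U + 3 / real n + 1) / real n)"
proof -
  define t where "t = sqrt (B / real n)"
  define x where "x = sqrt (real n * B)"
  define l where "l = sqrt L"
  define q where "q = sqrt (L * B / real n)"
  have n0: "1 \<le> real n" using n by simp
  have l: "1 \<le> l" using L by (simp add: l_def)
  have \<alpha>0: "0 \<le> \<alpha>" using L by (intro order_trans[OF _ \<alpha>]) simp
  have t0: "0 \<le> t" using B by (simp add: t_def)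
  \<comment> \<open>Links the horizon scale x to the error scale t: multiplying by t turns bounds on
    g x into bounds on g B, and dividing t by g gives at most 2 B.\<close>
  have xt: "x * t = B"
  proof -
    have "x * t = sqrt (real n * B * (B / real n))" unfolding x_def t_def by (simp only: real_sqrt_mult)
    also have "real n * B * (B / real n) = B\<^sup>2" using n0 by (simp add: power2_eq_square)
    finally show ?thesis using B by simp
  qed
  have q: "q = l * t" by (simp add: q_def l_def t_def real_sqrt_mult[symmetric])
  have nt: "1 / real n \<le> t"
    unfolding t_def
  proof (rule real_le_rsqrt)
    have "(1 / real n)\<^sup>2 \<le> 1 / real n" using n0 by (simp add: power2_eq_square field_simps)
    also have "\<dots> \<le> B / real n" using B by (intro divide_right_mono) auto
    finally show "(1 / real n)\<^sup>2 \<le> B / real n" .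
  qed
  define g where "g = 1 - \<gamma>"
  have g: "0 < g" "g \<le> 1" using \<gamma> by (auto simp: g_def)
  have gx: "g * x \<le> 2" "1 / g \<le> 2 * x"
  proof -
    have "x / 2 \<le> 1 / g" "1 / g \<le> 2 * x" using hor by (simp_all add: x_def g_def)
    then show "g * x \<le> 2" "1 / g \<le> 2 * x" using g by (simp_all add: field_simps)
  qed
  have gB: "g * B \<le> 2 * t"
  proof -
    have "(g * x) * t \<le> 2 * t" using gx(1) t0 by (rule mult_right_mono)
    then show ?thesis using xt by (simp add: mult.assoc)
  qed
  have lt: "0 \<le> l * t" using l t0 by simp
  define w where "w = B + 48 * (l * B)"
  have V_near: "\<bar>V y - \<rho> / g\<bar> \<le> w" if "y < S" for y
  proof -
    have "\<bar>V y - \<rho> / g\<bar> = \<bar>g * V y - \<rho>\<bar> * (1 / g)"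
      using g by (simp add: abs_mult[symmetric] field_simps abs_divide)
    also have "\<dots> \<le> (g * B + 24 * (l * t)) * (1 / g)"
      using V[OF that] g by (intro mult_right_mono) (auto simp: g_def q_def[symmetric] q)
    also have "\<dots> = B + 24 * (l * t) * (1 / g)" using g by (simp add: field_simps)
    also have "\<dots> \<le> B + 24 * (l * t) * (2 * x)"
      using gx(2) lt by (intro add_left_mono mult_left_mono) auto
    also have "\<dots> = B + 48 * (l * (x * t))" by simp
    finally show ?thesis by (simp add: w_def xt)
  qed
  have "sp_norm S V \<le> 2 * w"
  proof (rule sp_norm_le[OF S, where c = "\<rho> / g - w"])
    fix y assume "y < S"
    from V_near[OF this] show "\<rho> / g - w \<le> V y" "V y \<le> \<rho> / g - w + 2 * w" by linarith+
  qed
  moreover have "sp_norm S U \<le> sp_norm S V + 2 * (1 / real n)"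
    by (rule sp_norm_perturb[OF S U])
  moreover have n1: "1 / real n \<le> 1" using n0 by simp
  ultimately have "sp_norm S U + 3 / real n + 1 \<le> 2 * w + 6" by (simp add: field_simps)
  also have "\<dots> \<le> 104 * (l * B)"
  proof -
    have "1 * B \<le> l * B" using l B by (intro mult_right_mono) auto
    then have "2 * B + 96 * (l * B) + 6 \<le> 104 * (l * B)" using B by linarith
    then show ?thesis by (simp add: w_def distrib_left)
  qed
  also have "\<dots> \<le> \<alpha>\<^sup>2 * B"
  proof -
    have \<alpha>l: "96 * l \<le> \<alpha>" using \<alpha> by (simp add: l_def)
    have "(96 * l) * (96 * l) \<le> \<alpha> * \<alpha>" using \<alpha>l l by (intro mult_mono) auto
    moreover have "104 * l \<le> (96 * l) * (96 * l)" using l by simp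
    ultimately have "104 * l \<le> \<alpha>\<^sup>2" by (simp add: power2_eq_square)
    then have "104 * l * B \<le> \<alpha>\<^sup>2 * B" using B by (intro mult_right_mono) auto
    then show ?thesis by simp
  qed
  finally have "sqrt ((sp_norm S U + 3 / real n + 1) / real n) \<le> sqrt (\<alpha>\<^sup>2 * B / real n)"
    by (intro real_sqrt_le_mono divide_right_mono) auto
  also have "\<dots> = \<alpha> * t"
    using \<alpha>0 unfolding t_def times_divide_eq_right[symmetric] real_sqrt_mult by simp
  finally have "\<alpha> * sqrt ((sp_norm S U + 3 / real n + 1) / real n) \<le> \<alpha> * (\<alpha> * t)"
    using \<alpha>0 by (rule mult_left_mono)
  then have bonus: "\<alpha> * sqrt ((sp_norm S U + 3 / real n + 1) / real n) \<le> \<alpha>\<^sup>2 * t"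
    by (simp add: power2_eq_square mult.assoc)
  have "(\<rho> - g * B - 24 * (l * t)) / g - 1 / real n \<le> Min (U ` {..<S})"
  proof (rule Min_ge[OF S])
    fix y assume y: "y < S"
    have "\<rho> - g * B - 24 * (l * t) \<le> g * V y"
      using V[OF y] by (simp add: g_def q_def[symmetric] q)
    then have "(\<rho> - g * B - 24 * (l * t)) / g \<le> V y" using g by (simp add: divide_le_eq mult.commute)
    then show "(\<rho> - g * B - 24 * (l * t)) / g - 1 / real n \<le> U y" using U[OF y] by linarith
  qed
  then have "g * ((\<rho> - g * B - 24 * (l * t)) / g - 1 / real n) \<le> g * Min (U ` {..<S})"
    using g by (intro mult_left_mono) auto
  moreover have "g * (c / g - k) = c - g * k" for c k using g by (simp add: right_diff_distrib)
  ultimately have "\<rho> - g * B - 24 * (l * t) - g * (1 / real n) \<le> g * Min (U ` {..<S})"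
    by (simp only:)
  moreover have "g * (1 / real n) \<le> 1 * t" using g nt n0 by (intro mult_mono) auto
  \<comment> \<open>The losses other than the bonus: g B <= 2 t, the plug-in error 24 l t, and 3 t
    for the three terms g / n, one from the solver and two from \<open>L_hat\<close>. Together they
    fit into a second \<alpha>^2 t.\<close>
  moreover have "24 * (l * t) + 5 * t \<le> \<alpha>\<^sup>2 * t"
  proof -
    have \<alpha>l: "96 * l \<le> \<alpha>" using \<alpha> by (simp add: l_def)
    have "1 * \<alpha> \<le> \<alpha> * \<alpha>" using \<alpha>l l by (intro mult_right_mono) auto
    then have "24 * l + 5 \<le> \<alpha>\<^sup>2" using \<alpha>l l unfolding power2_eq_square by linarith
    then have "(24 * l + 5) * t \<le> \<alpha>\<^sup>2 * t" using t0 by (rule mult_right_mono)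
    then show ?thesis by (simp add: algebra_simps)
  qed
  ultimately have "\<rho> - 2 * (\<alpha>\<^sup>2 * t) \<le> g * Min (U ` {..<S}) - 2 * (g * (1 / real n)) - \<alpha> * sqrt ((sp_norm S U + 3 / real n + 1) / real n)"
    using gB bonus by linarith
  moreover have "0 \<le> \<alpha>\<^sup>2 * t" using t0 by simp
  ultimately have "\<rho> - 4 * (\<alpha>\<^sup>2 * t) \<le> g * Min (U ` {..<S}) - 2 * (g * (1 / real n)) - \<alpha> * sqrt ((sp_norm S U + 3 / real n + 1) / real n)"
    by linarith
  then show ?thesis by (simp add: g_def t_def mult.assoc)
qed

section \<open>Two-sided deviations with a data-dependent rate\<close>

lemma (in finite_mdp) emp_kernel_deviation:
  fixes F :: "(nat \<times> nat \<times> nat \<Rightarrow> nat) \<Rightarrow> nat \<Rightarrow> real"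
  assumes n: "n \<ge> 1" and sa: "s < S" "a < A"
    and indep: "\<And>\<omega> \<omega>'. (\<And>s' a' i. s' < S \<Longrightarrow> a' < A \<Longrightarrow> i < n \<Longrightarrow> (s', a') \<noteq> (s, a)
      \<Longrightarrow> \<omega> (s', a', i) = \<omega>' (s', a', i)) \<Longrightarrow> F \<omega> = F \<omega>' \<and> \<Lambda> \<omega> = \<Lambda> \<omega>'"
  shows "measure_pmf.prob (samples S A n P)
     {\<omega>. \<Lambda> \<omega> > 0 \<and> (\<forall>y<S. \<Lambda> \<omega> * \<bar>F \<omega> y - pv S P s a (F \<omega>)\<bar> \<le> 1) \<and>
       \<bar>pv S (emp_kernel n \<omega>) s a (F \<omega>) - pv S P s a (F \<omega>)\<bar>
         > \<Lambda> \<omega> * pvar S P s a (F \<omega>) + L / (\<Lambda> \<omega> * real n)} \<le> 2 * exp (- L)"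
    (is "measure_pmf.prob ?p ?X \<le> _")
proof -
  let ?Y = "\<lambda>F. {\<omega>. \<Lambda> \<omega> > 0 \<and> (\<forall>y<S. \<Lambda> \<omega> * (F \<omega> y - pv S P s a (F \<omega>)) \<le> 1) \<and>
       pv S (emp_kernel n \<omega>) s a (F \<omega>) - pv S P s a (F \<omega>)
         \<ge> \<Lambda> \<omega> * pvar S P s a (F \<omega>) + L / (\<Lambda> \<omega> * real n)}"
  \<comment> \<open>The lower tail is the upper tail of - F, which has the same variance.\<close>
  let ?G = "\<lambda>\<omega> y. (- 1) * F \<omega> y"
  have pvG: "pv S K s a (?G \<omega>) = - pv S K s a (F \<omega>)" for K \<omega>
    unfolding pv_cmult by simp
  have pvarG: "pvar S P s a (?G \<omega>) = pvar S P s a (F \<omega>)" for \<omega>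
    unfolding pvar_def pvG by simp
  have "?X \<subseteq> ?Y F \<union> ?Y ?G"
  proof
    fix \<omega> assume \<omega>: "\<omega> \<in> ?X"
    have abs_le: "u \<le> 1" "- u \<le> 1" if "\<bar>u\<bar> \<le> 1" for u :: real using that by auto
    have \<Lambda>: "\<Lambda> \<omega> > 0" using \<omega> by simp
    have range: "\<Lambda> \<omega> * (F \<omega> y - pv S P s a (F \<omega>)) \<le> 1" "\<Lambda> \<omega> * (- F \<omega> y + pv S P s a (F \<omega>)) \<le> 1"
      if y: "y < S" for y
    proof -
      have "\<bar>\<Lambda> \<omega> * (F \<omega> y - pv S P s a (F \<omega>))\<bar> \<le> 1" using \<omega> y by (simp add: abs_mult)
      from abs_le[OF this] show "\<Lambda> \<omega> * (F \<omega> y - pv S P s a (F \<omega>)) \<le> 1"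
        "\<Lambda> \<omega> * (- F \<omega> y + pv S P s a (F \<omega>)) \<le> 1" by (simp_all add: algebra_simps)
    qed
    show "\<omega> \<in> ?Y F \<union> ?Y ?G"
    proof (cases "pv S P s a (F \<omega>) \<le> pv S (emp_kernel n \<omega>) s a (F \<omega>)")
      case True
      then have "\<omega> \<in> ?Y F" using \<omega> \<Lambda> range by auto
      then show ?thesis by blast
    next
      case False
      then have "\<omega> \<in> ?Y ?G" using \<omega> \<Lambda> range unfolding mem_Collect_eq pvG pvarG by auto
      then show ?thesis by blast
    qed
  qed
  then have "measure_pmf.prob ?p ?X \<le> measure_pmf.prob ?p (?Y F \<union> ?Y ?G)"
    by (intro measure_pmf.finite_measure_mono) auto
  also have "\<dots> \<le> measure_pmf.prob ?p (?Y F) + measure_pmf.prob ?p (?Y ?G)"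
    by (rule measure_Un_le) auto
  also have "\<dots> \<le> exp (- L) + exp (- L)"
  proof (intro add_mono emp_kernel_bernstein n sa)
    fix \<omega> \<omega>' :: "nat \<times> nat \<times> nat \<Rightarrow> nat"
    assume *: "\<And>s' a' i. s' < S \<Longrightarrow> a' < A \<Longrightarrow> i < n \<Longrightarrow> (s', a') \<noteq> (s, a)
      \<Longrightarrow> \<omega> (s', a', i) = \<omega>' (s', a', i)"
    show "F \<omega> = F \<omega>' \<and> \<Lambda> \<omega> = \<Lambda> \<omega>'" by (rule indep) (rule *)
    then show "?G \<omega> = ?G \<omega>' \<and> \<Lambda> \<omega> = \<Lambda> \<omega>'" by simp
  qed
  finally show ?thesis by simp
qed

text \<open>The rate \<rho> / w balances both requirements: rate times w is \<rho> <= 1, which is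
  the range condition, and L / (rate * n) equals \<rho>, the additive error.\<close>

lemma (in finite_mdp) emp_kernel_deviation_span:
  fixes F :: "(nat \<times> nat \<times> nat \<Rightarrow> nat) \<Rightarrow> nat \<Rightarrow> real" and L :: real and n :: nat
  defines "w \<equiv> \<lambda>\<omega>. sp_norm S (F \<omega>) + 1"
  defines "\<rho> \<equiv> \<lambda>\<omega> :: nat \<times> nat \<times> nat \<Rightarrow> nat. sqrt (L * w \<omega> / real n)"
  assumes n: "n \<ge> 1" and L: "L > 0" and sa: "s < S" "a < A"
    and indep: "\<And>\<omega> \<omega>'. (\<And>s' a' i. s' < S \<Longrightarrow> a' < A \<Longrightarrow> i < n \<Longrightarrow> (s', a') \<noteq> (s, a)
      \<Longrightarrow> \<omega> (s', a', i) = \<omega>' (s', a', i)) \<Longrightarrow> F \<omega> = F \<omega>'"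
  shows "measure_pmf.prob (samples S A n P)
     {\<omega>. \<rho> \<omega> \<le> 1 \<and> \<bar>pv S (emp_kernel n \<omega>) s a (F \<omega>) - pv S P s a (F \<omega>)\<bar>
         > \<rho> \<omega> / w \<omega> * pvar S P s a (F \<omega>) + \<rho> \<omega>} \<le> 2 * exp (- L)"
    (is "measure_pmf.prob ?p ?X \<le> _")
proof -
  let ?\<Lambda> = "\<lambda>\<omega>. \<rho> \<omega> / w \<omega>"
  let ?Y = "{\<omega>. ?\<Lambda> \<omega> > 0 \<and> (\<forall>y<S. ?\<Lambda> \<omega> * \<bar>F \<omega> y - pv S P s a (F \<omega>)\<bar> \<le> 1) \<and>
       \<bar>pv S (emp_kernel n \<omega>) s a (F \<omega>) - pv S P s a (F \<omega>)\<bar>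
         > ?\<Lambda> \<omega> * pvar S P s a (F \<omega>) + L / (?\<Lambda> \<omega> * real n)}"
  have S: "S \<ge> 1" using sa by simp
  have w: "1 \<le> w \<omega>" for \<omega> using sp_norm_nonneg[OF S, of "F \<omega>"] by (simp add: w_def)
  have \<rho>0: "0 < \<rho> \<omega>" for \<omega>
    using L n w[of \<omega>] unfolding \<rho>_def by (intro real_sqrt_gt_zero divide_pos_pos mult_pos_pos) auto
  have "?X \<subseteq> ?Y"
  proof
    fix \<omega> assume \<omega>: "\<omega> \<in> ?X"
    have "\<rho> \<omega> * \<rho> \<omega> = L * w \<omega> / real n" using L w[of \<omega>] by (simp add: \<rho>_def)
    then have rate: "L / (?\<Lambda> \<omega> * real n) = \<rho> \<omega>"
      using \<rho>0[of \<omega>] w[of \<omega>] n by (simp add: field_simps)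
    have "?\<Lambda> \<omega> * \<bar>F \<omega> y - pv S P s a (F \<omega>)\<bar> \<le> 1" if y: "y < S" for y
    proof -
      let ?m = "Min (F \<omega> ` {..<S})"
      have F: "?m \<le> F \<omega> x" "F \<omega> x \<le> ?m + sp_norm S (F \<omega>)" if "x < S" for x
        using Min_le_value[OF that, of "F \<omega>"] value_le_Min_sp[OF that, of "F \<omega>"] by simp_all
      have "?m \<le> pv S P s a (F \<omega>)" by (rule pv_ge[OF sa F(1)])
      moreover have "pv S P s a (F \<omega>) \<le> ?m + sp_norm S (F \<omega>)" by (rule pv_le[OF sa F(2)])
      ultimately have "\<bar>F \<omega> y - pv S P s a (F \<omega>)\<bar> \<le> w \<omega>"
        using F[OF y] by (simp add: w_def abs_le_iff)
      then have "?\<Lambda> \<omega> * \<bar>F \<omega> y - pv S P s a (F \<omega>)\<bar> \<le> ?\<Lambda> \<omega> * w \<omega>"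
        using \<rho>0[of \<omega>] w[of \<omega>] by (intro mult_left_mono) auto
      also have "\<dots> = \<rho> \<omega>" using w[of \<omega>] by simp
      also have "\<dots> \<le> 1" using \<omega> by simp
      finally show ?thesis .
    qed
    then show "\<omega> \<in> ?Y" using \<omega> \<rho>0[of \<omega>] w[of \<omega>] unfolding mem_Collect_eq rate by auto
  qed
  then have "measure_pmf.prob ?p ?X \<le> measure_pmf.prob ?p ?Y"
    by (intro measure_pmf.finite_measure_mono) auto
  also have "\<dots> \<le> 2 * exp (- L)"
  proof (rule emp_kernel_deviation[OF n sa])
    fix \<omega> \<omega>' :: "nat \<times> nat \<times> nat \<Rightarrow> nat"
    assume *: "\<And>s' a' i. s' < S \<Longrightarrow> a' < A \<Longrightarrow> i < n \<Longrightarrow> (s', a') \<noteq> (s, a)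
      \<Longrightarrow> \<omega> (s', a', i) = \<omega>' (s', a', i)"
    have "F \<omega> = F \<omega>'" by (rule indep) (rule *)
    then show "F \<omega> = F \<omega>' \<and> ?\<Lambda> \<omega> = ?\<Lambda> \<omega>'" by (simp add: w_def \<rho>_def)
  qed
  finally show ?thesis .
qed

lemma sp_norm_shift: "sp_norm S (\<lambda>x. v x - c) = sp_norm S v" if S: "S \<ge> 1"
proof -
  have le: "sp_norm S (\<lambda>x. u x - k) \<le> sp_norm S u" for u k
  proof (rule sp_norm_le[OF S, where c = "Min (u ` {..<S}) - k"])
    fix x assume x: "x < S"
    show "Min (u ` {..<S}) - k \<le> u x - k" "u x - k \<le> Min (u ` {..<S}) - k + sp_norm S u"
      using Min_le_value[OF x, of u] value_le_Min_sp[OF x, of u] by linarith+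
  qed
  show ?thesis using le[of v c] le[of "\<lambda>x. v x - c" "- c"] by simp
qed

text \<open>The deterministic half of the proof, on the event where all deviations are controlled.
  The gain bound is applied at the selected discount factor, the comparison with \<rho> at a grid
  point of near-ideal horizon; maximality of the selected one connects the two.\<close>

lemma algorithm_guarantee:
  fixes P Q :: "nat \<Rightarrow> nat \<Rightarrow> nat pmf" and d :: "real \<Rightarrow> nat \<Rightarrow> nat" and U :: "real \<Rightarrow> nat \<Rightarrow> real"
    and \<alpha> :: real and n S A :: nat
  defines "Lhat \<equiv> \<lambda>\<gamma>. (1 - \<gamma>) * Min (U \<gamma> ` {..<S}) - 2 * (1 - \<gamma>) / real n
    - \<alpha> * sqrt ((sp_norm S (U \<gamma>) + 3 / real n + 1) / real n)"
  assumes mdp: "finite_mdp S A P" "finite_mdp S A Q"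
    and r: "\<And>x a. x < S \<Longrightarrow> a < A \<Longrightarrow> 0 \<le> r x a" "\<And>x a. x < S \<Longrightarrow> a < A \<Longrightarrow> r x a \<le> 1"
    and S: "S \<ge> 1" and n: "n \<ge> 1" and L: "L \<ge> 1" and \<alpha>: "96 * sqrt L \<le> \<alpha>"
    and h: "\<And>x. x < S \<Longrightarrow> 0 \<le> h x" "\<And>x. x < S \<Longrightarrow> h x \<le> B" and B: "B \<ge> 1"
    and opt: "\<And>x a. x < S \<Longrightarrow> a < A \<Longrightarrow> r x a + pv S P x a h \<le> \<rho> + h x"
      "\<And>x. x < S \<Longrightarrow> \<exists>a<A. r x a + pv S P x a h = \<rho> + h x" and \<rho>: "\<rho> \<le> 1"
    and d: "\<And>\<gamma> x. \<gamma> \<in> gamma_grid n \<Longrightarrow> x < S \<Longrightarrow> d \<gamma> x < A"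
    and near: "\<And>\<gamma> x. \<gamma> \<in> gamma_grid n \<Longrightarrow> x < S \<Longrightarrow>
      opt_disc_value S A Q r \<gamma> x - 1 / real n \<le> disc_value Q r (det_pol (d \<gamma>)) \<gamma> x"
    and U: "\<And>\<gamma> x. \<gamma> \<in> gamma_grid n \<Longrightarrow> x < S \<Longrightarrow> \<bar>U \<gamma> x - opt_disc_value S A Q r \<gamma> x\<bar> \<le> 1 / real n"
    and dev_W: "\<And>\<gamma> x a j W \<kappa>. \<gamma> \<in> gamma_grid n \<Longrightarrow> x < S \<Longrightarrow> a < A \<Longrightarrow> j \<le> n\<^sup>2
      \<Longrightarrow> W = pinned_val S A Q r \<gamma> x (real j / real n)
      \<Longrightarrow> \<kappa> = sqrt (L * (sp_norm S W + 1) / real n) \<Longrightarrow> \<kappa> \<le> 1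
      \<Longrightarrow> \<bar>pv S Q x a W - pv S P x a W\<bar> \<le> \<kappa> / (sp_norm S W + 1) * pvar S P x a W + \<kappa>"
    and dev_h: "\<And>x a. x < S \<Longrightarrow> a < A \<Longrightarrow> sqrt (L * B / real n) \<le> 1 \<Longrightarrow>
      \<bar>pv S Q x a h - pv S P x a h\<bar> \<le> sqrt (L * B / real n) / B * pvar S P x a h + sqrt (L * B / real n)"
    and dev_h2: "\<And>x a. x < S \<Longrightarrow> a < A \<Longrightarrow>
      \<bar>pv S Q x a (\<lambda>y. (h y)\<^sup>2) - pv S P x a (\<lambda>y. (h y)\<^sup>2)\<bar>
        \<le> 1 / (8 * B\<^sup>2) * pvar S P x a (\<lambda>y. (h y)\<^sup>2) + L / (1 / (8 * B\<^sup>2) * real n)"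
    and \<gamma>s: "\<gamma>s \<in> gamma_grid n" "\<And>\<gamma>. \<gamma> \<in> gamma_grid n \<Longrightarrow> Lhat \<gamma> \<le> Lhat \<gamma>s"
    and s: "s < S"
  shows "max (Lhat \<gamma>s) 0 \<le> gain P r (det_pol (d \<gamma>s)) s"
    and "\<rho> - 4 * \<alpha>\<^sup>2 * sqrt (B / real n) \<le> max (Lhat \<gamma>s) 0"
proof -
  interpret P: finite_mdp S A P by fact
  have Q: "discounted_mdp S A Q r \<gamma>" if "\<gamma> \<in> gamma_grid n" for \<gamma>
    using mdp(2) r gamma_grid_bounds[OF that n]
    by (simp add: discounted_mdp_def discounted_mdp_axioms_def)
  let ?V = "\<lambda>\<gamma>. opt_disc_value S A Q r \<gamma>"
  have "Lhat \<gamma>s \<le> gain P r (det_pol (d \<gamma>s)) s"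
    unfolding Lhat_def
  proof (rule Lhat_le_gain[OF S n L \<alpha>])
    show "(1 - \<gamma>s) * Min (?V \<gamma>s ` {..<S}) - 49 * sqrt (L * (sp_norm S (?V \<gamma>s) + 1) / real n)
        \<le> gain P r (det_pol (d \<gamma>s)) s"
      by (rule plugin_gain_lower_bound[OF mdp(1) Q[OF \<gamma>s(1)] S n L gamma_grid_bounds(3)[OF \<gamma>s(1) n]
            d[OF \<gamma>s(1)] near[OF \<gamma>s(1)] dev_W[OF \<gamma>s(1)] s])
  qed (use U \<gamma>s(1) gamma_grid_bounds(2)[OF \<gamma>s(1) n] in auto)
  moreover have "0 \<le> gain P r (det_pol (d \<gamma>s)) s"
    by (rule P.gain_det_nonneg[OF d[OF \<gamma>s(1)] r(1) s])
  ultimately show "max (Lhat \<gamma>s) 0 \<le> gain P r (det_pol (d \<gamma>s)) s" by simp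
  define t where "t = sqrt (B / real n)"
  define q where "q = sqrt (L * B / real n)"
  define x where "x = sqrt (real n * B)"
  have n0: "1 \<le> real n" using n by simp
  have t0: "0 \<le> t" using B by (simp add: t_def)
  have q0: "0 \<le> q" using B L by (simp add: q_def)
  show "\<rho> - 4 * \<alpha>\<^sup>2 * sqrt (B / real n) \<le> max (Lhat \<gamma>s) 0"
  \<comment> \<open>If the allowed loss is at least 1, the lower bound holds because \<rho> <= 1 and
    the output is truncated at 0.\<close>
  proof (cases "1 \<le> 4 * \<alpha>\<^sup>2 * t")
    case True
    then show ?thesis using \<rho> unfolding t_def by linarith
  next
    case False
    \<comment> \<open>Now 4 \<alpha>^2 t < 1. With 96 sqrt L <= \<alpha> this forces L t < 1 /
      36864, where 36864 = 4 * 96^2. Hence q and t are at most 1/8, n >= 64 B, and the ideal horizon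
      x lies in the range [sqrt n, n] of the grid.\<close>
    have sqrtL: "1 \<le> sqrt L" using L by simp
    have L_sqrt: "L = sqrt L * sqrt L" using L by simp
    have \<alpha>0: "0 \<le> \<alpha>" using \<alpha> sqrtL by linarith
    have "(96 * sqrt L) * (96 * sqrt L) \<le> \<alpha> * \<alpha>"
      by (rule mult_mono[OF \<alpha> \<alpha> \<alpha>0]) (use L in simp)
    then have \<alpha>L: "9216 * L \<le> \<alpha>\<^sup>2" using L_sqrt by (simp add: power2_eq_square)
    have "36864 * (L * t) \<le> 4 * \<alpha>\<^sup>2 * t"
      using mult_right_mono[OF \<alpha>L t0] unfolding mult.assoc by linarith
    then have Lt: "L * t < 1 / 36864" using False by linarith
    have "1 * sqrt L \<le> sqrt L * sqrt L" using sqrtL by (intro mult_right_mono) auto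
    then have "sqrt L \<le> L" by (simp only: L_sqrt[symmetric] mult_1)
    then have "sqrt L * t \<le> L * t" using t0 by (rule mult_right_mono)
    moreover have "q = sqrt L * t" by (simp add: q_def t_def real_sqrt_mult[symmetric])
    ultimately have q8: "q \<le> 1 / 8" using Lt by linarith
    then have q1: "q \<le> 1" by linarith
    have t1: "t \<le> 1 / 8" using Lt mult_right_mono[OF L t0] by simp
    have "t * t \<le> (1 / 8) * (1 / 8)" using t1 t0 by (intro mult_mono) auto
    moreover have "t * t = B / real n" using B by (simp add: t_def)
    ultimately have nB: "64 * B \<le> real n" using n0 by (simp add: field_simps)
    have n4: "n \<ge> 4" using nB B by linarith
    have x: "sqrt (real n) \<le> x" "x \<le> real n"
    proof -
      show "sqrt (real n) \<le> x" using B n0 by (simp add: x_def)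
      show "x \<le> real n"
        unfolding x_def using nB B n0 by (intro real_le_lsqrt) (auto simp: power2_eq_square)
    qed
    have xt: "x * t = B"
    proof -
      have "x * t = sqrt (real n * B * (B / real n))" unfolding x_def t_def by (simp only: real_sqrt_mult)
      also have "real n * B * (B / real n) = B\<^sup>2" using n0 by (simp add: power2_eq_square)
      finally show ?thesis using B by simp
    qed
    obtain \<gamma> where \<gamma>: "\<gamma> \<in> gamma_grid n" "x / 2 \<le> 1 / (1 - \<gamma>)" "1 / (1 - \<gamma>) \<le> 2 * x"
      using gamma_grid_near[OF n4 x(1,2)] by blast
    note \<gamma>_bounds = gamma_grid_bounds[OF \<gamma>(1) n]
    have "(1 - \<gamma>) * x \<le> 2" using \<gamma>(2) \<gamma>_bounds by (simp add: field_simps)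
    from mult_right_mono[OF this t0] have \<gamma>B: "(1 - \<gamma>) * B \<le> 1" using t1 by (simp add: xt mult.assoc)
    have V: "\<bar>(1 - \<gamma>) * ?V \<gamma> y - \<rho>\<bar> \<le> (1 - \<gamma>) * B + 24 * q" if y: "y < S" for y
    proof (rule plugin_value_bounds[OF mdp(1) Q[OF \<gamma>(1)] h])
      show "\<bar>pv S Q x a h - pv S P x a h\<bar> \<le> q / B * pvar S P x a h + q" if "x < S" "a < A" for x a
        unfolding q_def by (rule dev_h[OF that q1[unfolded q_def]])
      show "\<bar>pv S Q x a (\<lambda>y. (h y)\<^sup>2) - pv S P x a (\<lambda>y. (h y)\<^sup>2)\<bar> \<le> pvar S P x a h / 2 + B / 8"
        if xa: "x < S" "a < A" for x a
      proof -
        \<comment> \<open>The rate 1 / (8 B^2) against the factor 4 B^2 of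
          \<open>pvar_square\<close> leaves half the variance of h; the additive term is 8 B q^2 <=
          B / 8 since q <= 1/8.\<close>
        have "1 / (8 * B\<^sup>2) * pvar S P x a (\<lambda>y. (h y)\<^sup>2) \<le> 1 / (8 * B\<^sup>2) * (4 * B\<^sup>2 * pvar S P x a h)"
          using B by (intro mult_left_mono P.pvar_square[OF xa h]) auto
        also have "\<dots> = pvar S P x a h / 2" using B by (simp add: field_simps)
        finally have 1: "1 / (8 * B\<^sup>2) * pvar S P x a (\<lambda>y. (h y)\<^sup>2) \<le> pvar S P x a h / 2" .
        have q2: "q * q = L * B / real n" using L B by (simp add: q_def)
        have "L / (1 / (8 * B\<^sup>2) * real n) = 8 * B * (q * q)"
          unfolding q2 using B n0 by (simp add: field_simps power2_eq_square)
        also have "\<dots> \<le> 8 * B * ((1 / 8) * (1 / 8))"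
          using q8 q0 B by (intro mult_left_mono mult_mono) auto
        finally have "L / (1 / (8 * B\<^sup>2) * real n) \<le> B / 8" by simp
        then show ?thesis using dev_h2[OF xa] 1 by linarith
      qed
    qed (use B opt \<rho> q0 q8 \<gamma>B y in auto)
    have "\<rho> - 4 * \<alpha>\<^sup>2 * sqrt (B / real n) \<le> Lhat \<gamma>"
      unfolding Lhat_def
      by (rule Lhat_ge_opt_gain[OF S n L \<alpha> \<gamma>_bounds(1,2) B \<gamma>(2,3)[unfolded x_def] U[OF \<gamma>(1)] V[unfolded q_def]])
    also have "\<dots> \<le> Lhat \<gamma>s" by (rule \<gamma>s(2)[OF \<gamma>(1)])
    finally show ?thesis by simp
  qed
qed

text \<open>At most \<open>n S A (n\<^sup>2 + 1) + 2 S A\<close> two-sided events at level \<open>exp (- L)\<close>; the logarithm in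
  \<open>alpha\<close> leaves room for \<open>12 S A n\<^sup>5\<close> of them.\<close>

lemma (in finite_mdp) concentration_event:
  fixes h :: "nat \<Rightarrow> real" and n :: nat and \<delta> L :: real
  defines "L \<equiv> ln (24 * real S * real A * real n ^ 5 / \<delta>)"
  assumes S: "S \<ge> 1" and n: "n \<ge> 1" and \<delta>: "0 < \<delta>" "\<delta> < 1"
    and h: "\<And>x. x < S \<Longrightarrow> 0 \<le> h x" "\<And>x. x < S \<Longrightarrow> h x \<le> B" and B: "B = sp_norm S h + 1"
  shows "\<exists>bad. measure_pmf.prob (samples S A n P) bad \<le> \<delta> \<and> (\<forall>\<omega>. \<omega> \<notin> bad \<longrightarrow>
    (\<forall>\<gamma>\<in>gamma_grid n. \<forall>x<S. \<forall>a<A. \<forall>j\<le>n\<^sup>2. let W = pinned_val S A (emp_kernel n \<omega>) r \<gamma> x (real j / real n);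
        \<kappa> = sqrt (L * (sp_norm S W + 1) / real n) in
      \<kappa> \<le> 1 \<longrightarrow> \<bar>pv S (emp_kernel n \<omega>) x a W - pv S P x a W\<bar> \<le> \<kappa> / (sp_norm S W + 1) * pvar S P x a W + \<kappa>) \<and>
    (\<forall>x<S. \<forall>a<A. sqrt (L * B / real n) \<le> 1 \<longrightarrow> \<bar>pv S (emp_kernel n \<omega>) x a h - pv S P x a h\<bar>
      \<le> sqrt (L * B / real n) / B * pvar S P x a h + sqrt (L * B / real n)) \<and>
    (\<forall>x<S. \<forall>a<A. \<bar>pv S (emp_kernel n \<omega>) x a (\<lambda>y. (h y)\<^sup>2) - pv S P x a (\<lambda>y. (h y)\<^sup>2)\<bar>
      \<le> 1 / (8 * B\<^sup>2) * pvar S P x a (\<lambda>y. (h y)\<^sup>2) + L / (1 / (8 * B\<^sup>2) * real n)))"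
proof -
  let ?p = "samples S A n P"
  let ?W = "\<lambda>\<gamma> x j \<omega>. pinned_val S A (emp_kernel n \<omega>) r \<gamma> x (real j / real n)"
  define X1 where "X1 = (\<lambda>(\<gamma>, x, a, j). {\<omega>. sqrt (L * (sp_norm S (?W \<gamma> x j \<omega>) + 1) / real n) \<le> 1 \<and>
    \<bar>pv S (emp_kernel n \<omega>) x a (?W \<gamma> x j \<omega>) - pv S P x a (?W \<gamma> x j \<omega>)\<bar>
      > sqrt (L * (sp_norm S (?W \<gamma> x j \<omega>) + 1) / real n) / (sp_norm S (?W \<gamma> x j \<omega>) + 1)
          * pvar S P x a (?W \<gamma> x j \<omega>) + sqrt (L * (sp_norm S (?W \<gamma> x j \<omega>) + 1) / real n)})"
  define X2 where "X2 = (\<lambda>(x, a). {\<omega>. sqrt (L * (sp_norm S h + 1) / real n) \<le> 1 \<and>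
    \<bar>pv S (emp_kernel n \<omega>) x a h - pv S P x a h\<bar>
      > sqrt (L * (sp_norm S h + 1) / real n) / (sp_norm S h + 1) * pvar S P x a h
        + sqrt (L * (sp_norm S h + 1) / real n)})"
  \<comment> \<open>The positivity and range conditions give the set the shape of
    \<open>emp_kernel_deviation\<close>. Both always hold on the index set, so the complement yields
    the bare deviation bound.\<close>
  define X3 where "X3 = (\<lambda>(x, a). {\<omega>. 1 / (8 * B\<^sup>2) > 0 \<and>
    (\<forall>y<S. 1 / (8 * B\<^sup>2) * \<bar>(h y)\<^sup>2 - pv S P x a (\<lambda>y. (h y)\<^sup>2)\<bar> \<le> 1) \<and>
    \<bar>pv S (emp_kernel n \<omega>) x a (\<lambda>y. (h y)\<^sup>2) - pv S P x a (\<lambda>y. (h y)\<^sup>2)\<bar>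
      > 1 / (8 * B\<^sup>2) * pvar S P x a (\<lambda>y. (h y)\<^sup>2) + L / (1 / (8 * B\<^sup>2) * real n)})"
  define I1 where "I1 = gamma_grid n \<times> {..<S} \<times> {..<A} \<times> {..n\<^sup>2}"
  define I2 where "I2 = {..<S} \<times> {..<A}"
  define bad where "bad = (\<Union>i\<in>I1. X1 i) \<union> ((\<Union>i\<in>I2. X2 i) \<union> (\<Union>i\<in>I2. X3 i))"
  have B1: "1 \<le> B" using sp_norm_nonneg[OF S, of h] by (simp add: B)
  let ?K = "24 * real S * real A * real n ^ 5"
  have SA: "1 \<le> real S * real A" using mult_mono[of 1 "real S" 1 "real A"] S A_pos by simp
  have n5: "1 \<le> real n ^ 5" using n by (intro one_le_power) auto
  have K: "24 \<le> ?K" using mult_mono[of 1 "real S * real A" 1 "real n ^ 5"] SA n5 by simp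
  have K\<delta>: "1 < ?K / \<delta>" using K \<delta> by (simp add: less_divide_eq)
  then have L0: "0 < L" unfolding L_def by (rule ln_gt_zero)
  have expL: "exp (- L) = \<delta> / ?K"
  proof -
    have "exp L = ?K / \<delta>" unfolding L_def using K\<delta> by (intro exp_ln) linarith
    then show ?thesis by (simp add: exp_minus)
  qed
  have p1: "measure_pmf.prob ?p (X1 i) \<le> 2 * exp (- L)" if i: "i \<in> I1" for i
  proof -
    obtain \<gamma> x a j where i': "i = (\<gamma>, x, a, j)" by (metis prod_cases4)
    have xa: "x < S" "a < A" using i by (auto simp: i' I1_def)
    show ?thesis
      unfolding i' X1_def prod.case
    proof (rule emp_kernel_deviation_span[OF n L0 xa])
      fix \<omega> \<omega>' :: "nat \<times> nat \<times> nat \<Rightarrow> nat"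
      assume *: "\<And>s' a' i. s' < S \<Longrightarrow> a' < A \<Longrightarrow> i < n \<Longrightarrow> (s', a') \<noteq> (x, a)
        \<Longrightarrow> \<omega> (s', a', i) = \<omega>' (s', a', i)"
      \<comment> \<open>The pinned value ignores the whole row of x, for all actions, and so in
        particular the samples drawn at (x, a).\<close>
      show "?W \<gamma> x j \<omega> = ?W \<gamma> x j \<omega>'"
      proof (rule pinned_val_cong)
        fix y b assume "y < S" "y \<noteq> x" "b < A"
        then show "emp_kernel n \<omega> y b = emp_kernel n \<omega>' y b"
          unfolding emp_kernel_def using * n
          by (intro map_pmf_cong refl) (auto simp: set_pmf_of_set lessThan_empty_iff)
      qed
    qed
  qed
  have p2: "measure_pmf.prob ?p (X2 i) \<le> 2 * exp (- L)" if i: "i \<in> I2" for i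
  proof -
    obtain x a where i': "i = (x, a)" by fastforce
    have xa: "x < S" "a < A" using i by (auto simp: i' I2_def)
    show ?thesis
      unfolding i' X2_def prod.case
      by (rule emp_kernel_deviation_span[OF n L0 xa, where F = "\<lambda>_. h"]) simp
  qed
  have range: "1 / (8 * B\<^sup>2) * \<bar>(h y)\<^sup>2 - pv S P x a (\<lambda>y. (h y)\<^sup>2)\<bar> \<le> 1"
    if "x < S" "a < A" "y < S" for x a y
  proof -
    have h2: "0 \<le> (h y)\<^sup>2" "(h y)\<^sup>2 \<le> B\<^sup>2" if "y < S" for y
      using h[OF that] by (auto intro: power_mono)
    have "0 \<le> pv S P x a (\<lambda>y. (h y)\<^sup>2)" "pv S P x a (\<lambda>y. (h y)\<^sup>2) \<le> B\<^sup>2"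
      using h2 by (auto intro!: pv_ge pv_le that)
    then have "\<bar>(h y)\<^sup>2 - pv S P x a (\<lambda>y. (h y)\<^sup>2)\<bar> \<le> 8 * B\<^sup>2"
      using h2[OF that(3)] zero_le_power2[of B] by linarith
    then show ?thesis using B1 by (simp add: divide_le_eq)
  qed
  have p3: "measure_pmf.prob ?p (X3 i) \<le> 2 * exp (- L)" if i: "i \<in> I2" for i
  proof -
    obtain x a where i': "i = (x, a)" by fastforce
    have xa: "x < S" "a < A" using i by (auto simp: i' I2_def)
    show ?thesis
      unfolding i' X3_def prod.case
      by (rule emp_kernel_deviation[OF n xa, where F = "\<lambda>_ y. (h y)\<^sup>2" and \<Lambda> = "\<lambda>_. 1 / (8 * B\<^sup>2)"]) simp
  qed
  have fin: "finite I1" "finite I2"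
    using gamma_grid_finite_card(1)[OF n] by (simp_all add: I1_def I2_def)
  have union: "measure_pmf.prob ?p (\<Union>i\<in>I. X i) \<le> real (card I) * (2 * exp (- L))"
    if "finite I" "\<And>i. i \<in> I \<Longrightarrow> measure_pmf.prob ?p (X i) \<le> 2 * exp (- L)"
    for I :: "'i set" and X
  proof -
    have "measure_pmf.prob ?p (\<Union>i\<in>I. X i) \<le> (\<Sum>i\<in>I. measure_pmf.prob ?p (X i))"
      using that(1) by (intro measure_pmf.finite_measure_subadditive_finite) auto
    also have "\<dots> \<le> (\<Sum>i\<in>I. 2 * exp (- L))" by (intro sum_mono that(2))
    finally show ?thesis by simp
  qed
  have card1: "real (card I1) \<le> real n * (real S * real A) * (real n ^ 2 + 1)"
  proof -
    have "card I1 = card (gamma_grid n) * (S * (A * (n\<^sup>2 + 1)))"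
      by (simp add: I1_def card_cartesian_product)
    also have "\<dots> \<le> n * (S * (A * (n\<^sup>2 + 1)))"
      using gamma_grid_finite_card(2)[OF n] by (rule mult_right_mono) simp
    finally have "real (card I1) \<le> real (n * (S * (A * (n\<^sup>2 + 1))))" by (rule of_nat_mono)
    then show ?thesis by (simp add: algebra_simps)
  qed
  have card2: "real (card I2) = real S * real A" by (simp add: I2_def card_cartesian_product)
  have "measure_pmf.prob ?p bad \<le> measure_pmf.prob ?p (\<Union>i\<in>I1. X1 i)
      + (measure_pmf.prob ?p (\<Union>i\<in>I2. X2 i) + measure_pmf.prob ?p (\<Union>i\<in>I2. X3 i))"
    unfolding bad_def by (intro order_trans[OF measure_Un_le] add_left_mono measure_Un_le) auto
  also have "\<dots> \<le> real (card I1) * (2 * exp (- L)) + (real (card I2) * (2 * exp (- L)) + real (card I2) * (2 * exp (- L)))"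
    using union[OF fin(1) p1] union[OF fin(2) p2] union[OF fin(2) p3] by (intro add_mono) auto
  also have "\<dots> = (real (card I1) + 2 * real (card I2)) * (2 * exp (- L))" by (simp add: algebra_simps)
  also have "\<dots> \<le> (12 * (real S * real A) * real n ^ 5) * (2 * exp (- L))"
  proof (rule mult_right_mono)
    have pow: "real n ^ 3 \<le> real n ^ 5" "real n \<le> real n ^ 5"
      using n power_increasing[of 3 5 "real n"] power_increasing[of 1 5 "real n"] by auto
    have "real n * (real n ^ 2 + 1) + 2 = real n ^ 3 + real n + 2"
      by (simp add: algebra_simps power2_eq_square power3_eq_cube)
    then have "real n * (real n ^ 2 + 1) + 2 \<le> 12 * real n ^ 5" using pow n5 by linarith
    then have "(real S * real A) * (real n * (real n ^ 2 + 1) + 2) \<le> (real S * real A) * (12 * real n ^ 5)"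
      by (intro mult_left_mono) auto
    then show "real (card I1) + 2 * real (card I2) \<le> 12 * (real S * real A) * real n ^ 5"
      using card1 card2 by (simp add: algebra_simps)
  qed simp
  also have "\<dots> = \<delta>"
  proof -
    have cancel: "k * (\<delta> / k) = \<delta>" if "k \<noteq> 0" for k using that by simp
    have "(12 * (real S * real A) * real n ^ 5) * (2 * exp (- L)) = ?K * exp (- L)" by simp
    also have "\<dots> = \<delta>" unfolding expL by (rule cancel) (use K in linarith)
    finally show ?thesis .
  qed
  finally have prob: "measure_pmf.prob ?p bad \<le> \<delta>" .
  have "\<omega> \<notin> bad \<Longrightarrow> i \<in> I1 \<Longrightarrow> \<omega> \<notin> X1 i" "\<omega> \<notin> bad \<Longrightarrow> k \<in> I2 \<Longrightarrow> \<omega> \<notin> X2 k"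
    "\<omega> \<notin> bad \<Longrightarrow> k \<in> I2 \<Longrightarrow> \<omega> \<notin> X3 k" for \<omega> i k
    by (auto simp: bad_def)
  note good = this
  show ?thesis
  proof (intro exI[of _ bad] conjI prob allI impI ballI)
    fix \<omega> \<gamma> x a j assume "\<omega> \<notin> bad" "\<gamma> \<in> gamma_grid n" "x < S" "a < A" "j \<le> n\<^sup>2"
    then have "\<omega> \<notin> X1 (\<gamma>, x, a, j)" by (intro good(1)) (auto simp: I1_def)
    then show "let W = ?W \<gamma> x j \<omega>; \<kappa> = sqrt (L * (sp_norm S W + 1) / real n) in
      \<kappa> \<le> 1 \<longrightarrow> \<bar>pv S (emp_kernel n \<omega>) x a W - pv S P x a W\<bar> \<le> \<kappa> / (sp_norm S W + 1) * pvar S P x a W + \<kappa>"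
      by (simp add: X1_def Let_def not_less)
  next
    fix \<omega> x a assume "\<omega> \<notin> bad" "x < S" "a < A" "sqrt (L * B / real n) \<le> 1"
    moreover from this have "\<omega> \<notin> X2 (x, a)" by (intro good(2)) (auto simp: I2_def)
    ultimately show "\<bar>pv S (emp_kernel n \<omega>) x a h - pv S P x a h\<bar>
      \<le> sqrt (L * B / real n) / B * pvar S P x a h + sqrt (L * B / real n)"
      by (simp add: X2_def B not_less)
  next
    fix \<omega> x a assume xa: "\<omega> \<notin> bad" "x < S" "a < A"
    then have "\<omega> \<notin> X3 (x, a)" by (intro good(3)) (auto simp: I2_def)
    moreover have "1 / (8 * B\<^sup>2) > 0" using B1 by simp
    ultimately show "\<bar>pv S (emp_kernel n \<omega>) x a (\<lambda>y. (h y)\<^sup>2) - pv S P x a (\<lambda>y. (h y)\<^sup>2)\<bar>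
      \<le> 1 / (8 * B\<^sup>2) * pvar S P x a (\<lambda>y. (h y)\<^sup>2) + L / (1 / (8 * B\<^sup>2) * real n)"
      unfolding X3_def prod.case mem_Collect_eq using range[OF xa(2,3)] by (meson not_less)
  qed
qed

section \<open>From the concentration event to the high-probability guarantee\<close>

theorem theorem1:
  shows "\<exists>C3::real. \<forall>(S::nat) (A::nat) P r (\<delta>::real) (n::nat) solve gsel \<pi>star.
     S \<ge> 1 \<and> A \<ge> 1 \<and> valid_kernel S A P \<and> weakly_communicating S A P \<and>
     (\<forall>s<S. \<forall>a<A. 0 \<le> r s a \<and> r s a \<le> 1) \<and>
     0 < \<delta> \<and> \<delta> < 1 \<and> n \<ge> 1 \<and>
     solver_spec S A r n solve \<and>
     (\<forall>\<omega>. gsel \<omega> \<in> gamma_grid n \<and>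
           (\<forall>\<gamma>\<in>gamma_grid n. L_hat S A \<delta> n solve \<omega> \<gamma> \<le> L_hat S A \<delta> n solve \<omega> (gsel \<omega>))) \<and>
     blackwell_optimal S A P r \<pi>star
     \<longrightarrow>
     measure_pmf.prob (samples S A n P)
       {\<omega>. let \<pi>hat = fst (solve (emp_kernel n \<omega>) (gsel \<omega>));
               \<rho>hat = max (L_hat S A \<delta> n solve \<omega> (gsel \<omega>)) 0 in
             \<forall>s<S. gain P r (det_pol \<pi>hat) s \<ge> \<rho>hat \<and>
                   \<rho>hat \<ge> opt_gain S A P r s
                          - C3 * (alpha S A \<delta> n)\<^sup>2 * sqrt ((sp_norm S (bias P r \<pi>star) + 1) / real n)}
       \<ge> 1 - \<delta>"
proof (intro exI[of _ 4] allI impI)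
  fix S A :: nat and P :: "nat \<Rightarrow> nat \<Rightarrow> nat pmf" and r :: "nat \<Rightarrow> nat \<Rightarrow> real" and \<delta> :: real and n :: nat
    and solve :: "(nat \<Rightarrow> nat \<Rightarrow> nat pmf) \<Rightarrow> real \<Rightarrow> (nat \<Rightarrow> nat) \<times> (nat \<Rightarrow> real)"
    and gsel :: "(nat \<times> nat \<times> nat \<Rightarrow> nat) \<Rightarrow> real" and \<pi>star :: "nat \<Rightarrow> nat pmf"
  assume *: "S \<ge> 1 \<and> A \<ge> 1 \<and> valid_kernel S A P \<and> weakly_communicating S A P \<and>
     (\<forall>s<S. \<forall>a<A. 0 \<le> r s a \<and> r s a \<le> 1) \<and>
     0 < \<delta> \<and> \<delta> < 1 \<and> n \<ge> 1 \<and>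
     solver_spec S A r n solve \<and>
     (\<forall>\<omega>. gsel \<omega> \<in> gamma_grid n \<and>
           (\<forall>\<gamma>\<in>gamma_grid n. L_hat S A \<delta> n solve \<omega> \<gamma> \<le> L_hat S A \<delta> n solve \<omega> (gsel \<omega>))) \<and>
     blackwell_optimal S A P r \<pi>star"
  have S: "S \<ge> 1" and A: "A \<ge> 1" and kernel: "valid_kernel S A P" and wc: "weakly_communicating S A P"
    and r: "\<And>s a. s < S \<Longrightarrow> a < A \<Longrightarrow> 0 \<le> r s a" "\<And>s a. s < S \<Longrightarrow> a < A \<Longrightarrow> r s a \<le> 1"
    and \<delta>: "0 < \<delta>" "\<delta> < 1" and n: "n \<ge> 1" and solver: "solver_spec S A r n solve"
    and gsel: "\<And>\<omega>. gsel \<omega> \<in> gamma_grid n"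
      "\<And>\<omega> \<gamma>. \<gamma> \<in> gamma_grid n \<Longrightarrow> L_hat S A \<delta> n solve \<omega> \<gamma> \<le> L_hat S A \<delta> n solve \<omega> (gsel \<omega>)"
    and bw: "blackwell_optimal S A P r \<pi>star"
    using * by auto
  interpret finite_mdp S A P using kernel A by unfold_locales
  define L where "L = ln (24 * real S * real A * real n ^ 5 / \<delta>)"
  have L1: "1 \<le> L"
  proof -
    have "1 \<le> real S * real A" using mult_mono[of 1 "real S" 1 "real A"] S A by simp
    moreover have "1 \<le> real n ^ 5" using n by (intro one_le_power) auto
    ultimately have K: "24 \<le> 24 * real S * real A * real n ^ 5"
      using mult_mono[of 1 "real S * real A" 1 "real n ^ 5"] by simp
    have "exp 1 \<le> (24::real)" using exp_le by linarith
    also have "\<dots> \<le> 24 * real S * real A * real n ^ 5 / \<delta>"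
      using K \<delta> mult_right_mono[of \<delta> 1 24] by (simp add: le_divide_eq)
    finally have "ln (exp 1) \<le> L" unfolding L_def by (subst ln_le_cancel_iff) (auto intro: less_le_trans[OF exp_gt_zero])
    then show ?thesis by simp
  qed
  have \<alpha>: "96 * sqrt L \<le> alpha S A \<delta> n"
    unfolding L_def by (rule alpha_ge) (use L1 in \<open>simp add: L_def\<close>)
  obtain \<rho> where \<rho>: "\<rho> \<le> 1" "\<And>s. s < S \<Longrightarrow> opt_gain S A P r s = \<rho>"
    "\<And>s a. s < S \<Longrightarrow> a < A \<Longrightarrow> r s a + pv S P s a (bias P r \<pi>star) \<le> \<rho> + bias P r \<pi>star s"
    "\<And>s. s < S \<Longrightarrow> \<exists>a<A. r s a + pv S P s a (bias P r \<pi>star) = \<rho> + bias P r \<pi>star s"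
    using blackwell_average_optimality[OF S wc r bw] by blast
  \<comment> \<open>The optimality equation is invariant under adding constants to the bias.
    Shifting its minimum to 0 puts h into [0, B], as the estimates for h^2 require.\<close>
  define c where "c = Min (bias P r \<pi>star ` {..<S})"
  define h where "h x = bias P r \<pi>star x - c" for x
  define B where "B = sp_norm S (bias P r \<pi>star) + 1"
  have pv_h: "pv S P s a h = pv S P s a (bias P r \<pi>star) - c" if "s < S" "a < A" for s a
    unfolding h_def pv_diff pv_const[OF that] ..
  have h: "0 \<le> h x" "h x \<le> B" if "x < S" for x
    using Min_le_value[OF that, of "bias P r \<pi>star"] value_le_Min_sp[OF that, of "bias P r \<pi>star"]
    by (simp_all only: h_def B_def c_def[symmetric])
  have B: "B = sp_norm S h + 1" unfolding h_def sp_norm_shift[OF S] B_def ..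
  have B1: "1 \<le> B" using sp_norm_nonneg[OF S, of "bias P r \<pi>star"] by (simp add: B_def)
  have opt: "r x a + pv S P x a h \<le> \<rho> + h x" if "x < S" "a < A" for x a
    using \<rho>(3)[OF that] by (simp add: pv_h[OF that] h_def)
  have opt_eq: "\<exists>a<A. r x a + pv S P x a h = \<rho> + h x" if "x < S" for x
    using \<rho>(4)[OF that] by (auto simp: pv_h[OF that] h_def)
  obtain bad where bad: "measure_pmf.prob (samples S A n P) bad \<le> \<delta>"
    and dev: "\<And>\<omega>. \<omega> \<notin> bad \<Longrightarrow>
      (\<forall>\<gamma>\<in>gamma_grid n. \<forall>x<S. \<forall>a<A. \<forall>j\<le>n\<^sup>2. let W = pinned_val S A (emp_kernel n \<omega>) r \<gamma> x (real j / real n);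
          \<kappa> = sqrt (L * (sp_norm S W + 1) / real n) in
        \<kappa> \<le> 1 \<longrightarrow> \<bar>pv S (emp_kernel n \<omega>) x a W - pv S P x a W\<bar> \<le> \<kappa> / (sp_norm S W + 1) * pvar S P x a W + \<kappa>) \<and>
      (\<forall>x<S. \<forall>a<A. sqrt (L * B / real n) \<le> 1 \<longrightarrow> \<bar>pv S (emp_kernel n \<omega>) x a h - pv S P x a h\<bar>
        \<le> sqrt (L * B / real n) / B * pvar S P x a h + sqrt (L * B / real n)) \<and>
      (\<forall>x<S. \<forall>a<A. \<bar>pv S (emp_kernel n \<omega>) x a (\<lambda>y. (h y)\<^sup>2) - pv S P x a (\<lambda>y. (h y)\<^sup>2)\<bar>
        \<le> 1 / (8 * B\<^sup>2) * pvar S P x a (\<lambda>y. (h y)\<^sup>2) + L / (1 / (8 * B\<^sup>2) * real n))"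
    using concentration_event[OF S n \<delta> h B, of r] unfolding L_def by blast
  let ?p = "samples S A n P"
  let ?G = "{\<omega>. let \<pi>hat = fst (solve (emp_kernel n \<omega>) (gsel \<omega>));
               \<rho>hat = max (L_hat S A \<delta> n solve \<omega> (gsel \<omega>)) 0 in
             \<forall>s<S. gain P r (det_pol \<pi>hat) s \<ge> \<rho>hat \<and>
                   \<rho>hat \<ge> opt_gain S A P r s
                          - 4 * (alpha S A \<delta> n)\<^sup>2 * sqrt ((sp_norm S (bias P r \<pi>star) + 1) / real n)}"
  \<comment> \<open>Restricted to the support of the samples: only there is the empirical kernel
    known to be valid, so that \<open>solver_spec\<close> applies. The restriction costs no
    probability.\<close>
  have good: "\<omega> \<in> ?G" if \<omega>: "\<omega> \<in> set_pmf ?p" "\<omega> \<notin> bad" for \<omega>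
  proof -
    let ?Q = "emp_kernel n \<omega>"
    let ?U = "\<lambda>\<gamma>. snd (solve ?Q \<gamma>)" and ?d = "\<lambda>\<gamma>. fst (solve ?Q \<gamma>)"
    have Q: "valid_kernel S A ?Q" by (rule valid_emp_kernel[OF \<omega>(1) kernel n])
    have mdpQ: "finite_mdp S A ?Q" using Q A by unfold_locales
    have solved: "?d \<gamma> x < A"
      "opt_disc_value S A ?Q r \<gamma> x - 1 / real n \<le> disc_value ?Q r (det_pol (?d \<gamma>)) \<gamma> x"
      "\<bar>?U \<gamma> x - opt_disc_value S A ?Q r \<gamma> x\<bar> \<le> 1 / real n"
      if "\<gamma> \<in> gamma_grid n" "x < S" for \<gamma> x
      using solver Q gamma_grid_bounds[OF that(1) n] that(2) unfolding solver_spec_def by auto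
    have Lhat: "L_hat S A \<delta> n solve \<omega> = (\<lambda>\<gamma>. (1 - \<gamma>) * Min (?U \<gamma> ` {..<S}) - 2 * (1 - \<gamma>) / real n
      - alpha S A \<delta> n * sqrt ((sp_norm S (?U \<gamma>) + 3 / real n + 1) / real n))"
      by (simp add: L_hat_def Let_def fun_eq_iff)
    have devs: "\<bar>pv S ?Q x a W - pv S P x a W\<bar> \<le> \<kappa> / (sp_norm S W + 1) * pvar S P x a W + \<kappa>"
      if "\<gamma> \<in> gamma_grid n" "x < S" "a < A" "j \<le> n\<^sup>2" "W = pinned_val S A ?Q r \<gamma> x (real j / real n)"
        "\<kappa> = sqrt (L * (sp_norm S W + 1) / real n)" "\<kappa> \<le> 1" for \<gamma> x a j W \<kappa>
      using conjunct1[OF dev[OF \<omega>(2)]] that unfolding Let_def by auto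
    have "max (L_hat S A \<delta> n solve \<omega> (gsel \<omega>)) 0 \<le> gain P r (det_pol (?d (gsel \<omega>))) s
        \<and> \<rho> - 4 * (alpha S A \<delta> n)\<^sup>2 * sqrt (B / real n) \<le> max (L_hat S A \<delta> n solve \<omega> (gsel \<omega>)) 0"
      if s: "s < S" for s
      using dev[OF \<omega>(2)] gsel(1) gsel(2)[where \<omega> = \<omega>] s unfolding Lhat
      by (intro conjI algorithm_guarantee[where d = ?d and U = ?U and \<gamma>s = "gsel \<omega>",
        OF finite_mdp_axioms mdpQ r S n L1 \<alpha> h B1 opt opt_eq \<rho>(1) solved devs]) auto
    then show ?thesis by (simp add: Let_def \<rho>(2) B_def)
  qed
  have "1 - \<delta> \<le> 1 - measure_pmf.prob ?p bad" using bad by simp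
  also have "\<dots> = measure_pmf.prob ?p (- bad)" using measure_pmf.prob_compl[of bad ?p] by (simp add: Compl_eq_Diff_UNIV)
  also have "\<dots> = measure_pmf.prob ?p (- bad \<inter> set_pmf ?p)" by (simp add: measure_Int_set_pmf)
  also have "\<dots> \<le> measure_pmf.prob ?p ?G"
    using good by (intro measure_pmf.finite_measure_mono) auto
  finally show "1 - \<delta> \<le> measure_pmf.prob ?p ?G" .
qed

end
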